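(* Assume that the filtration $\mathbb{F}$ is left-continuous at $1$, i.e. $\sigma\big(\bigcup_{t<1}\mathcal{F}_t\big)=\mathcal{F}_1$. Let $X=\{X(t),t\in[0,1]\}$ be an $\mathbb{F}$-adapted process and let $\alpha>\frac12$, $\delta>0$ be constants such that, for some positive constants $C$ (not necessarily the same in (i) and (ii)): (i) for every $s,t\in[0,1]$, $|X(t)-X(s)|\le C|t-s|^{\alpha}$; (ii) for every $s,t\in[1-\delta,1]$ with $t=s+\Delta$, $\Delta>0$, and every $\epsilon>0$ with $\epsilon\le\Delta^{\alpha}$, $$P\Big(\sup_{s\le u\le t}|X(u)-X(s)|\le\epsilon\Big)\le\exp\big(-C\Delta\,\epsilon^{-1/\alpha}\big).$$ Then for any $\mathcal{F}_1$-measurable random variable $\xi$ there exists an $\mathbb{F}$-adapted process $\psi$ such that the integral $\int_0^t\psi(s)\,dX(s)$ exists for every $t<1$ and $$\lim_{t\to1-}\int_0^t\psi(s)\,dX(s)=\xi$$ almost surely.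
   Context: $(\Omega,\mathcal{F},\mathbb{F}=\{\mathcal{F}_t,t\in[0,1]\},P)$ is a stochastic basis (filtered probability space). Integrals with respect to $X$ are pathwise generalized Lebesgue--Stieltjes integrals, defined as follows. For $f,g:[a,b]\to\mathbb{R}$ and $\beta\in(0,1)$ put $$(D_{a+}^{\beta}f)(x)=\frac{1}{\Gamma(1-\beta)}\Big(\frac{f(x)}{(x-a)^\beta}+\beta\int_a^x\frac{f(x)-f(u)}{(x-u)^{\beta+1}}du\Big),$$ $$(D_{b-}^{1-\beta}g)(x)=\frac{e^{i\pi(1-\beta)}}{\Gamma(\beta)}\Big(\frac{g(x)}{(b-x)^{1-\beta}}+(1-\beta)\int_x^b\frac{g(x)-g(u)}{(u-x)^{2-\beta}}du\Big),$$ and $g_{b-}(x)=g(x)-g(b)$. If $D_{a+}^\beta f\in L_1[a,b]$ and $D_{b-}^{1-\beta}g_{b-}\in L_\infty[a,b]$, then $$\int_a^b f(x)\,dg(x)=e^{i\pi\beta}\int_a^b(D_{a+}^\beta f)(x)(D_{b-}^{1-\beta}g_{b-})(x)\,dx.$$ If $g$ is $\alpha$-H\"older continuous on $[a,b]$, the admissible integrands are the functions $f$ with $$\|f\|_{\beta;[a,b]}=\int_a^b\Big(\frac{|f(t)|}{(t-a)^\beta}+\int_a^t\frac{|f(t)-f(s)|}{(t-s)^{\beta+1}}ds\Big)dt<\infty$$ for some $\beta\in(1-\alpha,1)$; for these the integral is well defined, and "the integral exists" means this (pathwise, almost surely). *)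

theory Defs
  imports "HOL-Probability.Probability"
begin

definition stochastic_basis :: "'a measure \<Rightarrow> (real \<Rightarrow> 'a measure) \<Rightarrow> bool" where
  "stochastic_basis M F \<longleftrightarrow> prob_space M \<and>
     (\<forall>t\<in>{0..1}. subalgebra M (F t)) \<and>
     (\<forall>s\<in>{0..1}. \<forall>t\<in>{0..1}. s \<le> t \<longrightarrow> sets (F s) \<subseteq> sets (F t))"

definition adapted :: "(real \<Rightarrow> 'a measure) \<Rightarrow> (real \<Rightarrow> 'a \<Rightarrow> real) \<Rightarrow> bool" where
  "adapted F Y \<longleftrightarrow> (\<forall>t\<in>{0..1}. Y t \<in> borel_measurable (F t))"

definition left_continuous_at_1 :: "'a measure \<Rightarrow> (real \<Rightarrow> 'a measure) \<Rightarrow> bool" where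
  "left_continuous_at_1 M F \<longleftrightarrow>
     sigma_sets (space M) (\<Union>t\<in>{0..<1}. sets (F t)) = sets (F 1)"

section \<open>Fractional derivatives of order \<open>\<gamma> \<in> (0,1)\<close>\<close>

definition frac_deriv_left :: "real \<Rightarrow> real \<Rightarrow> (real \<Rightarrow> real) \<Rightarrow> real \<Rightarrow> real" where
  "frac_deriv_left \<gamma> a f x = 1 / Gamma (1 - \<gamma>) *
     (f x / (x - a) powr \<gamma> + \<gamma> * (LINT u:{a..x}|lebesgue. (f x - f u) / (x - u) powr (\<gamma> + 1)))"

definition frac_deriv_right :: "real \<Rightarrow> real \<Rightarrow> (real \<Rightarrow> real) \<Rightarrow> real \<Rightarrow> complex" where
  "frac_deriv_right \<gamma> b g x = exp (\<i> * of_real (pi * \<gamma>)) / of_real (Gamma (1 - \<gamma>)) *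
     of_real (g x / (b - x) powr \<gamma> + \<gamma> * (LINT u:{x..b}|lebesgue. (g x - g u) / (u - x) powr (\<gamma> + 1)))"

text \<open>A Bochner integral that does not exist has value 0, so membership in \<open>L\<^sub>1\<close> or \<open>L\<^sub>\<infinity>\<close>
  includes that the inner integral converges almost everywhere.\<close>

definition frac_deriv_left_in_L1 :: "real \<Rightarrow> real \<Rightarrow> real \<Rightarrow> (real \<Rightarrow> real) \<Rightarrow> bool" where
  "frac_deriv_left_in_L1 \<gamma> a b f \<longleftrightarrow>
     (AE x in lebesgue. x \<in> {a..b} \<longrightarrow>
        set_integrable lebesgue {a..x} (\<lambda>u. (f x - f u) / (x - u) powr (\<gamma> + 1))) \<and>
     set_integrable lebesgue {a..b} (frac_deriv_left \<gamma> a f)"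

definition frac_deriv_right_in_Linf :: "real \<Rightarrow> real \<Rightarrow> real \<Rightarrow> (real \<Rightarrow> real) \<Rightarrow> bool" where
  "frac_deriv_right_in_Linf \<gamma> a b g \<longleftrightarrow>
     (AE x in lebesgue. x \<in> {a..b} \<longrightarrow>
        set_integrable lebesgue {x..b} (\<lambda>u. (g x - g u) / (u - x) powr (\<gamma> + 1))) \<and>
     set_borel_measurable lebesgue {a..b} (frac_deriv_right \<gamma> b g) \<and>
     (\<exists>K. AE x in lebesgue. x \<in> {a..b} \<longrightarrow> norm (frac_deriv_right \<gamma> b g x) \<le> K)"

section \<open>The generalized Lebesgue--Stieltjes integral\<close>

definition has_gls_integral_of_order ::
  "real \<Rightarrow> (real \<Rightarrow> real) \<Rightarrow> (real \<Rightarrow> real) \<Rightarrow> real \<Rightarrow> real \<Rightarrow> real \<Rightarrow> bool" where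
  "has_gls_integral_of_order \<beta> f g a b I \<longleftrightarrow>
     frac_deriv_left_in_L1 \<beta> a b f \<and>
     frac_deriv_right_in_Linf (1 - \<beta>) a b (\<lambda>x. g x - g b) \<and>
     complex_of_real I = exp (\<i> * of_real (pi * \<beta>)) *
       (LINT x:{a..b}|lebesgue. of_real (frac_deriv_left \<beta> a f x) *
          frac_deriv_right (1 - \<beta>) b (\<lambda>x. g x - g b) x)"

definition frac_norm :: "real \<Rightarrow> real \<Rightarrow> real \<Rightarrow> (real \<Rightarrow> real) \<Rightarrow> ennreal" where
  "frac_norm \<beta> a b f =
     (\<integral>\<^sup>+t\<in>{a..b}. (ennreal (\<bar>f t\<bar> / (t - a) powr \<beta>) +
        (\<integral>\<^sup>+s\<in>{a..t}. ennreal (\<bar>f t - f s\<bar> / (t - s) powr (\<beta> + 1)) \<partial>lebesgue)) \<partial>lebesgue)"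

text \<open>\<open>f\<close> is an admissible integrand for an \<open>\<alpha>\<close>-Hoelder continuous integrator \<open>g\<close> on \<open>[a,b]\<close>,
  and its integral is \<open>I\<close>.  The value does not depend on the order \<open>\<beta>\<close>.  The condition
  \<open>0 < \<beta>\<close> only matters if \<open>\<alpha> > 1\<close>.  Measurability of \<open>f\<close> is implicit in the finiteness
  of the norm, but the library's \<open>nn_integral\<close> also has a value for non-measurable integrands.\<close>

definition has_gls_integral ::
  "real \<Rightarrow> (real \<Rightarrow> real) \<Rightarrow> (real \<Rightarrow> real) \<Rightarrow> real \<Rightarrow> real \<Rightarrow> real \<Rightarrow> bool" where
  "has_gls_integral \<alpha> f g a b I \<longleftrightarrow>
     (\<exists>\<beta>. 0 < \<beta> \<and> 1 - \<alpha> < \<beta> \<and> \<beta> < 1 \<and>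
        set_borel_measurable lebesgue {a..b} f \<and>
        frac_norm \<beta> a b f < \<infinity> \<and>
        has_gls_integral_of_order \<beta> f g a b I)"

end

theory Submission
  imports Defs
begin

text \<open>On a short interval \<open>[a,b]\<close> near 1 the integrand \<open>2 (X(s) - X(a)) / \<theta>\<^sup>2\<close>, switched off once
  \<open>\<bar>X - X(a)\<bar>\<close> reaches \<open>\<theta>\<close>, has integral 1 unless \<open>X\<close> stays \<open>\<theta>\<close>-close to \<open>X(a)\<close>, and the small ball
  estimate makes this unlikely for small \<open>\<theta>\<close>.  It can be replaced by a step function on a fine
  deterministic grid, because \<open>\<alpha> > 1/2\<close> makes the quadratic variation along the grid negligible.
  Let \<open>\<zeta>\<^sub>n \<rightarrow> \<xi>\<close> with \<open>\<zeta>\<^sub>n\<close> measurable at time \<open>t\<^sub>n \<rightarrow> 1\<close>; on \<open>[t\<^sub>n, t\<^sub>n\<^sub>+\<^sub>1]\<close> use such an integrand, multiplied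
  by \<open>\<zeta>\<^sub>n\<close> minus the current value of the integral.  By Borel--Cantelli all but finitely many stages
  succeed, and the integral follows \<open>\<zeta>\<^sub>n\<close> to \<open>\<xi>\<close>.

  For a step function the generalized Lebesgue--Stieltjes integral has to be computed from the
  definition.  The left derivative of the indicator of \<open>(c,\<infinity>)\<close> is a multiple of \<open>(x - c)\<^sup>-\<^sup>\<beta>\<close> on \<open>x > c\<close>,
  so the value \<open>g(b) - g(c)\<close> is the inversion formula for the Marchaud derivative.  This is shown by
  truncating the Marchaud integral at \<open>\<epsilon>\<close>, where Fubini applies and produces an approximate identity.\<close>

section \<open>Inversion of the Marchaud derivative\<close>

text \<open>A stage has only a relative error, which is multiplied by the random distance that is
  left to the target. This is why the \<open>\<zeta>\<^sub>n\<close> are taken bounded: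
  deterministic bounds for that distance are then known before any stage is chosen, and the error
  allowed in a stage is divided by them. The limit runs over continuous time, so being close to the
  target at the times \<open>t\<^sub>n\<close> does not suffice. The integral of a stage is
  therefore controlled on every path and along its whole interval: up to a small error it stays
  between 0 and 1, so the value moves only between the old one and the target. The coefficient comes
  from the chain rule: \<open>2 y / \<theta>\<^sup>2\<close> is the derivative of
  \<open>(y / \<theta>)\<^sup>2\<close>, which is 1 at the exit. On a grid of N steps the
  second-order correction is of order \<open>N powr (1 - 2 * \<alpha>)\<close>, and this tends to 0
  because \<alpha> > 1/2. The same inequality puts 1/2 between 1 - \<alpha> and 1, so all stages
  share the order 1/2 and their integrals can be added.\<close>

lemma has_integral_imp_set_integral_lborel:
  fixes f :: "real \<Rightarrow> real"
  assumes [measurable]: "f \<in> borel_measurable borel" and A [measurable]: "A \<in> sets borel"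
    and "\<And>x. x \<in> A \<Longrightarrow> 0 \<le> f x" and "(f has_integral I) A"
  shows "set_integrable lborel A f" and "(LINT x:A|lborel. f x) = I"
proof -
  have "I \<ge> 0"
    using assms by (intro has_integral_nonneg[OF assms(4)]) auto
  have "integral\<^sup>N lborel (\<lambda>x. ennreal (indicator A x * f x)) = ennreal I"
    using nn_integral_has_integral_lebesgue[OF assms(3,4)]
    by simp
  then have "has_bochner_integral lborel (\<lambda>x. indicator A x * f x) I"
    using \<open>I \<ge> 0\<close> assms(3)
    by (intro has_bochner_integral_nn_integral) (auto simp: indicator_def)
  then show "set_integrable lborel A f" and "(LINT x:A|lborel. f x) = I"
    by (auto simp: set_integrable_def set_lebesgue_integral_def has_bochner_integral_iff)
qed

section \<open>Integrals of powers and translations\<close>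

lemma powr_integral_from_0:
  fixes p c :: real
  assumes "p > -1" "c \<ge> 0"
  shows "set_integrable lborel {0..c} (\<lambda>x. x powr p)"
    and "(LINT x:{0..c}|lborel. x powr p) = c powr (p + 1) / (p + 1)"
  using has_integral_imp_set_integral_lborel[OF _ _ _ has_integral_powr_from_0[OF assms]] by auto

lemma powr_integral_to_inf:
  fixes p c :: real
  assumes "p < -1" "c > 0"
  shows "set_integrable lborel {c..} (\<lambda>x. x powr p)"
    and "(LINT x:{c..}|lborel. x powr p) = - (c powr (p + 1)) / (p + 1)"
  using has_integral_imp_set_integral_lborel[OF _ _ _ has_integral_powr_to_inf[OF assms]] by auto

lemma set_integral_lborel_shift:
  fixes f :: "real \<Rightarrow> real"
  shows "(LINT x:{a + c..b + c}|lborel. f x) = (LINT x:{a..b}|lborel. f (x + c))"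
    and "set_integrable lborel {a + c..b + c} f \<longleftrightarrow> set_integrable lborel {a..b} (\<lambda>x. f (x + c))"
proof -
  \<comment> \<open>The form \<open>c + 1 * x\<close> is the one in which the affine substitution
    rule delivers the argument.\<close>
  have *: "indicator {a + c..b + c} (c + 1 * x) = (indicator {a..b} x :: real)" for x
    by (auto simp: indicator_def)
  show "(LINT x:{a + c..b + c}|lborel. f x) = (LINT x:{a..b}|lborel. f (x + c))"
    unfolding set_lebesgue_integral_def
    using lborel_integral_real_affine[of 1 "\<lambda>x. indicator {a + c..b + c} x *\<^sub>R f x" c]
    by (simp only: *) (simp add: add.commute)
  show "set_integrable lborel {a + c..b + c} f \<longleftrightarrow> set_integrable lborel {a..b} (\<lambda>x. f (x + c))"
    unfolding set_integrable_def
    using lborel_integrable_real_affine_iff[of 1 "\<lambda>x. indicator {a + c..b + c} x *\<^sub>R f x" c]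
    by (simp only: *) (simp add: add.commute)
qed

text \<open>The right-sided derivative of \<open>g - g b\<close> on \<open>[a,b]\<close> is a Marchaud derivative once \<open>g\<close> is
  extended by \<open>g b\<close> beyond \<open>b\<close>: the boundary term is the contribution of \<open>v > b - x\<close>.\<close>

definition marchaud :: "real \<Rightarrow> real \<Rightarrow> (real \<Rightarrow> real) \<Rightarrow> real \<Rightarrow> real" where
  "marchaud \<beta> \<epsilon> h x = (1 - \<beta>) * (LINT v:{\<epsilon>..}|lborel. (h x - h (x + v)) * v powr (\<beta> - 2))"

text \<open>The assumptions on \<open>h\<close> serve the two ends of the Marchaud integral. Hoelder
  continuity weakens the singularity at \<open>v = 0\<close> to
  \<open>v powr (\<alpha> + \<beta> - 2)\<close>, which is integrable as \<alpha> + \<beta> > 1;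
  boundedness leaves \<open>v powr (\<beta> - 2)\<close> at infinity, integrable as \<beta> <
  1.\<close>

locale marchaud_hoelder =
  fixes \<alpha> \<beta> C H :: real and h :: "real \<Rightarrow> real"
  assumes beta: "0 < \<beta>" "\<beta> < 1" "1 - \<alpha> < \<beta>"
    and C: "C \<ge> 0"
    and hoelder: "\<bar>h x - h y\<bar> \<le> C * \<bar>x - y\<bar> powr \<alpha>"
    and bounded: "\<bar>h x\<bar> \<le> H"
    and borel [measurable]: "h \<in> borel_measurable borel"
begin

section \<open>Truncated Marchaud integrals of bounded Hoelder functions\<close>

lemma H_nonneg: "H \<ge> 0"
  using bounded[of 0] by linarith

lemma abs_marchaud_integrand_le:
  assumes "v \<ge> 0"
  shows "\<bar>(h x - h (x + v)) * v powr (\<beta> - 2)\<bar> \<le> C * v powr (\<alpha> + \<beta> - 2)"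
proof -
  have "\<bar>h x - h (x + v)\<bar> * v powr (\<beta> - 2) \<le> (C * v powr \<alpha>) * v powr (\<beta> - 2)"
    using hoelder[of x "x + v"] assms by (intro mult_right_mono) auto
  also have "\<dots> = C * v powr (\<alpha> + \<beta> - 2)"
    by (simp add: powr_add[symmetric] algebra_simps)
  finally show ?thesis
    by (simp add: abs_mult)
qed

lemma set_integrable_near:
  assumes "\<epsilon> \<ge> 0"
  shows "set_integrable lborel {0..\<epsilon>} (\<lambda>v. (h x - h (x + v)) * v powr (\<beta> - 2))"
proof (rule set_integrable_bound)
  show "set_integrable lborel {0..\<epsilon>} (\<lambda>v. C * v powr (\<alpha> + \<beta> - 2))"
    using powr_integral_from_0(1)[of "\<alpha> + \<beta> - 2" \<epsilon>] beta assms
    by (intro set_integrable_mult_right) auto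
  show "AE v in lborel. v \<in> {0..\<epsilon>} \<longrightarrow>
      norm ((h x - h (x + v)) * v powr (\<beta> - 2)) \<le> norm (C * v powr (\<alpha> + \<beta> - 2))"
    using abs_marchaud_integrand_le C by (auto simp: abs_mult)
qed (auto simp: set_borel_measurable_def)

lemma abs_integral_near_le:
  assumes "\<epsilon> \<ge> 0"
  shows "\<bar>LINT v:{0..\<epsilon>}|lborel. (h x - h (x + v)) * v powr (\<beta> - 2)\<bar>
    \<le> C * \<epsilon> powr (\<alpha> + \<beta> - 1) / (\<alpha> + \<beta> - 1)"
proof -
  have I: "set_integrable lborel {0..\<epsilon>} (\<lambda>v. C * v powr (\<alpha> + \<beta> - 2))"
    using powr_integral_from_0(1)[of "\<alpha> + \<beta> - 2" \<epsilon>] beta assms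
    by (intro set_integrable_mult_right) auto
  have "norm (LINT v:{0..\<epsilon>}|lborel. (h x - h (x + v)) * v powr (\<beta> - 2))
      \<le> (LINT v:{0..\<epsilon>}|lborel. C * v powr (\<alpha> + \<beta> - 2))"
    unfolding set_lebesgue_integral_def
    by (intro Bochner_Integration.integral_norm_bound_integral I[unfolded set_integrable_def]
          set_integrable_near[OF assms, of x, unfolded set_integrable_def])
       (use abs_marchaud_integrand_le in \<open>auto simp: indicator_def\<close>)
  also have "\<dots> = C * \<epsilon> powr (\<alpha> + \<beta> - 1) / (\<alpha> + \<beta> - 1)"
    using powr_integral_from_0(2)[of "\<alpha> + \<beta> - 2" \<epsilon>] beta assms by (simp add: algebra_simps)
  finally show ?thesis by simp
qed

lemma set_integrable_far:
  assumes "\<epsilon> > 0"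
  shows "set_integrable lborel {\<epsilon>..} (\<lambda>v. h (x + v) * v powr (\<beta> - 2))"
    and "set_integrable lborel {\<epsilon>..} (\<lambda>v. h x * v powr (\<beta> - 2))"
    and "set_integrable lborel {\<epsilon>..} (\<lambda>v. (h x - h (x + v)) * v powr (\<beta> - 2))"
proof -
  have I: "set_integrable lborel {\<epsilon>..} (\<lambda>v. H * v powr (\<beta> - 2))"
    using powr_integral_to_inf(1)[of "\<beta> - 2" \<epsilon>] beta assms
    by (intro set_integrable_mult_right) auto
  show 1: "set_integrable lborel {\<epsilon>..} (\<lambda>v. h (x + v) * v powr (\<beta> - 2))"
    using bounded H_nonneg
    by (intro set_integrable_bound[OF I])
       (auto simp: set_borel_measurable_def abs_mult intro!: mult_right_mono)
  show 2: "set_integrable lborel {\<epsilon>..} (\<lambda>v. h x * v powr (\<beta> - 2))"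
    using bounded H_nonneg
    by (intro set_integrable_bound[OF I])
       (auto simp: set_borel_measurable_def abs_mult intro!: mult_right_mono)
  show "set_integrable lborel {\<epsilon>..} (\<lambda>v. (h x - h (x + v)) * v powr (\<beta> - 2))"
    using set_integral_diff(1)[OF 2 1] by (simp add: left_diff_distrib)
qed

text \<open>Away from the singularity the two terms of the difference can be integrated separately,
  and the first one explicitly. This separation is what the truncation is for: it lets Fubini act on
  the second term alone.\<close>

lemma marchaud_far:
  assumes "\<epsilon> > 0"
  shows "marchaud \<beta> \<epsilon> h x = \<epsilon> powr (\<beta> - 1) * h x
    - (1 - \<beta>) * (LINT v:{\<epsilon>..}|lborel. h (x + v) * v powr (\<beta> - 2))"
proof -
  have "(LINT v:{\<epsilon>..}|lborel. (h x - h (x + v)) * v powr (\<beta> - 2)) =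
    (LINT v:{\<epsilon>..}|lborel. h x * v powr (\<beta> - 2)) - (LINT v:{\<epsilon>..}|lborel. h (x + v) * v powr (\<beta> - 2))"
    using set_integral_diff(2)[OF set_integrable_far(2)[OF assms, of x] set_integrable_far(1)[OF assms, of x]]
    by (simp add: left_diff_distrib)
  also have "(LINT v:{\<epsilon>..}|lborel. h x * v powr (\<beta> - 2)) = h x * (\<epsilon> powr (\<beta> - 1) / (1 - \<beta>))"
    using powr_integral_to_inf(2)[of "\<beta> - 2" \<epsilon>] beta assms by (simp add: divide_simps) argo
  finally show ?thesis
    using beta by (simp add: marchaud_def right_diff_distrib)
qed

lemma set_integral_split:
  assumes "\<epsilon> > 0"
  shows "set_integrable lborel {0..} (\<lambda>v. (h x - h (x + v)) * v powr (\<beta> - 2))"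
    and "(LINT v:{0..}|lborel. (h x - h (x + v)) * v powr (\<beta> - 2)) =
      (LINT v:{0..\<epsilon>}|lborel. (h x - h (x + v)) * v powr (\<beta> - 2)) +
      (LINT v:{\<epsilon>..}|lborel. (h x - h (x + v)) * v powr (\<beta> - 2))"
proof -
  let ?f = "\<lambda>v. (h x - h (x + v)) * v powr (\<beta> - 2)"
  have S: "{0..} = {0..\<epsilon>} \<union> {\<epsilon>..}"
    using assms by auto
  show "set_integrable lborel {0..} ?f"
    unfolding S using assms
    by (intro set_integrable_Un set_integrable_near set_integrable_far) auto
  have "AE v in lborel. v \<noteq> \<epsilon>"
    by (rule AE_lborel_singleton)
  then show "(LINT v:{0..}|lborel. ?f v) = (LINT v:{0..\<epsilon>}|lborel. ?f v) + (LINT v:{\<epsilon>..}|lborel. ?f v)"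
    unfolding S using assms
    by (intro set_integral_Un_AE set_integrable_near set_integrable_far) auto
qed

text \<open>The bound is independent of \<open>x\<close> and its exponent \<alpha> + \<beta> - 1 is
  positive, so the truncated derivatives converge uniformly.\<close>

lemma marchaud_diff_le:
  assumes "\<epsilon> > 0"
  shows "\<bar>marchaud \<beta> 0 h x - marchaud \<beta> \<epsilon> h x\<bar>
    \<le> (1 - \<beta>) * (C * \<epsilon> powr (\<alpha> + \<beta> - 1) / (\<alpha> + \<beta> - 1))"
proof -
  have "marchaud \<beta> 0 h x - marchaud \<beta> \<epsilon> h x =
    (1 - \<beta>) * (LINT v:{0..\<epsilon>}|lborel. (h x - h (x + v)) * v powr (\<beta> - 2))"
    unfolding marchaud_def set_integral_split(2)[OF assms] by (simp add: algebra_simps)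
  also have "\<bar>\<dots>\<bar> = (1 - \<beta>) * \<bar>LINT v:{0..\<epsilon>}|lborel. (h x - h (x + v)) * v powr (\<beta> - 2)\<bar>"
    using beta by (simp add: abs_mult)
  also have "\<dots> \<le> (1 - \<beta>) * (C * \<epsilon> powr (\<alpha> + \<beta> - 1) / (\<alpha> + \<beta> - 1))"
    using abs_integral_near_le[of \<epsilon> x] assms beta by (intro mult_left_mono) auto
  finally show ?thesis .
qed

lemma marchaud_measurable [measurable]: "marchaud \<beta> \<epsilon> h \<in> borel_measurable borel"
  unfolding marchaud_def set_lebesgue_integral_def by measurable

lemma abs_marchaud_far_le:
  assumes "\<epsilon> > 0"
  shows "\<bar>marchaud \<beta> \<epsilon> h x\<bar> \<le> 2 * H * \<epsilon> powr (\<beta> - 1)"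
proof -
  have I: "set_integrable lborel {\<epsilon>..} (\<lambda>v. H * v powr (\<beta> - 2))"
    using powr_integral_to_inf(1)[of "\<beta> - 2" \<epsilon>] beta assms
    by (intro set_integrable_mult_right) auto
  have "norm (LINT v:{\<epsilon>..}|lborel. h (x + v) * v powr (\<beta> - 2)) \<le> (LINT v:{\<epsilon>..}|lborel. H * v powr (\<beta> - 2))"
    unfolding set_lebesgue_integral_def
    by (intro Bochner_Integration.integral_norm_bound_integral I[unfolded set_integrable_def]
          set_integrable_far(1)[OF assms, of x, unfolded set_integrable_def])
       (auto simp: indicator_def abs_mult bounded intro!: mult_right_mono)
  also have "\<dots> = H * (\<epsilon> powr (\<beta> - 1) / (1 - \<beta>))"
    using powr_integral_to_inf(2)[of "\<beta> - 2" \<epsilon>] beta assms by (simp add: divide_simps) argo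
  finally have "(1 - \<beta>) * \<bar>LINT v:{\<epsilon>..}|lborel. h (x + v) * v powr (\<beta> - 2)\<bar> \<le> (1 - \<beta>) * (H * (\<epsilon> powr (\<beta> - 1) / (1 - \<beta>)))"
    using beta by (intro mult_left_mono) auto
  also have "\<dots> = H * \<epsilon> powr (\<beta> - 1)" using beta by simp
  finally have "\<bar>(1 - \<beta>) * (LINT v:{\<epsilon>..}|lborel. h (x + v) * v powr (\<beta> - 2))\<bar> \<le> H * \<epsilon> powr (\<beta> - 1)"
    using beta by (simp add: abs_mult)
  moreover have "\<bar>\<epsilon> powr (\<beta> - 1) * h x\<bar> \<le> H * \<epsilon> powr (\<beta> - 1)"
    using bounded[of x] by (simp add: abs_mult mult.commute mult_right_mono)
  ultimately show ?thesis
    unfolding marchaud_far[OF assms] by linarith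
qed

text \<open>Cutting at \<open>v = 1\<close> bounds the near part by Hoelder continuity and the far
  part by boundedness. The L-infinity condition on the integrator rests on this.\<close>

lemma abs_marchaud_le: "\<exists>B. \<forall>x. \<bar>marchaud \<beta> 0 h x\<bar> \<le> B"
proof -
  have "\<bar>marchaud \<beta> 0 h x\<bar> \<le> 2 * H * 1 powr (\<beta> - 1) + (1 - \<beta>) * (C * 1 powr (\<alpha> + \<beta> - 1) / (\<alpha> + \<beta> - 1))" for x
    using marchaud_diff_le[of 1 x] abs_marchaud_far_le[of 1 x] by linarith
  then show ?thesis by blast
qed

end

section \<open>The kernel of the weighted truncated integral\<close>

lemma set_integral_lborel_scale:
  fixes f :: "real \<Rightarrow> real"
  assumes "\<epsilon> > 0"
  shows "(LINT x:{0..}|lborel. f x) = (LINT y:{0..}|lborel. \<epsilon> * f (\<epsilon> * y))"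
proof -
  have "(\<lambda>y. indicator {0..} y *\<^sub>R (\<epsilon> * f (\<epsilon> * y))) =
      (\<lambda>y. \<epsilon> *\<^sub>R (indicator {0..} (0 + \<epsilon> * y) *\<^sub>R f (0 + \<epsilon> * y)))"
    using assms by (auto simp: fun_eq_iff indicator_def zero_le_mult_iff)
  then show ?thesis
    unfolding set_lebesgue_integral_def
    using lborel_integral_real_affine[of \<epsilon> "\<lambda>x. indicator {0..} x *\<^sub>R f x" 0] assms
    by (simp only: integral_scaleR_right)
qed

text \<open>Under the substitution \<open>z = x / (u - x)\<close>, with
  \<open>dz = u / (u - x)\<^sup>2 dx\<close>, the integrand becomes
  \<open>z powr (- \<beta>) / u\<close>, and \<open>G\<close> is its primitive. The integrand is
  singular at \<open>x = 0\<close>, so the fundamental theorem is applied in the form that asks for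
  the derivative in the interior only.\<close>

lemma powr_kernel_integral:
  fixes \<beta> \<epsilon> u :: real
  assumes \<beta>: "0 < \<beta>" "\<beta> < 1" and u: "0 < \<epsilon>" "\<epsilon> \<le> u"
  shows "(LINT x:{0..u - \<epsilon>}|lborel. x powr (- \<beta>) * (u - x) powr (\<beta> - 2)) =
    ((u - \<epsilon>) / \<epsilon>) powr (1 - \<beta>) / ((1 - \<beta>) * u)"
proof -
  define G where "G x = (x / (u - x)) powr (1 - \<beta>) / ((1 - \<beta>) * u)" for x
  have "(G has_vector_derivative x powr (- \<beta>) * (u - x) powr (\<beta> - 2)) (at x)"
    if x: "x \<in> {0<..<u - \<epsilon>}" for x
  proof -
    have "x > 0" "u - x > 0" "x < u" "u > 0" using x u by auto
    then have "(G has_real_derivative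
        ((1 - \<beta>) * (x / (u - x)) powr (1 - \<beta> - 1) * (u / (u - x)\<^sup>2)) / ((1 - \<beta>) * u)) (at x)"
      unfolding G_def
      by (intro DERIV_cdivide DERIV_fun_powr[where g = "\<lambda>x. x / (u - x)", THEN DERIV_cong])
         (auto intro!: derivative_eq_intros simp: power2_eq_square)
    moreover have "(1 - \<beta>) * (x / (u - x)) powr (1 - \<beta> - 1) * (u / (u - x)\<^sup>2) / ((1 - \<beta>) * u) =
        (x / (u - x)) powr (- \<beta>) * (1 / (u - x)\<^sup>2)"
      using \<open>u > 0\<close> \<beta> by (simp add: divide_simps)
    moreover have "\<dots> = x powr (- \<beta>) * (u - x) powr (\<beta> - 2)"
      using \<open>x > 0\<close> \<open>u - x > 0\<close>
      by (simp add: powr_divide powr_minus powr_diff field_simps)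
    ultimately show ?thesis
      by (simp add: has_real_derivative_iff_has_vector_derivative)
  qed
  moreover have "continuous_on {0..u - \<epsilon>} G"
    unfolding G_def using u \<beta> by (intro continuous_intros continuous_on_powr') auto
  ultimately have "((\<lambda>x. x powr (- \<beta>) * (u - x) powr (\<beta> - 2)) has_integral (G (u - \<epsilon>) - G 0)) {0..u - \<epsilon>}"
    using u by (intro fundamental_theorem_of_calculus_interior) auto
  then have "(LINT x:{0..u - \<epsilon>}|lborel. x powr (- \<beta>) * (u - x) powr (\<beta> - 2)) = G (u - \<epsilon>) - G 0"
    by (intro has_integral_imp_set_integral_lborel(2)) auto
  then show ?thesis
    by (simp add: G_def)
qed

text \<open>The kernel that appears when the truncated Marchaud integral is paired with \<open>x\<^sup>-\<^sup>\<beta>\<close> and rescaled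
  by the truncation parameter.\<close>

definition riesz_kernel :: "real \<Rightarrow> real \<Rightarrow> real" where
  "riesz_kernel \<beta> y = y powr (- \<beta>) - max 0 (y - 1) powr (1 - \<beta>) / y"

lemma riesz_kernel_measurable [measurable]: "riesz_kernel \<beta> \<in> borel_measurable borel"
  unfolding riesz_kernel_def by measurable

text \<open>On [0,1] the second term vanishes. At infinity the leading terms cancel: the kernel is
  \<open>y powr (- \<beta>)\<close> times \<open>1 - (1 - 1 / y) powr (1 - \<beta>)\<close>, and
  this factor lies between 0 and \<open>1 / y\<close>.\<close>

lemma set_integrable_riesz_kernel:
  assumes \<beta>: "0 < \<beta>" "\<beta> < 1"
  shows "set_integrable lborel {0..} (riesz_kernel \<beta>)"
proof -
  have S: "{0..} = {0..1::real} \<union> {1..}"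
    by auto
  have 1: "set_integrable lborel {0..1} (riesz_kernel \<beta>)"
  proof (rule set_integrable_bound)
    show "set_integrable lborel {0..1} (\<lambda>y. y powr (- \<beta>))"
      using \<beta> by (intro powr_integral_from_0) auto
  qed (auto simp: set_borel_measurable_def riesz_kernel_def)
  have 2: "set_integrable lborel {1..} (riesz_kernel \<beta>)"
  proof (rule set_integrable_bound)
    show "set_integrable lborel {1..} (\<lambda>y. y powr (- \<beta> - 1))"
      using \<beta> by (intro powr_integral_to_inf) auto
    have "\<bar>riesz_kernel \<beta> y\<bar> \<le> y powr (- \<beta> - 1)" if "y \<ge> 1" for y
    proof -
      have q: "0 \<le> 1 - 1 / y" "1 - 1 / y \<le> 1" using that by auto
      have "(y - 1) powr (1 - \<beta>) / y = (y * (1 - 1 / y)) powr (1 - \<beta>) / y"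
        using that by (simp add: right_diff_distrib)
      also have "\<dots> = (y powr (1 - \<beta>) / y) * (1 - 1 / y) powr (1 - \<beta>)"
        using that q by (subst powr_mult) auto
      also have "y powr (1 - \<beta>) / y = y powr (- \<beta>)"
        using that by (simp add: powr_diff powr_minus field_simps)
      finally have "riesz_kernel \<beta> y = y powr (- \<beta>) * (1 - (1 - 1 / y) powr (1 - \<beta>))"
        using that by (simp add: riesz_kernel_def algebra_simps)
      moreover have "(1 - 1 / y) powr 1 \<le> (1 - 1 / y) powr (1 - \<beta>)"
        using q \<beta> by (intro powr_mono') auto
      then have "1 - (1 - 1 / y) powr (1 - \<beta>) \<le> 1 / y" using q by simp
      moreover have "(1 - 1 / y) powr (1 - \<beta>) \<le> 1"
        using q \<beta> by (intro powr_le1) auto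
      ultimately have "\<bar>riesz_kernel \<beta> y\<bar> \<le> y powr (- \<beta>) * (1 / y)"
        by (simp only: abs_mult abs_of_nonneg[OF powr_ge_zero]) (intro mult_mono, auto)
      also have "\<dots> = y powr (- \<beta> - 1)"
        using that by (simp add: powr_diff)
      finally show ?thesis .
    qed
    then show "AE y in lborel. y \<in> {1..} \<longrightarrow> norm (riesz_kernel \<beta> y) \<le> norm (y powr (- \<beta> - 1))"
      by auto
  qed (auto simp: set_borel_measurable_def)
  show ?thesis
    unfolding S by (intro set_integrable_Un 1 2) auto
qed

text \<open>The integrals below run over \<open>x \<ge> 0\<close>, so vanishing from
  \<open>T\<close> on amounts to compact support there.\<close>

locale marchaud_compact = marchaud_hoelder +
  fixes T :: real
  assumes T: "T \<ge> 0" and support: "x \<ge> T \<Longrightarrow> h x = 0"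
begin

section \<open>Pairing the Marchaud derivative with a power weight\<close>

lemma marchaud_eq_0:
  assumes "x \<ge> T" "\<epsilon> \<ge> 0"
  shows "marchaud \<beta> \<epsilon> h x = 0"
proof -
  have "(\<lambda>v. indicator {\<epsilon>..} v *\<^sub>R ((h x - h (x + v)) * v powr (\<beta> - 2))) = (\<lambda>v. 0)"
    using assms by (auto simp: indicator_def support)
  then show ?thesis
    by (simp add: marchaud_def set_lebesgue_integral_def)
qed

lemma marchaud_eq_boundary:
  assumes "x < T"
  shows "marchaud \<beta> 0 h x = h x * (T - x) powr (\<beta> - 1) +
    (1 - \<beta>) * (LINT v:{0..T - x}|lborel. (h x - h (x + v)) * v powr (\<beta> - 2))"
proof -
  have "(LINT v:{T - x..}|lborel. (h x - h (x + v)) * v powr (\<beta> - 2)) = (LINT v:{T - x..}|lborel. h x * v powr (\<beta> - 2))"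
    by (intro set_lebesgue_integral_cong) (auto simp: support)
  also have "\<dots> = h x * ((T - x) powr (\<beta> - 1) / (1 - \<beta>))"
    using powr_integral_to_inf(2)[of "\<beta> - 2" "T - x"] beta assms by (simp add: divide_simps) argo
  finally show ?thesis
    using assms beta set_integral_split(2)[of "T - x" x]
    by (simp add: marchaud_def distrib_left)
qed

lemma set_integrable_weight: "set_integrable lborel {0..T} (\<lambda>x. B * x powr (- \<beta>))"
  using powr_integral_from_0(1)[of "- \<beta>" T] beta T by (intro set_integrable_mult_right) auto

lemma set_integrable_bounded_support:
  assumes [measurable]: "f \<in> borel_measurable borel"
    and B: "\<And>x. \<bar>f x\<bar> \<le> B" and f: "\<And>x. x \<ge> T \<Longrightarrow> f x = 0"
  shows "set_integrable lborel {0..} (\<lambda>x. x powr (- \<beta>) * f x)"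
  unfolding set_integrable_def
proof (rule Bochner_Integration.integrable_bound)
  show "integrable lborel (\<lambda>x. indicator {0..T} x *\<^sub>R (B * x powr (- \<beta>)))"
    using set_integrable_weight unfolding set_integrable_def .
  have "\<bar>x powr (- \<beta>) * f x\<bar> \<le> \<bar>B * x powr (- \<beta>)\<bar>" for x
    using B[of x] by (simp add: abs_mult mult.commute mult_right_mono)
  then show "AE x in lborel. norm (indicator {0..} x *\<^sub>R (x powr (- \<beta>) * f x))
      \<le> norm (indicator {0..T} x *\<^sub>R (B * x powr (- \<beta>)))"
    using f by (auto simp: indicator_def not_le)
qed auto

text \<open>By \<open>marchaud_far\<close> the left side contains a double integral over
  \<open>x \<ge> 0\<close> and \<open>u \<ge> x + \<epsilon>\<close>. Integrating over
  \<open>x\<close> first is the content of \<open>powr_kernel_integral\<close> and leaves a single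
  integral of \<open>h u\<close> against an explicit kernel; the scaling
  \<open>u = \<epsilon> * y\<close> then removes \<epsilon> from the kernel.\<close>

lemma weighted_marchaud_far:
  assumes \<epsilon>: "\<epsilon> > 0"
  shows "(LINT x:{0..}|lborel. x powr (- \<beta>) * marchaud \<beta> \<epsilon> h x) =
    (LINT y:{0..}|lborel. h (\<epsilon> * y) * riesz_kernel \<beta> y)"
proof -
  \<comment> \<open>The second variable is \<open>u = x + v\<close>, so that \<open>h\<close> no
    longer depends on \<open>x\<close>.\<close>
  define f where "f = (\<lambda>(x, u). indicator {0..} x * x powr (- \<beta>) *
    (if x + \<epsilon> \<le> u then h u * (u - x) powr (\<beta> - 2) else 0))"
  have [measurable]: "f \<in> borel_measurable (lborel \<Otimes>\<^sub>M lborel)"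
    unfolding f_def by measurable
  \<comment> \<open>The cut-off keeps \<open>u - x\<close> above \<epsilon>, which bounds the
    singular factor by \<open>\<epsilon> powr (\<beta> - 2)\<close>, and the support of
    \<open>h\<close> confines \<open>u\<close>, hence also \<open>x\<close>, to [0,T]. The majorant
    is a product, so its integrability is elementary.\<close>
  have bnd: "\<bar>f (x, u)\<bar> \<le> indicator {0..T} x * (x powr (- \<beta>) * (H * \<epsilon> powr (\<beta> - 2))) * indicator {0..T} u" for x u
  proof (cases "0 \<le> x \<and> x + \<epsilon> \<le> u \<and> u < T")
    case True
    have "(u - x) powr (\<beta> - 2) \<le> \<epsilon> powr (\<beta> - 2)"
      using True \<epsilon> beta by (intro powr_mono2') auto
    then have "\<bar>h u\<bar> * (u - x) powr (\<beta> - 2) \<le> H * \<epsilon> powr (\<beta> - 2)"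
      using bounded[of u] H_nonneg by (intro mult_mono) auto
    then have "x powr (- \<beta>) * (\<bar>h u\<bar> * (u - x) powr (\<beta> - 2)) \<le> x powr (- \<beta>) * (H * \<epsilon> powr (\<beta> - 2))"
      by (intro mult_left_mono) auto
    then show ?thesis
      using True \<epsilon> by (simp add: f_def abs_mult)
  next
    case False
    then have "f (x, u) = 0"
      by (auto simp: f_def indicator_def support)
    then show ?thesis using H_nonneg by (simp add: zero_le_mult_iff)
  qed
  have "integrable (lborel \<Otimes>\<^sub>M lborel) f"
  proof (rule Bochner_Integration.integrable_bound)
    let ?g = "\<lambda>(x, u). indicator {0..T} x * (x powr (- \<beta>) * (H * \<epsilon> powr (\<beta> - 2))) * indicator {0..T} u :: real"
    have "set_integrable lborel {0..T} (\<lambda>x. x powr (- \<beta>) * (H * \<epsilon> powr (\<beta> - 2)))"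
      using set_integrable_weight[of "H * \<epsilon> powr (\<beta> - 2)"] by (simp add: mult.commute)
    then have i: "integrable lborel (\<lambda>x. indicator {0..T} x * (x powr (- \<beta>) * (H * \<epsilon> powr (\<beta> - 2))))"
      by (simp add: set_integrable_def)
    show "integrable (lborel \<Otimes>\<^sub>M lborel) ?g"
    proof (rule lborel_pair.Fubini_integrable)
      show "integrable lborel (\<lambda>x. \<integral>y. norm (?g (x, y)) \<partial>lborel)"
        using integrable_mult_left[OF integrable_norm[OF i], of T] T
        by (simp add: abs_mult ac_simps)
      have "integrable lborel (indicator {0..T} :: real \<Rightarrow> real)"
        by (rule integrable_real_indicator) (auto simp: emeasure_lborel_Icc_eq)
      then show "AE x in lborel. integrable lborel (\<lambda>y. ?g (x, y))"
        by simp
    qed measurable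
    show "AE x in lborel \<Otimes>\<^sub>M lborel. norm (f x) \<le> norm (?g x)"
      using bnd by (auto intro!: AE_I2 order_trans[OF bnd])
  qed auto
  then have fub: "(\<integral>x. (\<integral>u. f (x, u) \<partial>lborel) \<partial>lborel) = (\<integral>u. (\<integral>x. f (x, u) \<partial>lborel) \<partial>lborel)"
    and intu: "integrable lborel (\<lambda>u. \<integral>x. f (x, u) \<partial>lborel)"
    and intx: "integrable lborel (\<lambda>x. \<integral>u. f (x, u) \<partial>lborel)"
    using lborel_pair.Fubini_integral[of "\<lambda>x u. f (x, u)"]
      lborel_pair.integrable_fst'[of f] lborel_pair.integrable_snd[of "\<lambda>x u. f (x, u)"] by auto
  have inner_u: "(\<integral>u. f (x, u) \<partial>lborel) =
      indicator {0..} x * (x powr (- \<beta>) * (LINT v:{\<epsilon>..}|lborel. h (x + v) * v powr (\<beta> - 2)))" for x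
  proof -
    have "(\<integral>u. f (x, u) \<partial>lborel) = indicator {0..} x * x powr (- \<beta>) *
       (\<integral>u. (if x + \<epsilon> \<le> u then h u * (u - x) powr (\<beta> - 2) else 0) \<partial>lborel)"
      unfolding f_def by simp
    also have "(\<integral>u. (if x + \<epsilon> \<le> u then h u * (u - x) powr (\<beta> - 2) else 0) \<partial>lborel) =
      (LINT v:{\<epsilon>..}|lborel. h (x + v) * v powr (\<beta> - 2))"
      unfolding set_lebesgue_integral_def
      by (subst lborel_integral_real_affine[of 1 _ x])
         (auto simp: indicator_def intro!: Bochner_Integration.integral_cong)
    finally show ?thesis by simp
  qed
  have inner_x: "(\<integral>x. f (x, u) \<partial>lborel) =
      indicator {0..} u * (h u * (max 0 (u - \<epsilon>) / \<epsilon>) powr (1 - \<beta>) / ((1 - \<beta>) * u))" for u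
  proof (cases "\<epsilon> \<le> u")
    case True
    have "(\<lambda>x. f (x, u)) =
        (\<lambda>x. h u * (indicator {0..u - \<epsilon>} x *\<^sub>R (x powr (- \<beta>) * (u - x) powr (\<beta> - 2))))"
      by (auto simp: fun_eq_iff f_def indicator_def)
    then have "(\<integral>x. f (x, u) \<partial>lborel) = h u * (LINT x:{0..u - \<epsilon>}|lborel. x powr (- \<beta>) * (u - x) powr (\<beta> - 2))"
      unfolding set_lebesgue_integral_def by simp
    also have "\<dots> = h u * (((u - \<epsilon>) / \<epsilon>) powr (1 - \<beta>) / ((1 - \<beta>) * u))"
      using powr_kernel_integral[of \<beta> \<epsilon> u] beta \<epsilon> True by simp
    finally show ?thesis using True \<epsilon> by simp
  next
    case False
    then have "f (x, u) = 0" for x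
      by (auto simp: f_def indicator_def)
    with False show ?thesis by simp
  qed
  have int1: "set_integrable lborel {0..} (\<lambda>x. x powr (- \<beta>) * h x)"
    using bounded support by (intro set_integrable_bounded_support) auto
  have Q: "set_integrable lborel {0..} (\<lambda>x. x powr (- \<beta>) * (LINT v:{\<epsilon>..}|lborel. h (x + v) * v powr (\<beta> - 2)))"
    using intx unfolding inner_u set_integrable_def by simp
  have R: "set_integrable lborel {0..} (\<lambda>u. h u * (max 0 (u - \<epsilon>) / \<epsilon>) powr (1 - \<beta>) / ((1 - \<beta>) * u))"
    using intu unfolding inner_x set_integrable_def by simp
  have "(LINT x:{0..}|lborel. x powr (- \<beta>) * marchaud \<beta> \<epsilon> h x) =
    (LINT x:{0..}|lborel. \<epsilon> powr (\<beta> - 1) * (x powr (- \<beta>) * h x) -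
      (1 - \<beta>) * (x powr (- \<beta>) * (LINT v:{\<epsilon>..}|lborel. h (x + v) * v powr (\<beta> - 2))))"
    unfolding marchaud_far[OF \<epsilon>] by (simp add: algebra_simps)
  also have "\<dots> = (LINT x:{0..}|lborel. \<epsilon> powr (\<beta> - 1) * (x powr (- \<beta>) * h x)) -
      (LINT x:{0..}|lborel. (1 - \<beta>) * (x powr (- \<beta>) * (LINT v:{\<epsilon>..}|lborel. h (x + v) * v powr (\<beta> - 2))))"
    using int1 Q by (intro set_integral_diff) auto
  also have "(LINT x:{0..}|lborel. (1 - \<beta>) * (x powr (- \<beta>) * (LINT v:{\<epsilon>..}|lborel. h (x + v) * v powr (\<beta> - 2)))) =
     (1 - \<beta>) * (\<integral>x. (\<integral>u. f (x, u) \<partial>lborel) \<partial>lborel)"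
    unfolding inner_u set_integral_mult_right by (simp add: set_lebesgue_integral_def)
  also have "\<dots> = (LINT u:{0..}|lborel. (1 - \<beta>) * (h u * (max 0 (u - \<epsilon>) / \<epsilon>) powr (1 - \<beta>) / ((1 - \<beta>) * u)))"
    unfolding fub inner_x set_integral_mult_right by (simp add: set_lebesgue_integral_def)
  also have "(LINT x:{0..}|lborel. \<epsilon> powr (\<beta> - 1) * (x powr (- \<beta>) * h x)) - \<dots> =
    (LINT u:{0..}|lborel. \<epsilon> powr (\<beta> - 1) * (u powr (- \<beta>) * h u) -
       (1 - \<beta>) * (h u * (max 0 (u - \<epsilon>) / \<epsilon>) powr (1 - \<beta>) / ((1 - \<beta>) * u)))"
    using int1 R by (intro set_integral_diff(2)[symmetric] set_integrable_mult_right) auto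
  also have "\<dots> = (LINT y:{0..}|lborel. \<epsilon> * (\<epsilon> powr (\<beta> - 1) * ((\<epsilon> * y) powr (- \<beta>) * h (\<epsilon> * y)) -
       (1 - \<beta>) * (h (\<epsilon> * y) * (max 0 (\<epsilon> * y - \<epsilon>) / \<epsilon>) powr (1 - \<beta>) / ((1 - \<beta>) * (\<epsilon> * y)))))"
    by (rule set_integral_lborel_scale[OF \<epsilon>])
  also have "\<dots> = (LINT y:{0..}|lborel. h (\<epsilon> * y) * riesz_kernel \<beta> y)"
  proof (rule set_lebesgue_integral_cong)
    show "\<forall>y. y \<in> {0..} \<longrightarrow> \<epsilon> * (\<epsilon> powr (\<beta> - 1) * ((\<epsilon> * y) powr (- \<beta>) * h (\<epsilon> * y)) -
       (1 - \<beta>) * (h (\<epsilon> * y) * (max 0 (\<epsilon> * y - \<epsilon>) / \<epsilon>) powr (1 - \<beta>) / ((1 - \<beta>) * (\<epsilon> * y)))) =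
       h (\<epsilon> * y) * riesz_kernel \<beta> y"
    proof (intro allI impI)
      fix y :: real assume "y \<in> {0..}"
      then have y: "y \<ge> 0" by simp
      have "max 0 (\<epsilon> * y - \<epsilon>) / \<epsilon> = max 0 (y - 1)"
        using \<epsilon> by (auto simp: max_def field_simps)
      moreover have "\<epsilon> * (\<epsilon> powr (\<beta> - 1) * (\<epsilon> * y) powr (- \<beta>)) = y powr (- \<beta>)"
        using \<epsilon> y by (simp add: powr_mult powr_diff powr_minus field_simps)
      ultimately show "\<epsilon> * (\<epsilon> powr (\<beta> - 1) * ((\<epsilon> * y) powr (- \<beta>) * h (\<epsilon> * y)) -
       (1 - \<beta>) * (h (\<epsilon> * y) * (max 0 (\<epsilon> * y - \<epsilon>) / \<epsilon>) powr (1 - \<beta>) / ((1 - \<beta>) * (\<epsilon> * y)))) =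
       h (\<epsilon> * y) * riesz_kernel \<beta> y"
        using \<epsilon> beta by (simp add: riesz_kernel_def right_diff_distrib)
    qed
  qed simp
  finally show ?thesis .
qed

text \<open>In \<open>weighted_marchaud_far\<close> the kernel is free of \<epsilon>, so letting
  \<epsilon> tend to 0 only turns \<open>h (\<epsilon> * y)\<close> into \<open>h 0\<close>, with
  majorant \<open>H * \<bar>riesz_kernel \<beta> y\<bar>\<close>. On the left side the truncation
  error is uniform in \<open>x\<close> and is integrated against the weight
  \<open>x powr (- \<beta>)\<close>, which has finite mass on [0,T].\<close>

lemma weighted_marchaud:
  "(LINT x:{0..T}|lborel. x powr (- \<beta>) * marchaud \<beta> 0 h x) = h 0 * (LINT y:{0..}|lborel. riesz_kernel \<beta> y)"
proof -
  define e where "e n = inverse (real (Suc n))" for n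
  have e: "e n > 0" for n by (simp add: e_def)
  have e0: "e \<longlonglongrightarrow> 0"
    unfolding e_def by (rule LIMSEQ_inverse_real_of_nat)
  have "\<alpha> > 0" using beta by linarith
  have "(\<lambda>n. LINT y:{0..}|lborel. h (e n * y) * riesz_kernel \<beta> y) \<longlonglongrightarrow>
    (LINT y:{0..}|lborel. h 0 * riesz_kernel \<beta> y)"
    unfolding set_lebesgue_integral_def
  proof (rule integral_dominated_convergence)
    have "set_integrable lborel {0..} (\<lambda>y. H * \<bar>riesz_kernel \<beta> y\<bar>)"
      using set_integrable_abs[OF set_integrable_riesz_kernel[of \<beta>]] beta by auto
    then show "integrable lborel (\<lambda>y. indicator {0..} y *\<^sub>R (H * \<bar>riesz_kernel \<beta> y\<bar>))"
      by (simp add: set_integrable_def)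
    show "AE y in lborel. norm (indicator {0..} y *\<^sub>R (h (e n * y) * riesz_kernel \<beta> y))
       \<le> indicator {0..} y *\<^sub>R (H * \<bar>riesz_kernel \<beta> y\<bar>)" for n
      using bounded by (auto simp: indicator_def abs_mult intro!: mult_right_mono)
    have "(\<lambda>n. h (e n * y)) \<longlonglongrightarrow> h 0" for y
    proof -
      have "(\<lambda>n. C * \<bar>e n * y - 0\<bar> powr \<alpha>) \<longlonglongrightarrow> C * \<bar>0 * y - 0\<bar> powr \<alpha>"
        using e0 \<open>\<alpha> > 0\<close>
        by (intro tendsto_intros tendsto_powr') auto
      then have "(\<lambda>n. C * \<bar>e n * y - 0\<bar> powr \<alpha>) \<longlonglongrightarrow> 0" by simp
      then have "(\<lambda>n. h (e n * y) - h 0) \<longlonglongrightarrow> 0"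
        by (rule Lim_null_comparison[rotated]) (use hoelder[of _ 0] in auto)
      then show ?thesis by (rule LIM_zero_cancel)
    qed
    then show "AE y in lborel. (\<lambda>n. indicator {0..} y *\<^sub>R (h (e n * y) * riesz_kernel \<beta> y))
      \<longlonglongrightarrow> indicator {0..} y *\<^sub>R (h 0 * riesz_kernel \<beta> y)"
      by (auto intro!: tendsto_intros)
  qed auto
  then have lim1: "(\<lambda>n. LINT x:{0..}|lborel. x powr (- \<beta>) * marchaud \<beta> (e n) h x) \<longlonglongrightarrow>
      h 0 * (LINT y:{0..}|lborel. riesz_kernel \<beta> y)"
    using e by (simp add: weighted_marchaud_far)
  obtain B where B: "\<And>x. \<bar>marchaud \<beta> 0 h x\<bar> \<le> B"
    using abs_marchaud_le by blast
  have I0: "set_integrable lborel {0..} (\<lambda>x. x powr (- \<beta>) * marchaud \<beta> 0 h x)"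
    using B by (intro set_integrable_bounded_support marchaud_eq_0) auto
  define W where "W = (LINT x:{0..T}|lborel. x powr (- \<beta>))"
  have diff: "\<bar>(LINT x:{0..}|lborel. x powr (- \<beta>) * marchaud \<beta> (e n) h x) -
      (LINT x:{0..}|lborel. x powr (- \<beta>) * marchaud \<beta> 0 h x)\<bar>
     \<le> ((1 - \<beta>) * (C * e n powr (\<alpha> + \<beta> - 1) / (\<alpha> + \<beta> - 1))) * W" for n
  proof -
    let ?c = "(1 - \<beta>) * (C * e n powr (\<alpha> + \<beta> - 1) / (\<alpha> + \<beta> - 1))"
    have In: "set_integrable lborel {0..} (\<lambda>x. x powr (- \<beta>) * marchaud \<beta> (e n) h x)"
      using e[of n]
      by (intro set_integrable_bounded_support[OF _ abs_marchaud_far_le[OF e[of n]]] marchaud_eq_0) auto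
    have 1: "(LINT x:{0..}|lborel. x powr (- \<beta>) * marchaud \<beta> (e n) h x) -
      (LINT x:{0..}|lborel. x powr (- \<beta>) * marchaud \<beta> 0 h x) =
      (LINT x:{0..}|lborel. x powr (- \<beta>) * marchaud \<beta> (e n) h x - x powr (- \<beta>) * marchaud \<beta> 0 h x)"
      by (rule set_integral_diff(2)[OF In I0, symmetric])
    have 2: "norm (LINT x:{0..}|lborel. x powr (- \<beta>) * marchaud \<beta> (e n) h x - x powr (- \<beta>) * marchaud \<beta> 0 h x)
        \<le> (LINT x:{0..T}|lborel. ?c * x powr (- \<beta>))"
      unfolding set_lebesgue_integral_def
    proof (intro Bochner_Integration.integral_norm_bound_integral)
      show "integrable lborel (\<lambda>x. indicator {0..} x *\<^sub>R (x powr - \<beta> * marchaud \<beta> (e n) h x - x powr - \<beta> * marchaud \<beta> 0 h x))"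
        using set_integral_diff(1)[OF In I0] by (simp add: set_integrable_def)
      show "integrable lborel (\<lambda>x. indicator {0..T} x *\<^sub>R (?c * x powr - \<beta>))"
        using set_integrable_weight[of ?c] by (simp add: set_integrable_def)
      show "norm (indicator {0..} x *\<^sub>R (x powr - \<beta> * marchaud \<beta> (e n) h x - x powr - \<beta> * marchaud \<beta> 0 h x))
         \<le> indicator {0..T} x *\<^sub>R (?c * x powr - \<beta>)" for x
      proof (cases "0 \<le> x \<and> x \<le> T")
        case True
        have "\<bar>marchaud \<beta> (e n) h x - marchaud \<beta> 0 h x\<bar> * x powr (- \<beta>) \<le> ?c * x powr (- \<beta>)"
          using marchaud_diff_le[OF e, of x n] by (intro mult_right_mono) (auto simp: abs_minus_commute)
        then show ?thesis
          using True by (simp add: right_diff_distrib[symmetric] abs_mult mult.commute)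
      next
        case False
        then show ?thesis
          using e[of n] by (auto simp: indicator_def marchaud_eq_0)
      qed
    qed
    have 3: "(LINT x:{0..T}|lborel. ?c * x powr (- \<beta>)) = ?c * W"
      unfolding W_def by (rule set_integral_mult_right)
    show ?thesis
      using 2 unfolding 1 3 real_norm_def .
  qed
  have "(\<lambda>n. ((1 - \<beta>) * (C * e n powr (\<alpha> + \<beta> - 1) / (\<alpha> + \<beta> - 1))) * W) \<longlonglongrightarrow>
      ((1 - \<beta>) * (C * 0 powr (\<alpha> + \<beta> - 1) / (\<alpha> + \<beta> - 1))) * W"
    using e0 beta e by (intro tendsto_intros tendsto_powr') (auto intro!: always_eventually less_imp_le)
  then have "(\<lambda>n. ((1 - \<beta>) * (C * e n powr (\<alpha> + \<beta> - 1) / (\<alpha> + \<beta> - 1))) * W) \<longlonglongrightarrow> 0"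
    by simp
  then have "(\<lambda>n. (LINT x:{0..}|lborel. x powr (- \<beta>) * marchaud \<beta> (e n) h x) -
      (LINT x:{0..}|lborel. x powr (- \<beta>) * marchaud \<beta> 0 h x)) \<longlonglongrightarrow> 0"
    by (rule Lim_null_comparison[rotated]) (use diff in auto)
  then have "(\<lambda>n. LINT x:{0..}|lborel. x powr (- \<beta>) * marchaud \<beta> (e n) h x) \<longlonglongrightarrow>
      (LINT x:{0..}|lborel. x powr (- \<beta>) * marchaud \<beta> 0 h x)"
    by (rule LIM_zero_cancel)
  with lim1 have "(LINT x:{0..}|lborel. x powr (- \<beta>) * marchaud \<beta> 0 h x) =
      h 0 * (LINT y:{0..}|lborel. riesz_kernel \<beta> y)"
    using LIMSEQ_unique by blast
  moreover have "(LINT x:{0..T}|lborel. x powr (- \<beta>) * marchaud \<beta> 0 h x) =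
      (LINT x:{0..}|lborel. x powr (- \<beta>) * marchaud \<beta> 0 h x)"
    unfolding set_lebesgue_integral_def
    by (intro Bochner_Integration.integral_cong) (auto simp: indicator_def marchaud_eq_0)
  ultimately show ?thesis by simp
qed

end

lemma abs_clamp_diff_le:
  "\<bar>max a (min b x) - max a (min b y)\<bar> \<le> \<bar>x - y :: real\<bar>"
  by (auto simp: max_def min_def)

text \<open>The constant is found by testing \<open>weighted_marchaud\<close> on \<open>h x = 1 - x\<close>.\<close>

lemma integral_riesz_kernel:
  assumes \<beta>: "0 < \<beta>" "\<beta> < 1"
  shows "(LINT y:{0..}|lborel. riesz_kernel \<beta> y) = Gamma \<beta> * Gamma (1 - \<beta>)"
proof -
  \<comment> \<open>Clamping makes \<open>1 - x\<close> bounded and Lipschitz on the whole line and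
    zero from 1 on. As \<open>h 0 = 1\<close>, \<open>weighted_marchaud\<close> returns the constant
    itself.\<close>
  define h :: "real \<Rightarrow> real" where "h x = 1 - max 0 (min 1 x)" for x
  interpret marchaud_compact 1 \<beta> 1 1 h 1
  proof
    show "\<bar>h x - h y\<bar> \<le> 1 * \<bar>x - y\<bar> powr 1" for x y
      using abs_clamp_diff_le[of 0 1 x y] by (simp add: h_def abs_minus_commute)
    show "h \<in> borel_measurable borel" unfolding h_def by measurable
  qed (use \<beta> in \<open>auto simp: h_def\<close>)
  have m: "marchaud \<beta> 0 h x = (1 - x) powr \<beta> / \<beta>" if x: "0 \<le> x" "x < 1" for x
  proof -
    have "(LINT v:{0..1 - x}|lborel. (h x - h (x + v)) * v powr (\<beta> - 2)) = (LINT v:{0..1 - x}|lborel. v powr (\<beta> - 1))"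
    proof (intro set_lebesgue_integral_cong)
      show "\<forall>v. v \<in> {0..1 - x} \<longrightarrow> (h x - h (x + v)) * v powr (\<beta> - 2) = v powr (\<beta> - 1)"
      proof (intro allI impI)
        fix v assume v: "v \<in> {0..1 - x}"
        then have "h x - h (x + v) = v" using x by (simp add: h_def)
        then show "(h x - h (x + v)) * v powr (\<beta> - 2) = v powr (\<beta> - 1)"
          using v powr_mult_base[of v "\<beta> - 2"] by simp
      qed
    qed simp
    also have "\<dots> = (1 - x) powr \<beta> / \<beta>"
      using powr_integral_from_0(2)[of "\<beta> - 1" "1 - x"] \<beta> x by simp
    finally have "marchaud \<beta> 0 h x = (1 - x) * (1 - x) powr (\<beta> - 1) + (1 - \<beta>) * ((1 - x) powr \<beta> / \<beta>)"
      using marchaud_eq_boundary[of x] x by (simp add: h_def)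
    also have "(1 - x) * (1 - x) powr (\<beta> - 1) = (1 - x) powr \<beta>"
      using powr_mult_base[of "1 - x" "\<beta> - 1"] x by simp
    also have "(1 - x) powr \<beta> + (1 - \<beta>) * ((1 - x) powr \<beta> / \<beta>) = (1 - x) powr \<beta> / \<beta>"
      using \<beta> by (simp add: field_simps)
    finally show ?thesis .
  qed
  have "(LINT y:{0..}|lborel. riesz_kernel \<beta> y) = (LINT x:{0..1}|lborel. x powr (- \<beta>) * marchaud \<beta> 0 h x)"
    using weighted_marchaud by (simp add: h_def)
  also have "\<dots> = (LINT x:{0..1}|lborel. x powr (- \<beta>) * (1 - x) powr \<beta> * (1 / \<beta>))"
  proof (intro set_lebesgue_integral_cong)
    show "\<forall>x. x \<in> {0..1} \<longrightarrow> x powr (- \<beta>) * marchaud \<beta> 0 h x = x powr (- \<beta>) * (1 - x) powr \<beta> * (1 / \<beta>)"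
    proof (intro allI impI)
      fix x :: real assume "x \<in> {0..1}"
      then consider "0 \<le> x" "x < 1" | "x = 1" by force
      then show "x powr (- \<beta>) * marchaud \<beta> 0 h x = x powr (- \<beta>) * (1 - x) powr \<beta> * (1 / \<beta>)"
        by cases (auto simp: m marchaud_eq_0)
    qed
  qed simp
  also have "\<dots> = (LINT x:{0..1}|lborel. x powr (- \<beta>) * (1 - x) powr \<beta>) * (1 / \<beta>)"
    by (rule set_integral_mult_left)
  \<comment> \<open>In the Beta value \<open>Gamma 2 = 1\<close>, and
    \<open>Gamma (\<beta> + 1) = \<beta> * Gamma \<beta>\<close> absorbs the factor
    \<open>1 / \<beta>\<close>.\<close>
  also have "\<dots> = Beta (1 - \<beta>) (1 + \<beta>) * (1 / \<beta>)"
  proof -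
    have "(LINT x:{0..1}|lborel. x powr (- \<beta>) * (1 - x) powr \<beta>) = Beta (1 - \<beta>) (1 + \<beta>)"
      using \<beta> has_integral_Beta_real[of "1 - \<beta>" "1 + \<beta>"]
      by (intro has_integral_imp_set_integral_lborel(2)) auto
    then show ?thesis by simp
  qed
  also have "\<dots> = Gamma \<beta> * Gamma (1 - \<beta>)"
  proof -
    have "\<beta> \<notin> \<int>\<^sub>\<le>\<^sub>0" using \<beta> by (auto elim!: nonpos_Ints_cases)
    then have "Gamma (\<beta> + 1) = \<beta> * Gamma \<beta>" by (rule Gamma_plus1)
    moreover have "Gamma (2::real) = 1" using Gamma_fact[of 1, where ?'a = real] by simp
    ultimately show ?thesis using \<beta> by (simp add: Beta_def add.commute)
  qed
  finally show ?thesis .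
qed

section \<open>The integral of step functions\<close>

text \<open>The derivatives are defined with \<open>lebesgue\<close>, but substitution and Fubini
  are applied over \<open>lborel\<close>; this is the bridge for Borel integrands.\<close>

lemma set_integral_lebesgue_eq_lborel:
  fixes f :: "real \<Rightarrow> 'b::{banach, second_countable_topology}"
  assumes "(\<lambda>x. indicator A x *\<^sub>R f x) \<in> borel_measurable borel"
  shows "set_integrable lebesgue A f \<longleftrightarrow> set_integrable lborel A f"
    and "(LINT x:A|lebesgue. f x) = (LINT x:A|lborel. f x)"
  using assms
  by (auto simp: set_integrable_def set_lebesgue_integral_def integrable_completion integral_completion)

lemma powr_shifted_integral:
  fixes c b p :: real
  assumes "p > -1" "c \<le> b"
  shows "set_integrable lborel {c..b} (\<lambda>x. (x - c) powr p)"
  using powr_integral_from_0(1)[of p "b - c"] set_integral_lborel_shift(2)[of 0 c "b - c" "\<lambda>x. (x - c) powr p"] assms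
  by simp

lemma powr_reflected_integral:
  fixes a c x \<beta> :: real
  assumes "0 < \<beta>" "a \<le> c" "c < x"
  shows "set_integrable lborel {a..c} (\<lambda>u. (x - u) powr (- \<beta> - 1))"
    and "(LINT u:{a..c}|lborel. (x - u) powr (- \<beta> - 1)) = ((x - c) powr (- \<beta>) - (x - a) powr (- \<beta>)) / \<beta>"
proof -
  have "((\<lambda>u. (x - u) powr (- \<beta>) / \<beta>) has_real_derivative (x - u) powr (- \<beta> - 1)) (at u)" if "u \<in> {a..c}" for u
    using assms that
    by (intro DERIV_cdivide DERIV_fun_powr[where g = "\<lambda>u. x - u", THEN DERIV_cong, THEN DERIV_cdivide, THEN DERIV_cong])
       (auto intro!: derivative_eq_intros)
  then have "((\<lambda>u. (x - u) powr (- \<beta> - 1)) has_integral ((x - c) powr (- \<beta>) / \<beta> - (x - a) powr (- \<beta>) / \<beta>)) {a..c}"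
    using assms by (intro fundamental_theorem_of_calculus)
      (auto simp: has_real_derivative_iff_has_vector_derivative[symmetric] intro: DERIV_subset)
  from has_integral_imp_set_integral_lborel[OF _ _ _ this]
  show "set_integrable lborel {a..c} (\<lambda>u. (x - u) powr (- \<beta> - 1))"
    and "(LINT u:{a..c}|lborel. (x - u) powr (- \<beta> - 1)) = ((x - c) powr (- \<beta>) - (x - a) powr (- \<beta>)) / \<beta>"
    by (auto simp: diff_divide_distrib)
qed

section \<open>The right-sided derivative of a Hoelder continuous integrator\<close>

locale hoelder_integrator =
  fixes \<alpha> \<beta> C a b :: real and g :: "real \<Rightarrow> real"
  assumes beta: "0 < \<beta>" "\<beta> < 1" "1 - \<alpha> < \<beta>"
    and C: "C \<ge> 0" and ab: "a \<le> b"
    and hoelder: "\<And>x y. x \<in> {a..b} \<Longrightarrow> y \<in> {a..b} \<Longrightarrow> \<bar>g x - g y\<bar> \<le> C * \<bar>x - y\<bar> powr \<alpha>"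
begin

text \<open>Clamping the argument to [a,b] is 1-Lipschitz, so the Hoelder bound extends to the whole
  line with the same constant. Subtracting \<open>g b\<close> makes the function vanish beyond
  \<open>b\<close>, as \<open>marchaud_compact\<close> demands.\<close>

definition ext :: "real \<Rightarrow> real" where
  "ext x = g (max a (min b x)) - g b"

lemma ext_eq: "x \<in> {a..b} \<Longrightarrow> ext x = g x - g b"
  by (simp add: ext_def)

lemma ext_hoelder: "\<bar>ext x - ext y\<bar> \<le> C * \<bar>x - y\<bar> powr \<alpha>"
proof -
  have "\<bar>ext x - ext y\<bar> \<le> C * \<bar>max a (min b x) - max a (min b y)\<bar> powr \<alpha>"
    unfolding ext_def using ab hoelder[of "max a (min b x)" "max a (min b y)"] by simp
  also have "\<dots> \<le> C * \<bar>x - y\<bar> powr \<alpha>"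
    using C beta by (intro mult_left_mono powr_mono2 abs_clamp_diff_le) auto
  finally show ?thesis .
qed

lemma continuous_ext: "continuous_on UNIV ext"
proof (unfold continuous_on_def, intro ballI)
  fix x
  have "((\<lambda>y. C * \<bar>y - x\<bar> powr \<alpha>) \<longlongrightarrow> C * \<bar>x - x\<bar> powr \<alpha>) (at x)"
    using beta by (intro tendsto_intros tendsto_powr') auto
  then have "((\<lambda>y. C * \<bar>y - x\<bar> powr \<alpha>) \<longlongrightarrow> 0) (at x)"
    using beta by simp
  then have "((\<lambda>y. ext y - ext x) \<longlongrightarrow> 0) (at x)"
    by (rule Lim_null_comparison[rotated]) (use ext_hoelder in auto)
  then show "(ext \<longlongrightarrow> ext x) (at x within UNIV)"
    by (rule LIM_zero_cancel)
qed

lemma ext_measurable [measurable]: "ext \<in> borel_measurable borel"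
  using continuous_ext by (rule borel_measurable_continuous_onI)

lemma ext_bounded: "\<bar>ext x\<bar> \<le> C * (b - a) powr \<alpha>"
proof -
  have "\<bar>ext x\<bar> \<le> C * \<bar>max a (min b x) - b\<bar> powr \<alpha>"
    unfolding ext_def using ab hoelder[of "max a (min b x)" b] by simp
  also have "\<dots> \<le> C * (b - a) powr \<alpha>"
    using C beta ab by (intro mult_left_mono powr_mono2) auto
  finally show ?thesis .
qed

text \<open>The shift by \<open>c\<close> moves the jump of a step function to the origin, which is
  where \<open>weighted_marchaud\<close> evaluates its function.\<close>

lemma marchaud_compact_ext:
  assumes "c \<le> b"
  shows "marchaud_compact \<alpha> \<beta> C (C * (b - a) powr \<alpha>) (\<lambda>x. ext (c + x)) (b - c)"
proof
  show "\<bar>ext (c + x) - ext (c + y)\<bar> \<le> C * \<bar>x - y\<bar> powr \<alpha>" for x y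
    using ext_hoelder[of "c + x" "c + y"] by simp
  show "ext (c + x) = 0" if "x \<ge> b - c" for x
    using that ab by (simp add: ext_def)
qed (use assms beta C ext_bounded in auto)

sublocale marchaud_hoelder \<alpha> \<beta> C "C * (b - a) powr \<alpha>" ext
  using beta C ext_hoelder ext_bounded ext_measurable by unfold_locales

lemma marchaud_ext_shift: "marchaud \<beta> \<epsilon> (\<lambda>x. ext (c + x)) y = marchaud \<beta> \<epsilon> ext (c + y)"
  by (simp add: marchaud_def add.assoc)

text \<open>Written exactly as \<open>frac_deriv_right\<close> unfolds for the order
  \<open>1 - \<beta>\<close>.\<close>

abbreviation right_integrand :: "real \<Rightarrow> real \<Rightarrow> real" where
  "right_integrand x u \<equiv> ((g x - g b) - (g u - g b)) / (u - x) powr (1 - \<beta> + 1)"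

lemma right_integrand_eq:
  assumes "x \<in> {a..b}"
  shows "set_integrable lebesgue {x..b} (right_integrand x)"
    and "(LINT u:{x..b}|lebesgue. right_integrand x u) =
      (LINT v:{0..b - x}|lborel. (ext x - ext (x + v)) * v powr (\<beta> - 2))"
proof -
  let ?k = "\<lambda>u. (ext x - ext u) * (u - x) powr (\<beta> - 2)"
  have eq: "right_integrand x u = ?k u" if "u \<in> {x..b}" for u
  proof -
    have "2 - \<beta> = - (\<beta> - 2)" by simp
    then have "inverse ((u - x) powr (2 - \<beta>)) = (u - x) powr (\<beta> - 2)"
      by (simp only: powr_minus inverse_inverse_eq)
    then show ?thesis
      using assms that by (simp add: ext_eq divide_inverse)
  qed
  have sets: "{x..b} = {0 + x..(b - x) + x}"
    by simp
  have I: "set_integrable lborel {x..b} ?k"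
    unfolding sets set_integral_lborel_shift(2)
    using set_integrable_near[of "b - x" x] assms by (simp add: add.commute)
  have "set_integrable lebesgue {x..b} ?k"
    using I by (subst set_integral_lebesgue_eq_lborel) auto
  then show "set_integrable lebesgue {x..b} (right_integrand x)"
    by (rule set_integrable_cong[THEN iffD1, rotated -1]) (use eq in auto)
  have "(LINT u:{x..b}|lebesgue. right_integrand x u) = (LINT u:{x..b}|lebesgue. ?k u)"
    using eq by (intro set_lebesgue_integral_cong) auto
  also have "\<dots> = (LINT u:{x..b}|lborel. ?k u)"
    by (intro set_integral_lebesgue_eq_lborel) auto
  also have "\<dots> = (LINT v:{0..b - x}|lborel. (ext x - ext (x + v)) * v powr (\<beta> - 2))"
    unfolding sets set_integral_lborel_shift(1) by (simp add: add.commute)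
  finally show "(LINT u:{x..b}|lebesgue. right_integrand x u) =
      (LINT v:{0..b - x}|lborel. (ext x - ext (x + v)) * v powr (\<beta> - 2))" .
qed

text \<open>\<open>marchaud\<close> carries neither the complex sign nor the normalization
  \<open>1 / Gamma \<beta>\<close> of the fractional derivative; both are collected here.\<close>

definition phase :: complex where
  "phase = exp (\<i> * of_real (pi * (1 - \<beta>))) / of_real (Gamma \<beta>)"

lemma frac_deriv_right_eq:
  assumes x: "x \<in> {a..b}"
  shows "frac_deriv_right (1 - \<beta>) b (\<lambda>x. g x - g b) x = phase * of_real (marchaud \<beta> 0 ext x)"
proof -
  interpret S: marchaud_compact \<alpha> \<beta> C "C * (b - a) powr \<alpha>" "\<lambda>y. ext (x + y)" "b - x"
    using x by (intro marchaud_compact_ext) auto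
  have "(g x - g b) / (b - x) powr (1 - \<beta>) + (1 - \<beta>) * (LINT u:{x..b}|lebesgue. right_integrand x u) = marchaud \<beta> 0 ext x"
  proof (cases "x = b")
    \<comment> \<open>At the end point everything vanishes: the boundary term has numerator
      \<open>g b - g b\<close>, the inner integral runs over a single point, and \<open>ext\<close>
      is 0 from \<open>b\<close> on.\<close>
    case True
    have "(\<lambda>v. indicator {0..(0::real)} v *\<^sub>R ((ext b - ext (b + v)) * v powr (\<beta> - 2))) = (\<lambda>v. 0)"
      by (auto simp: fun_eq_iff indicator_def)
    then have "(LINT v:{0..(0::real)}|lborel. (ext b - ext (b + v)) * v powr (\<beta> - 2)) = 0"
      unfolding set_lebesgue_integral_def by (simp only: Bochner_Integration.integral_zero)
    then show ?thesis
      using True S.marchaud_eq_0[of 0 0] right_integrand_eq(2)[OF x] unfolding marchaud_ext_shift by simp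
  next
    case False
    have "(b - x) powr (\<beta> - 1) = inverse ((b - x) powr (1 - \<beta>))"
      by (simp flip: powr_minus)
    then show ?thesis
      using S.marchaud_eq_boundary[of 0] False x right_integrand_eq(2)[OF x] ext_eq[OF x]
      unfolding marchaud_ext_shift by (simp add: divide_inverse)
  qed
  then show ?thesis
    by (simp add: frac_deriv_right_def phase_def)
qed

lemma frac_deriv_right_in_Linf_integrator:
  "frac_deriv_right_in_Linf (1 - \<beta>) a b (\<lambda>x. g x - g b)"
  unfolding frac_deriv_right_in_Linf_def
proof (intro conjI)
  show "AE x in lebesgue. x \<in> {a..b} \<longrightarrow> set_integrable lebesgue {x..b} (right_integrand x)"
    using right_integrand_eq(1) by (intro AE_I2) auto
  have "(\<lambda>x. indicator {a..b} x *\<^sub>R frac_deriv_right (1 - \<beta>) b (\<lambda>x. g x - g b) x) =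
      (\<lambda>x. indicator {a..b} x *\<^sub>R (phase * of_real (marchaud \<beta> 0 ext x)))"
    using frac_deriv_right_eq by (auto simp: fun_eq_iff indicator_def)
  then show "set_borel_measurable lebesgue {a..b} (frac_deriv_right (1 - \<beta>) b (\<lambda>x. g x - g b))"
    unfolding set_borel_measurable_def by (auto intro!: measurable_completion)
  obtain B where B: "\<And>x. \<bar>marchaud \<beta> 0 ext x\<bar> \<le> B"
    using abs_marchaud_le by blast
  have "x \<in> {a..b} \<longrightarrow> norm (frac_deriv_right (1 - \<beta>) b (\<lambda>x. g x - g b) x) \<le> norm phase * B" for x
    using B[of x] by (auto simp: frac_deriv_right_eq norm_mult mult_left_mono)
  then show "\<exists>K. AE x in lebesgue. x \<in> {a..b} \<longrightarrow> norm (frac_deriv_right (1 - \<beta>) b (\<lambda>x. g x - g b) x) \<le> K"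
    by (intro exI AE_I2)
qed

end

text \<open>A version of the integral relation that is stable under sums: the inner integrals converge
  everywhere, and Borel measurability gives measurability of \<open>t \<mapsto> \<integral>\<bar>f t - f s\<bar>/(t - s)\<^sup>\<beta>\<^sup>+\<^sup>1 ds\<close>.\<close>

definition borel_gls :: "real \<Rightarrow> (real \<Rightarrow> real) \<Rightarrow> (real \<Rightarrow> real) \<Rightarrow> real \<Rightarrow> real \<Rightarrow> real \<Rightarrow> bool" where
  "borel_gls \<beta> f g a b I \<longleftrightarrow>
     f \<in> borel_measurable borel \<and> frac_norm \<beta> a b f < \<infinity> \<and>
     (\<forall>x\<in>{a..b}. set_integrable lebesgue {a..x} (\<lambda>u. (f x - f u) / (x - u) powr (\<beta> + 1))) \<and>
     set_integrable lebesgue {a..b} (frac_deriv_left \<beta> a f) \<and>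
     set_integrable lebesgue {a..b} (\<lambda>x. of_real (frac_deriv_left \<beta> a f x) *
       frac_deriv_right (1 - \<beta>) b (\<lambda>x. g x - g b) x) \<and>
     complex_of_real I = exp (\<i> * of_real (pi * \<beta>)) *
       (LINT x:{a..b}|lebesgue. of_real (frac_deriv_left \<beta> a f x) *
          frac_deriv_right (1 - \<beta>) b (\<lambda>x. g x - g b) x)"

section \<open>Locality and linearity of the integral relation\<close>

lemma frac_deriv_left_cong:
  assumes "\<And>x. x \<in> {a..b} \<Longrightarrow> f x = f' x" "x \<in> {a..b}"
  shows "frac_deriv_left \<beta> a f x = frac_deriv_left \<beta> a f' x"
proof -
  have "(LINT u:{a..x}|lebesgue. (f x - f u) / (x - u) powr (\<beta> + 1)) =
      (LINT u:{a..x}|lebesgue. (f' x - f' u) / (x - u) powr (\<beta> + 1))"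
    using assms by (intro set_lebesgue_integral_cong) auto
  then show ?thesis
    using assms by (simp add: frac_deriv_left_def)
qed

lemma frac_norm_cong:
  assumes "\<And>x. x \<in> {a..b} \<Longrightarrow> f x = f' x"
  shows "frac_norm \<beta> a b f = frac_norm \<beta> a b f'"
  unfolding frac_norm_def
  using assms by (intro nn_integral_cong) (auto simp: indicator_def intro!: nn_integral_cong arg_cong2[where f = "(+)"])

text \<open>Inner integrals run over \<open>{a..x}\<close>, so only values on [a,b] matter. This
  later reduces the series \<psi> to finitely many stages, and it moves a jump lying beyond
  \<open>b\<close> to \<open>b\<close>.\<close>

lemma borel_gls_cong:
  assumes f: "borel_gls \<beta> f g a b I" and eq: "\<And>x. x \<in> {a..b} \<Longrightarrow> f x = f' x"
    and f': "f' \<in> borel_measurable borel"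
  shows "borel_gls \<beta> f' g a b I"
proof -
  have D: "frac_deriv_left \<beta> a f x = frac_deriv_left \<beta> a f' x" if "x \<in> {a..b}" for x
    using frac_deriv_left_cong[OF eq that] .
  have 1: "set_integrable lebesgue {a..x} (\<lambda>u. (f' x - f' u) / (x - u) powr (\<beta> + 1))" if "x \<in> {a..b}" for x
  proof -
    have "set_integrable lebesgue {a..x} (\<lambda>u. (f x - f u) / (x - u) powr (\<beta> + 1))"
      using f that by (auto simp: borel_gls_def)
    then show ?thesis
      by (rule set_integrable_cong[THEN iffD1, rotated -1]) (use that eq in auto)
  qed
  have 2: "set_integrable lebesgue {a..b} (frac_deriv_left \<beta> a f')"
  proof -
    have "set_integrable lebesgue {a..b} (frac_deriv_left \<beta> a f)"
      using f by (auto simp: borel_gls_def)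
    then show ?thesis
      by (rule set_integrable_cong[THEN iffD1, rotated -1]) (use D in auto)
  qed
  let ?R = "frac_deriv_right (1 - \<beta>) b (\<lambda>x. g x - g b)"
  have 3: "set_integrable lebesgue {a..b} (\<lambda>x. of_real (frac_deriv_left \<beta> a f' x) * ?R x)"
  proof -
    have "set_integrable lebesgue {a..b} (\<lambda>x. of_real (frac_deriv_left \<beta> a f x) * ?R x)"
      using f by (auto simp: borel_gls_def)
    then show ?thesis
      by (rule set_integrable_cong[THEN iffD1, rotated -1]) (use D in auto)
  qed
  have 4: "(LINT x:{a..b}|lebesgue. of_real (frac_deriv_left \<beta> a f x) * ?R x) =
     (LINT x:{a..b}|lebesgue. of_real (frac_deriv_left \<beta> a f' x) * ?R x)"
    using D by (intro set_lebesgue_integral_cong) auto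
  show ?thesis
    unfolding borel_gls_def
    using f f' 1 2 3 4 frac_norm_cong[where \<beta> = \<beta>, OF eq] by (auto simp: borel_gls_def)
qed

text \<open>The L-infinity condition is absent from \<open>borel_gls\<close> because it concerns the
  integrator alone; here Hoelder continuity supplies it.\<close>

lemma has_gls_integralI:
  assumes f: "borel_gls \<beta> f g a b I" and g: "hoelder_integrator \<alpha> \<beta> C a b g"
  shows "has_gls_integral \<alpha> f g a b I"
proof -
  interpret hoelder_integrator \<alpha> \<beta> C a b g by fact
  have m: "f \<in> borel_measurable borel"
    using f by (auto simp: borel_gls_def)
  have "(\<lambda>x. indicator {a..b} x *\<^sub>R f x) \<in> borel_measurable lebesgue"
    using m by (intro measurable_completion) auto
  moreover have "has_gls_integral_of_order \<beta> f g a b I"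
    unfolding has_gls_integral_of_order_def frac_deriv_left_in_L1_def
    using f frac_deriv_right_in_Linf_integrator by (auto simp: borel_gls_def)
  ultimately show ?thesis
    unfolding has_gls_integral_def set_borel_measurable_def
    using beta f by (auto simp: borel_gls_def)
qed

lemma frac_norm_add_le:
  assumes [measurable]: "f \<in> borel_measurable borel" "f' \<in> borel_measurable borel"
  shows "frac_norm \<beta> a b (\<lambda>x. f x + f' x) \<le> frac_norm \<beta> a b f + frac_norm \<beta> a b f'"
proof -
  let ?i = "\<lambda>f t s. ennreal (\<bar>f t - f s\<bar> / (t - s) powr (\<beta> + 1)) * indicator {a..t} s"
  let ?o = "\<lambda>f t. (ennreal (\<bar>f t\<bar> / (t - a) powr \<beta>) + (\<integral>\<^sup>+s. ?i f t s \<partial>lborel)) * indicator {a..b} t"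
  \<comment> \<open>The inner interval \<open>{a..t}\<close> moves with \<open>t\<close>. Written as
    inequalities it becomes a jointly measurable condition.\<close>
  have [measurable]: "?o f \<in> borel_measurable lborel" "?o f' \<in> borel_measurable lborel"
    unfolding atLeastAtMost_iff indicator_def by measurable
  have 1: "(\<integral>\<^sup>+s. ?i (\<lambda>x. f x + f' x) t s \<partial>lborel) \<le> (\<integral>\<^sup>+s. ?i f t s \<partial>lborel) + (\<integral>\<^sup>+s. ?i f' t s \<partial>lborel)" for t
  proof -
    have "(\<integral>\<^sup>+s. ?i (\<lambda>x. f x + f' x) t s \<partial>lborel) \<le> (\<integral>\<^sup>+s. ?i f t s + ?i f' t s \<partial>lborel)"
      by (intro nn_integral_mono)
         (auto simp: indicator_def ennreal_plus[symmetric] add_divide_distrib[symmetric]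
            simp del: ennreal_plus intro!: ennreal_leI divide_right_mono)
    also have "\<dots> = (\<integral>\<^sup>+s. ?i f t s \<partial>lborel) + (\<integral>\<^sup>+s. ?i f' t s \<partial>lborel)"
      by (intro nn_integral_add) auto
    finally show ?thesis .
  qed
  have 2: "ennreal (\<bar>f t + f' t\<bar> / (t - a) powr \<beta>) \<le> ennreal (\<bar>f t\<bar> / (t - a) powr \<beta>) + ennreal (\<bar>f' t\<bar> / (t - a) powr \<beta>)" for t
    by (auto simp: ennreal_plus[symmetric] add_divide_distrib[symmetric]
            simp del: ennreal_plus intro!: ennreal_leI divide_right_mono)
  have "?o (\<lambda>x. f x + f' x) t \<le> ?o f t + ?o f' t" for t
    using add_mono[OF 2[of t] 1[of t]] by (cases "t \<in> {a..b}") (simp_all add: add_ac)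
  then have "(\<integral>\<^sup>+t. ?o (\<lambda>x. f x + f' x) t \<partial>lborel) \<le> (\<integral>\<^sup>+t. ?o f t + ?o f' t \<partial>lborel)"
    by (intro nn_integral_mono) auto
  also have "\<dots> = (\<integral>\<^sup>+t. ?o f t \<partial>lborel) + (\<integral>\<^sup>+t. ?o f' t \<partial>lborel)"
    by (intro nn_integral_add) auto
  finally show ?thesis
    by (simp add: frac_norm_def nn_integral_completion)
qed

lemma frac_norm_cmult:
  assumes [measurable]: "f \<in> borel_measurable borel"
  shows "frac_norm \<beta> a b (\<lambda>x. c * f x) = ennreal \<bar>c\<bar> * frac_norm \<beta> a b f"
proof -
  let ?i = "\<lambda>f t s. ennreal (\<bar>f t - f s\<bar> / (t - s) powr (\<beta> + 1)) * indicator {a..t} s"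
  let ?o = "\<lambda>f t. (ennreal (\<bar>f t\<bar> / (t - a) powr \<beta>) + (\<integral>\<^sup>+s. ?i f t s \<partial>lborel)) * indicator {a..b} t"
  have [measurable]: "?o f \<in> borel_measurable lborel"
    unfolding atLeastAtMost_iff indicator_def by measurable
  have "?i (\<lambda>x. c * f x) t s = ennreal \<bar>c\<bar> * ?i f t s" for t s
    by (simp add: right_diff_distrib[symmetric] abs_mult ennreal_mult'[symmetric] mult.assoc[symmetric]
          times_divide_eq_right[symmetric] del: times_divide_eq_right)
  then have "(\<integral>\<^sup>+s. ?i (\<lambda>x. c * f x) t s \<partial>lborel) = ennreal \<bar>c\<bar> * (\<integral>\<^sup>+s. ?i f t s \<partial>lborel)" for t
    by (simp add: nn_integral_cmult)
  moreover have "ennreal (\<bar>c * f t\<bar> / (t - a) powr \<beta>) = ennreal \<bar>c\<bar> * ennreal (\<bar>f t\<bar> / (t - a) powr \<beta>)" for t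
    by (simp add: abs_mult ennreal_mult'[symmetric])
  ultimately have "?o (\<lambda>x. c * f x) t = ennreal \<bar>c\<bar> * ?o f t" for t
    by (simp add: distrib_left[symmetric] mult.assoc)
  then have "(\<integral>\<^sup>+t. ?o (\<lambda>x. c * f x) t \<partial>lborel) = ennreal \<bar>c\<bar> * (\<integral>\<^sup>+t. ?o f t \<partial>lborel)"
    by (simp add: nn_integral_cmult)
  then show ?thesis
    by (simp add: frac_norm_def nn_integral_completion)
qed

lemma borel_gls_add:
  assumes f: "borel_gls \<beta> f g a b I" and f': "borel_gls \<beta> f' g a b I'"
  shows "borel_gls \<beta> (\<lambda>x. f x + f' x) g a b (I + I')"
proof -
  have m: "f \<in> borel_measurable borel" "f' \<in> borel_measurable borel"
    using f f' by (auto simp: borel_gls_def)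
  have 1: "frac_norm \<beta> a b (\<lambda>x. f x + f' x) < \<infinity>"
    using frac_norm_add_le[OF m, of \<beta> a b] f f'
    by (auto simp: borel_gls_def intro: order_le_less_trans)
  have i: "set_integrable lebesgue {a..x} (\<lambda>u. (f x - f u) / (x - u) powr (\<beta> + 1))"
    "set_integrable lebesgue {a..x} (\<lambda>u. (f' x - f' u) / (x - u) powr (\<beta> + 1))" if "x \<in> {a..b}" for x
    using f f' that by (auto simp: borel_gls_def)
  have eq: "((f x + f' x) - (f u + f' u)) / (x - u) powr (\<beta> + 1) =
      (f x - f u) / (x - u) powr (\<beta> + 1) + (f' x - f' u) / (x - u) powr (\<beta> + 1)" for x u
    by (simp add: add_divide_distrib[symmetric] algebra_simps)
  have 2: "set_integrable lebesgue {a..x} (\<lambda>u. ((f x + f' x) - (f u + f' u)) / (x - u) powr (\<beta> + 1))"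
    if "x \<in> {a..b}" for x
    unfolding eq using i[OF that] by (rule set_integral_add)
  have D: "frac_deriv_left \<beta> a (\<lambda>x. f x + f' x) x = frac_deriv_left \<beta> a f x + frac_deriv_left \<beta> a f' x"
    if "x \<in> {a..b}" for x
    unfolding frac_deriv_left_def eq set_integral_add(2)[OF i[OF that]]
    by (simp add: algebra_simps add_divide_distrib)
  have 3: "set_integrable lebesgue {a..b} (frac_deriv_left \<beta> a (\<lambda>x. f x + f' x))"
  proof -
    have "set_integrable lebesgue {a..b} (\<lambda>x. frac_deriv_left \<beta> a f x + frac_deriv_left \<beta> a f' x)"
      using f f' by (intro set_integral_add) (auto simp: borel_gls_def)
    then show ?thesis
      by (rule set_integrable_cong[THEN iffD1, rotated -1]) (use D in auto)
  qed
  let ?R = "frac_deriv_right (1 - \<beta>) b (\<lambda>x. g x - g b)"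
  have p: "set_integrable lebesgue {a..b} (\<lambda>x. of_real (frac_deriv_left \<beta> a f x) * ?R x)"
    "set_integrable lebesgue {a..b} (\<lambda>x. of_real (frac_deriv_left \<beta> a f' x) * ?R x)"
    using f f' by (auto simp: borel_gls_def)
  have eq2: "of_real (frac_deriv_left \<beta> a (\<lambda>x. f x + f' x) x) * ?R x =
     of_real (frac_deriv_left \<beta> a f x) * ?R x + of_real (frac_deriv_left \<beta> a f' x) * ?R x" if "x \<in> {a..b}" for x
    using D[OF that] by (simp add: distrib_right)
  have 4: "set_integrable lebesgue {a..b} (\<lambda>x. of_real (frac_deriv_left \<beta> a (\<lambda>x. f x + f' x) x) * ?R x)"
    using set_integral_add(1)[OF p]
    by (rule set_integrable_cong[THEN iffD1, rotated -1]) (use eq2 in auto)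
  have "(LINT x:{a..b}|lebesgue. of_real (frac_deriv_left \<beta> a (\<lambda>x. f x + f' x) x) * ?R x) =
    (LINT x:{a..b}|lebesgue. of_real (frac_deriv_left \<beta> a f x) * ?R x + of_real (frac_deriv_left \<beta> a f' x) * ?R x)"
    using eq2 by (intro set_lebesgue_integral_cong) auto
  also have "\<dots> = (LINT x:{a..b}|lebesgue. of_real (frac_deriv_left \<beta> a f x) * ?R x) +
     (LINT x:{a..b}|lebesgue. of_real (frac_deriv_left \<beta> a f' x) * ?R x)"
    by (rule set_integral_add(2)[OF p])
  finally have 5: "complex_of_real (I + I') = exp (\<i> * of_real (pi * \<beta>)) *
      (LINT x:{a..b}|lebesgue. of_real (frac_deriv_left \<beta> a (\<lambda>x. f x + f' x) x) * ?R x)"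
    using f f' by (simp add: borel_gls_def distrib_left)
  show ?thesis
    unfolding borel_gls_def using m 1 2 3 4 5 by auto
qed

lemma borel_gls_cmult:
  assumes f: "borel_gls \<beta> f g a b I"
  shows "borel_gls \<beta> (\<lambda>x. c * f x) g a b (c * I)"
proof -
  have m: "f \<in> borel_measurable borel"
    using f by (auto simp: borel_gls_def)
  have 1: "frac_norm \<beta> a b (\<lambda>x. c * f x) < \<infinity>"
    using f by (auto simp: frac_norm_cmult[OF m] borel_gls_def ennreal_mult_less_top)
  have eq: "(c * f x - c * f u) / (x - u) powr (\<beta> + 1) = c * ((f x - f u) / (x - u) powr (\<beta> + 1))" for x u
    by (simp add: right_diff_distrib)
  have 2: "set_integrable lebesgue {a..x} (\<lambda>u. (c * f x - c * f u) / (x - u) powr (\<beta> + 1))"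
    if "x \<in> {a..b}" for x
    unfolding eq by (intro set_integrable_mult_right) (use f that in \<open>auto simp: borel_gls_def\<close>)
  have D: "frac_deriv_left \<beta> a (\<lambda>x. c * f x) x = c * frac_deriv_left \<beta> a f x" for x
    unfolding frac_deriv_left_def eq set_integral_mult_right by (simp add: algebra_simps)
  have 3: "set_integrable lebesgue {a..b} (frac_deriv_left \<beta> a (\<lambda>x. c * f x))"
    unfolding D[abs_def] using f by (auto simp: borel_gls_def)
  let ?R = "frac_deriv_right (1 - \<beta>) b (\<lambda>x. g x - g b)"
  have eq2: "of_real (frac_deriv_left \<beta> a (\<lambda>x. c * f x) x) * ?R x =
     of_real c * (of_real (frac_deriv_left \<beta> a f x) * ?R x)" for x
    by (simp add: D)
  have 4: "set_integrable lebesgue {a..b} (\<lambda>x. of_real (frac_deriv_left \<beta> a (\<lambda>x. c * f x) x) * ?R x)"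
    unfolding eq2 using f by (intro set_integrable_mult_right) (auto simp: borel_gls_def)
  have 5: "complex_of_real (c * I) = exp (\<i> * of_real (pi * \<beta>)) *
      (LINT x:{a..b}|lebesgue. of_real (frac_deriv_left \<beta> a (\<lambda>x. c * f x) x) * ?R x)"
    unfolding eq2 set_integral_mult_right using f by (simp add: borel_gls_def)
  show ?thesis
    unfolding borel_gls_def using m 1 2 3 4 5 by auto
qed

lemma borel_gls_zero: "borel_gls \<beta> (\<lambda>x. 0) g a b 0"
  by (simp add: borel_gls_def frac_norm_def frac_deriv_left_def[abs_def] set_integrable_def
        set_lebesgue_integral_def)

lemma borel_gls_sum:
  assumes "\<And>i. i \<in> A \<Longrightarrow> borel_gls \<beta> (f i) g a b (I i)"
  shows "borel_gls \<beta> (\<lambda>x. \<Sum>i\<in>A. f i x) g a b (\<Sum>i\<in>A. I i)"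
  using assms
  by (induction A rule: infinite_finite_induct) (auto intro: borel_gls_zero borel_gls_add)

section \<open>The integral of an indicator function\<close>

context hoelder_integrator
begin

text \<open>For \<open>x > c\<close> the difference of the indicators is 1 for
  \<open>u \<le> c\<close> and 0 afterwards, so the integration stops before the singularity at
  \<open>u = x\<close>; for \<open>x \<le> c\<close> it is 0 throughout.\<close>

lemma borel_gls_step_inner:
  assumes "a \<le> c" "x \<ge> a"
  shows "set_integrable lebesgue {a..x} (\<lambda>u. (indicator {c<..} x - indicator {c<..} u) / (x - u) powr (\<beta> + 1))"
    and "(LINT u:{a..x}|lebesgue. (indicator {c<..} x - indicator {c<..} u) / (x - u) powr (\<beta> + 1)) =
      indicator {c<..} x * (((x - c) powr (- \<beta>) - (x - a) powr (- \<beta>)) / \<beta>)"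
proof -
  have *: "(\<lambda>u. indicator {a..x} u *\<^sub>R ((indicator {c<..} x - indicator {c<..} u) / (x - u) powr (\<beta> + 1))) =
      (\<lambda>u. indicator {c<..} x * (indicator {a..c} u *\<^sub>R (x - u) powr (- \<beta> - 1)))"
  proof
    fix u
    have "- \<beta> - 1 = - (\<beta> + 1)" by simp
    then have "(x - u) powr (- \<beta> - 1) = inverse ((x - u) powr (\<beta> + 1))"
      by (simp only: powr_minus)
    then show "indicator {a..x} u *\<^sub>R ((indicator {c<..} x - indicator {c<..} u) / (x - u) powr (\<beta> + 1)) =
      indicator {c<..} x * (indicator {a..c} u *\<^sub>R (x - u) powr (- \<beta> - 1))"
      by (auto simp: indicator_def divide_inverse)
  qed
  have "has_bochner_integral lborel (\<lambda>u. indicator {c<..} x * (indicator {a..c} u *\<^sub>R (x - u) powr (- \<beta> - 1)))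
      (indicator {c<..} x * (((x - c) powr (- \<beta>) - (x - a) powr (- \<beta>)) / \<beta>))"
  proof (cases "x > c")
    case True
    then show ?thesis
      using powr_reflected_integral[of \<beta> a c x] beta assms
      by (simp add: has_bochner_integral_iff set_integrable_def set_lebesgue_integral_def)
  qed (simp add: has_bochner_integral_zero)
  then show "set_integrable lebesgue {a..x} (\<lambda>u. (indicator {c<..} x - indicator {c<..} u) / (x - u) powr (\<beta> + 1))"
    and "(LINT u:{a..x}|lebesgue. (indicator {c<..} x - indicator {c<..} u) / (x - u) powr (\<beta> + 1)) =
      indicator {c<..} x * (((x - c) powr (- \<beta>) - (x - a) powr (- \<beta>)) / \<beta>)"
    unfolding set_integrable_def set_lebesgue_integral_def *
    by (auto simp: has_bochner_integral_iff integrable_completion integral_completion)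
qed

text \<open>The term \<open>(x - a) powr (- \<beta>)\<close> of the inner integral cancels the
  boundary term, so the starting point \<open>a\<close> drops out.\<close>

lemma frac_deriv_left_step:
  assumes "a \<le> c" "x \<ge> a"
  shows "frac_deriv_left \<beta> a (indicator {c<..}) x = indicator {c<..} x * (x - c) powr (- \<beta>) / Gamma (1 - \<beta>)"
proof -
  have "indicator {c<..} x / (x - a) powr \<beta> + indicator {c<..} x * ((x - c) powr (- \<beta>) - (x - a) powr (- \<beta>)) =
      indicator {c<..} x * (x - c) powr (- \<beta>)"
    by (simp add: right_diff_distrib powr_minus divide_inverse)
  then show ?thesis
    using beta by (simp add: frac_deriv_left_def borel_gls_step_inner(2)[OF assms])
qed

text \<open>Before the jump both parts of the norm vanish. After it both are dominated by multiples
  of the integrable \<open>(t - c) powr (- \<beta>)\<close>: the boundary part because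
  \<open>a \<le> c\<close>, the inner part by its closed form.\<close>

lemma frac_norm_step:
  assumes c: "a \<le> c" "c \<le> b"
  shows "frac_norm \<beta> a b (indicator {c<..}) < \<infinity>"
proof -
  let ?f = "indicator {c<..} :: real \<Rightarrow> real"
  have "(ennreal (\<bar>?f t\<bar> / (t - a) powr \<beta>) +
        (\<integral>\<^sup>+s\<in>{a..t}. ennreal (\<bar>?f t - ?f s\<bar> / (t - s) powr (\<beta> + 1)) \<partial>lborel)) * indicator {a..b} t
     \<le> ennreal (indicator {c..b} t * ((1 + 1 / \<beta>) * (t - c) powr (- \<beta>)))" for t
  proof (cases "t \<in> {a..b} \<and> c < t")
    case True
    then have t: "t \<ge> a" "t \<le> b" "c < t" by auto
    have "(\<integral>\<^sup>+s\<in>{a..t}. ennreal (\<bar>?f t - ?f s\<bar> / (t - s) powr (\<beta> + 1)) \<partial>lborel) =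
        (\<integral>\<^sup>+s. ennreal (indicator {a..t} s *\<^sub>R ((?f t - ?f s) / (t - s) powr (\<beta> + 1))) \<partial>lborel)"
      using t by (intro nn_integral_cong) (auto simp: indicator_def)
    also have "\<dots> = ennreal (LINT u:{a..t}|lebesgue. (?f t - ?f u) / (t - u) powr (\<beta> + 1))"
      unfolding set_lebesgue_integral_def
      using borel_gls_step_inner(1)[OF c(1) t(1)] t
      by (subst nn_integral_eq_integral[symmetric])
         (auto simp: nn_integral_completion set_integrable_def indicator_def)
    also have "\<dots> = ennreal (((t - c) powr (- \<beta>) - (t - a) powr (- \<beta>)) / \<beta>)"
      using t by (subst borel_gls_step_inner(2)[OF c(1) t(1)]) simp
    also have "\<dots> \<le> ennreal (1 / \<beta> * (t - c) powr (- \<beta>))"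
      using beta by (intro ennreal_leI) (simp add: divide_right_mono)
    finally have "(\<integral>\<^sup>+s\<in>{a..t}. ennreal (\<bar>?f t - ?f s\<bar> / (t - s) powr (\<beta> + 1)) \<partial>lborel)
        \<le> ennreal (1 / \<beta> * (t - c) powr (- \<beta>))" .
    moreover have "(t - a) powr (- \<beta>) \<le> (t - c) powr (- \<beta>)"
      using t c beta by (intro powr_mono2') auto
    then have "ennreal (\<bar>?f t\<bar> / (t - a) powr \<beta>) \<le> ennreal ((t - c) powr (- \<beta>))"
      using t by (intro ennreal_leI) (simp add: powr_minus divide_inverse)
    ultimately have "ennreal (\<bar>?f t\<bar> / (t - a) powr \<beta>) +
        (\<integral>\<^sup>+s\<in>{a..t}. ennreal (\<bar>?f t - ?f s\<bar> / (t - s) powr (\<beta> + 1)) \<partial>lborel) \<le>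
       ennreal ((t - c) powr (- \<beta>)) + ennreal (1 / \<beta> * (t - c) powr (- \<beta>))"
      by (intro add_mono)
    also have "\<dots> = ennreal ((1 + 1 / \<beta>) * (t - c) powr (- \<beta>))"
      using beta by (simp add: ennreal_plus[symmetric] distrib_right del: ennreal_plus)
    finally show ?thesis using t by simp
  next
    case False
    have "(\<integral>\<^sup>+s\<in>{a..t}. ennreal (\<bar>?f t - ?f s\<bar> / (t - s) powr (\<beta> + 1)) \<partial>lborel) = 0" if "t \<le> c"
    proof -
      have "(\<lambda>s. ennreal (\<bar>?f t - ?f s\<bar> / (t - s) powr (\<beta> + 1)) * indicator {a..t} s) = (\<lambda>s. 0)"
        using that by (auto simp: fun_eq_iff indicator_def)
      then show ?thesis by (simp only: nn_integral_const mult_zero_left)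
    qed
    then show ?thesis using False by (cases "t \<le> c") (auto simp: indicator_def)
  qed
  then have "frac_norm \<beta> a b ?f \<le> (\<integral>\<^sup>+t. ennreal (indicator {c..b} t * ((1 + 1 / \<beta>) * (t - c) powr (- \<beta>))) \<partial>lborel)"
    unfolding frac_norm_def nn_integral_completion by (intro nn_integral_mono) auto
  also have "\<dots> < \<infinity>"
  proof -
    have "set_integrable lborel {c..b} (\<lambda>t. (1 + 1 / \<beta>) * (t - c) powr (- \<beta>))"
      using powr_shifted_integral[of "- \<beta>" c b] beta c by (intro set_integrable_mult_right) auto
    then have "integrable lborel (\<lambda>t. indicator {c..b} t * ((1 + 1 / \<beta>) * (t - c) powr (- \<beta>)))"
      by (simp add: set_integrable_def)
    then show ?thesis
      using beta by (subst nn_integral_eq_integral) (auto simp: indicator_def)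
  qed
  finally show ?thesis .
qed

text \<open>After a shift by \<open>c\<close> the product of the two derivatives is the integrand of
  \<open>weighted_marchaud\<close>. The constant from \<open>integral_riesz_kernel\<close> cancels
  the Gamma factors of both normalizations.\<close>

lemma borel_gls_step:
  assumes c: "a \<le> c" "c \<le> b"
  shows "borel_gls \<beta> (indicator {c<..}) g a b (g b - g c)"
proof -
  let ?f = "indicator {c<..} :: real \<Rightarrow> real"
  let ?L = "\<lambda>x. (1 / Gamma (1 - \<beta>)) * (x - c) powr (- \<beta>)"
  let ?R = "frac_deriv_right (1 - \<beta>) b (\<lambda>x. g x - g b)"
  interpret S: marchaud_compact \<alpha> \<beta> C "C * (b - a) powr \<alpha>" "\<lambda>y. ext (c + y)" "b - c"
    using c by (intro marchaud_compact_ext) auto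
  obtain B where B: "\<And>x. \<bar>marchaud \<beta> 0 ext x\<bar> \<le> B"
    using abs_marchaud_le by blast
  have D: "indicator {a..b} x *\<^sub>R frac_deriv_left \<beta> a ?f x = indicator {c..b} x *\<^sub>R ?L x" for x
    using c frac_deriv_left_step[of c x] by (auto simp: indicator_def)
  have iL: "set_integrable lborel {c..b} ?L"
    using powr_shifted_integral[of "- \<beta>" c b] beta c by (intro set_integrable_mult_right) auto
  have 3: "set_integrable lebesgue {a..b} (frac_deriv_left \<beta> a ?f)"
    using iL unfolding set_integrable_def D by (subst integrable_completion) auto
  have P: "indicator {a..b} x *\<^sub>R (of_real (frac_deriv_left \<beta> a ?f x) * ?R x) =
     (phase / Gamma (1 - \<beta>)) * of_real (indicator {c..b} x *\<^sub>R ((x - c) powr (- \<beta>) * marchaud \<beta> 0 ext x))" for x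
    using c frac_deriv_left_step[of c x] by (auto simp: indicator_def frac_deriv_right_eq)
  have "set_integrable lborel {c..b} (\<lambda>x. B * (x - c) powr (- \<beta>))"
    using powr_shifted_integral[of "- \<beta>" c b] beta c by (intro set_integrable_mult_right) auto
  then have iM: "set_integrable lborel {c..b} (\<lambda>x. (x - c) powr (- \<beta>) * marchaud \<beta> 0 ext x)"
  proof (rule set_integrable_bound)
    have "\<bar>(x - c) powr (- \<beta>) * marchaud \<beta> 0 ext x\<bar> \<le> \<bar>B * (x - c) powr (- \<beta>)\<bar>" for x
      using mult_right_mono[OF B[of x] powr_ge_zero[of "x - c" "- \<beta>"]] B[of x]
      by (simp add: abs_mult mult.commute)
    then show "AE x in lborel. x \<in> {c..b} \<longrightarrow>
      norm ((x - c) powr (- \<beta>) * marchaud \<beta> 0 ext x) \<le> norm (B * (x - c) powr (- \<beta>))"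
      by auto
  qed (auto simp: set_borel_measurable_def)
  have 4: "set_integrable lebesgue {a..b} (\<lambda>x. of_real (frac_deriv_left \<beta> a ?f x) * ?R x)"
  proof -
    have "integrable lborel (\<lambda>x. (phase / Gamma (1 - \<beta>)) *
        of_real (indicator {c..b} x *\<^sub>R ((x - c) powr (- \<beta>) * marchaud \<beta> 0 ext x)))"
      using iM unfolding set_integrable_def
      by (intro integrable_mult_right integrable_of_real)
    then show ?thesis
      unfolding set_integrable_def P
      by (subst integrable_completion) (rule borel_measurable_integrable)
  qed
  have sets: "{c..b} = {0 + c..(b - c) + c}" by simp
  have "(LINT x:{c..b}|lborel. (x - c) powr (- \<beta>) * marchaud \<beta> 0 ext x) =
     (LINT x:{0..b - c}|lborel. x powr (- \<beta>) * marchaud \<beta> 0 (\<lambda>y. ext (c + y)) x)"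
    unfolding sets set_integral_lborel_shift(1) marchaud_ext_shift by (simp add: add.commute)
  also have "\<dots> = (g c - g b) * (Gamma \<beta> * Gamma (1 - \<beta>))"
    using S.weighted_marchaud beta c by (simp add: integral_riesz_kernel ext_eq)
  finally have M: "(LINT x:{c..b}|lborel. (x - c) powr (- \<beta>) * marchaud \<beta> 0 ext x) =
     (g c - g b) * (Gamma \<beta> * Gamma (1 - \<beta>))" .
  have "Gamma \<beta> > 0" "Gamma (1 - \<beta>) > 0"
    using beta by (auto intro: Gamma_real_pos)
  have "(LINT x:{a..b}|lebesgue. of_real (frac_deriv_left \<beta> a ?f x) * ?R x) =
     (phase / Gamma (1 - \<beta>)) * of_real (LINT x:{c..b}|lborel. (x - c) powr (- \<beta>) * marchaud \<beta> 0 ext x)"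
    unfolding set_lebesgue_integral_def P
    by (subst integral_completion, measurable)
       (simp only: integral_mult_right_zero integral_complex_of_real)
  also have "\<dots> = exp (\<i> * of_real (pi * (1 - \<beta>))) * of_real (g c - g b)"
    unfolding M phase_def using \<open>Gamma \<beta> > 0\<close> \<open>Gamma (1 - \<beta>) > 0\<close> by (simp add: field_simps)
  finally have "exp (\<i> * of_real (pi * \<beta>)) * (LINT x:{a..b}|lebesgue. of_real (frac_deriv_left \<beta> a ?f x) * ?R x) =
     (exp (\<i> * of_real (pi * \<beta>)) * exp (\<i> * of_real (pi * (1 - \<beta>)))) * of_real (g c - g b)"
    by simp
  \<comment> \<open>The two phases combine to \<open>exp (\<i> * pi) = -1\<close>, which turns
    \<open>g c - g b\<close> into \<open>g b - g c\<close>.\<close>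
  also have "exp (\<i> * of_real (pi * \<beta>)) * exp (\<i> * of_real (pi * (1 - \<beta>))) = exp (\<i> * of_real pi)"
    by (simp add: exp_add[symmetric] algebra_simps)
  also have "\<dots> = -1"
    by (rule exp_pi_i')
  finally have 5: "complex_of_real (g b - g c) =
      exp (\<i> * of_real (pi * \<beta>)) * (LINT x:{a..b}|lebesgue. of_real (frac_deriv_left \<beta> a ?f x) * ?R x)"
    by simp
  show ?thesis
    unfolding borel_gls_def
    using frac_norm_step[OF c] borel_gls_step_inner(1)[OF c(1)] 3 4 5 by auto
qed

lemma borel_gls_interval:
  assumes "a \<le> c" "c \<le> d"
  shows "borel_gls \<beta> (indicator {c<..d}) g a b (g (min b d) - g (min b c))"
proof -
  \<comment> \<open>A jump beyond \<open>b\<close> is not seen on [a,b]. Placed at \<open>b\<close>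
    it contributes \<open>g b - g b = 0\<close>, which explains the minimum.\<close>
  have step: "borel_gls \<beta> (indicator {e<..}) g a b (g b - g (min b e))" if "a \<le> e" for e
    using ab that by (intro borel_gls_cong[OF borel_gls_step[of "min b e"]]) (auto simp: indicator_def)
  have "borel_gls \<beta> (\<lambda>x. indicator {c<..} x + (-1) * indicator {d<..} x) g a b
      ((g b - g (min b c)) + (-1) * (g b - g (min b d)))"
    using assms by (intro borel_gls_add borel_gls_cmult step) auto
  moreover have "(\<lambda>x. indicator {c<..} x + (-1) * indicator {d<..} x) = (indicator {c<..d} :: real \<Rightarrow> real)"
    using assms by (auto simp: fun_eq_iff indicator_def)
  ultimately show ?thesis by simp
qed

end

section \<open>Approximation of terminal values\<close>

locale filtered_space = prob_space M for M :: "'a measure" +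
  fixes F :: "real \<Rightarrow> 'a measure"
  assumes subalg: "t \<in> {0..1} \<Longrightarrow> subalgebra M (F t)"
    and F_mono: "s \<in> {0..1} \<Longrightarrow> t \<in> {0..1} \<Longrightarrow> s \<le> t \<Longrightarrow> sets (F s) \<subseteq> sets (F t)"
begin

lemma space_F: "t \<in> {0..1} \<Longrightarrow> space (F t) = space M"
  using subalg by (auto simp: subalgebra_def)

lemma sets_F_subset: "t \<in> {0..1} \<Longrightarrow> sets (F t) \<subseteq> sets M"
  using subalg by (auto simp: subalgebra_def)

lemma measurable_F_mono:
  assumes "f \<in> borel_measurable (F s)" "s \<in> {0..1}" "t \<in> {0..1}" "s \<le> t"
  shows "f \<in> borel_measurable (F t)"
  using assms F_mono[of s t] space_F
  by (intro measurable_from_subalg[OF _ assms(1)]) (auto simp: subalgebra_def)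

lemma measurable_F_M:
  assumes "f \<in> borel_measurable (F s)" "s \<in> {0..1}"
  shows "f \<in> borel_measurable M"
  using measurable_from_subalg[OF subalg assms(1)] assms(2) .

text \<open>The approximable events form a sigma-algebra. For a countable union, continuity from
  above leaves finitely many sets, and the latest of their approximation times is still below
  1.\<close>

lemma approx_event:
  assumes lc: "left_continuous_at_1 M F" and A: "A \<in> sets (F 1)" and "e > 0"
  shows "\<exists>t\<in>{0..<1}. \<exists>B\<in>sets (F t). prob (sym_diff A B) < e"
proof -
  have "A \<in> sigma_sets (space M) (\<Union>t\<in>{0..<1}. sets (F t))"
    using lc A by (simp add: left_continuous_at_1_def)
  then show ?thesis
    using \<open>e > 0\<close>
  proof (induction arbitrary: e rule: sigma_sets.induct)
    case (Basic A)
    then show ?case by force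
  next
    case Empty
    then show ?case by (intro bexI[of _ 0] bexI[of _ "{}"]) auto
  next
    case (Compl A)
    then obtain t B where t: "t \<in> {0..<1}" "B \<in> sets (F t)" "prob (sym_diff A B) < e" by metis
    have "A \<in> sets (F 1)"
      using Compl.hyps lc by (simp add: left_continuous_at_1_def)
    then have "A \<subseteq> space M" "B \<subseteq> space M"
      using sets.sets_into_space[of A "F 1"] sets.sets_into_space[OF t(2)] space_F[of 1] space_F[of t] t(1)
      by auto
    then have "sym_diff (space M - A) (space M - B) = sym_diff A B" by auto
    moreover have "space M - B \<in> sets (F t)"
      using sets.compl_sets[OF t(2)] space_F t(1) by auto
    ultimately show ?case using t by metis
  next
    case (Union A)
    have AM: "A i \<in> sets M" for i
    proof -
      have "A i \<in> sets (F 1)"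
        using Union.hyps lc by (simp add: left_continuous_at_1_def)
      then show ?thesis using sets_F_subset[of 1] by auto
    qed
    have "(\<lambda>n. prob ((\<Union>i. A i) - (\<Union>i<n. A i))) \<longlonglongrightarrow> prob (\<Inter>n. (\<Union>i. A i) - (\<Union>i<n. A i))"
      using AM by (intro finite_Lim_measure_decseq) (auto simp: decseq_def)
    moreover have "(\<Inter>n. (\<Union>i. A i) - (\<Union>i<n. A i)) = {}" by auto
    ultimately have "(\<lambda>n. prob ((\<Union>i. A i) - (\<Union>i<n. A i))) \<longlonglongrightarrow> 0"
      by (simp only: measure_empty)
    then have "\<forall>\<^sub>F n in sequentially. prob ((\<Union>i. A i) - (\<Union>i<n. A i)) < e / 2"
      using \<open>e > 0\<close> by (intro order_tendstoD) auto
    then obtain n where n: "prob ((\<Union>i. A i) - (\<Union>i<n. A i)) < e / 2"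
      by (auto simp: eventually_sequentially)
    \<comment> \<open>\<open>Suc n\<close> in place of \<open>n\<close> covers the case of an empty
      finite union.\<close>
    have "e / (2 * Suc n) > 0" using \<open>e > 0\<close> by simp
    then have "\<forall>i. \<exists>t\<in>{0..<1}. \<exists>B\<in>sets (F t). prob (sym_diff (A i) B) < e / (2 * Suc n)"
      using Union.IH by blast
    then obtain t B where tB: "\<And>i. t i \<in> {0..<1}" "\<And>i. B i \<in> sets (F (t i))"
      "\<And>i. prob (sym_diff (A i) (B i)) < e / (2 * Suc n)"
      by metis
    have BM: "B i \<in> sets M" for i
      using tB(1,2)[of i] sets_F_subset[of "t i"] by auto
    \<comment> \<open>Inserting 0 keeps the maximum meaningful when there are no indices, and it
      keeps \<open>T\<close> nonnegative.\<close>
    define T where "T = Max (insert 0 (t ` {..<n}))"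
    have "T \<in> insert 0 (t ` {..<n})"
      unfolding T_def by (rule Max_in) auto
    then have T: "T \<in> {0..<1}"
      using tB(1) by auto
    have "t i \<le> T" if "i < n" for i
      unfolding T_def using that by (intro Max_ge) auto
    then have "B i \<in> sets (F T)" if "i < n" for i
      using tB(1,2)[of i] F_mono[of "t i" T] that T by force
    then have BT: "(\<Union>i<n. B i) \<in> sets (F T)" by auto
    have "prob (sym_diff (\<Union>i. A i) (\<Union>i<n. B i)) \<le>
        prob (((\<Union>i. A i) - (\<Union>i<n. A i)) \<union> (\<Union>i<n. sym_diff (A i) (B i)))"
      using AM BM by (intro finite_measure_mono) auto
    also have "\<dots> \<le> prob ((\<Union>i. A i) - (\<Union>i<n. A i)) + prob (\<Union>i<n. sym_diff (A i) (B i))"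
      using AM BM by (intro measure_Un_le) auto
    also have "prob (\<Union>i<n. sym_diff (A i) (B i)) \<le> (\<Sum>i<n. prob (sym_diff (A i) (B i)))"
      using AM BM by (intro finite_measure_subadditive_finite) auto
    also have "\<dots> \<le> (\<Sum>i<n. e / (2 * Suc n))"
      using tB(3) by (intro sum_mono less_imp_le)
    also have "\<dots> \<le> e / 2"
      using \<open>e > 0\<close> by (simp add: field_simps)
    finally have "prob (sym_diff (\<Union>i. A i) (\<Union>i<n. B i)) < e"
      using n by simp
    then show ?case using T BT by blast
  qed
qed

text \<open>Round \<xi> down to a multiple of \<open>e\<close>, discard the event of large values,
  and replace each of the finitely many remaining level sets by an event known before time
  1.\<close>

lemma approx_random_variable:
  assumes lc: "left_continuous_at_1 M F" and \<xi>: "\<xi> \<in> borel_measurable (F 1)" and "e > 0"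
  shows "\<exists>t\<in>{0..<1}. \<exists>\<zeta>\<in>borel_measurable (F t). \<exists>K. (\<forall>\<omega>\<in>space M. \<bar>\<zeta> \<omega>\<bar> \<le> K) \<and>
    prob {\<omega>\<in>space M. \<bar>\<xi> \<omega> - \<zeta> \<omega>\<bar> > e} < e"
proof -
  note [measurable] = \<xi>
  have \<xi>M [measurable]: "\<xi> \<in> borel_measurable M"
    using \<xi> by (rule measurable_F_M) simp
  define A where "A k = {\<omega>\<in>space M. \<lfloor>\<xi> \<omega> / e\<rfloor> = k}" for k
  have A1: "A k \<in> sets (F 1)" for k
  proof -
    have "{\<omega>\<in>space (F 1). \<lfloor>\<xi> \<omega> / e\<rfloor> = k} \<in> sets (F 1)" by measurable
    then show ?thesis by (simp add: A_def space_F)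
  qed
  have AM: "A k \<in> sets M" for k
    using A1 sets_F_subset[of 1] by auto
  define R where "R n = {\<omega>\<in>space M. \<bar>real_of_int \<lfloor>\<xi> \<omega> / e\<rfloor>\<bar> > real n}" for n
  have RM: "R n \<in> sets M" for n
    unfolding R_def by measurable
  have "(\<lambda>n. prob (R n)) \<longlonglongrightarrow> prob (\<Inter>n. R n)"
    using RM by (intro finite_Lim_measure_decseq) (auto simp: decseq_def R_def)
  moreover have "(\<Inter>n. R n) = {}"
  proof -
    have "\<exists>n. \<not> \<bar>real_of_int \<lfloor>\<xi> \<omega> / e\<rfloor>\<bar> > real n" for \<omega>
      by (rule exI[of _ "nat \<bar>\<lfloor>\<xi> \<omega> / e\<rfloor>\<bar>"]) simp
    then show ?thesis by (auto simp: R_def)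
  qed
  ultimately have "(\<lambda>n. prob (R n)) \<longlonglongrightarrow> 0"
    by (simp only: measure_empty)
  then have "\<forall>\<^sub>F n in sequentially. prob (R n) < e / 2"
    using \<open>e > 0\<close> by (intro order_tendstoD) auto
  then obtain n where n: "prob (R n) < e / 2"
    by (auto simp: eventually_sequentially)
  define S where "S = {- int n..int n}"
  define N where "N = card S"
  have S: "finite S" "N > 0" by (auto simp: S_def N_def)
  have "\<forall>k. \<exists>t\<in>{0..<1}. \<exists>B\<in>sets (F t). prob (sym_diff (A k) B) < e / (2 * N)"
    using approx_event[OF lc A1] \<open>e > 0\<close> S by simp
  then obtain t B where tB: "\<And>k. t k \<in> {0..<1}" "\<And>k. B k \<in> sets (F (t k))"
    "\<And>k. prob (sym_diff (A k) (B k)) < e / (2 * N)"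
    by metis
  have BM: "B k \<in> sets M" for k
    using tB(1,2)[of k] sets_F_subset[of "t k"] by auto
  define T where "T = Max (insert 0 (t ` S))"
  have "T \<in> insert 0 (t ` S)"
    unfolding T_def using S by (intro Max_in) auto
  then have T: "T \<in> {0..<1}"
    using tB(1) by auto
  have "t k \<le> T" if "k \<in> S" for k
    unfolding T_def using that S by (intro Max_ge) auto
  then have BT: "B k \<in> sets (F T)" if "k \<in> S" for k
    using tB(1,2)[of k] F_mono[of "t k" T] that T by force
  \<comment> \<open>The sets \<open>B k\<close> may overlap. Outside the exceptional events,
    however, exactly one index in \<open>S\<close> is hit, so the sum has the rounded value there;
    elsewhere finiteness of \<open>S\<close> keeps it bounded.\<close>
  define \<zeta> where "\<zeta> \<omega> = (\<Sum>k\<in>S. (of_int k * e) * indicator (B k) \<omega>)" for \<omega>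
  have \<zeta>T: "\<zeta> \<in> borel_measurable (F T)"
    unfolding \<zeta>_def using BT by (intro borel_measurable_sum borel_measurable_times) auto
  have \<zeta>M [measurable]: "\<zeta> \<in> borel_measurable M"
    using measurable_F_M[OF \<zeta>T] T by auto
  have bnd: "\<bar>\<zeta> \<omega>\<bar> \<le> (\<Sum>k\<in>S. \<bar>of_int k * e\<bar>)" for \<omega>
    unfolding \<zeta>_def by (rule order_trans[OF sum_abs]) (auto intro!: sum_mono simp: indicator_def)
  have sub: "{\<omega>\<in>space M. \<bar>\<xi> \<omega> - \<zeta> \<omega>\<bar> > e} \<subseteq> R n \<union> (\<Union>k\<in>S. sym_diff (A k) (B k))"
  proof (rule subsetI, rule ccontr)
    fix \<omega> assume \<omega>: "\<omega> \<in> {\<omega>\<in>space M. \<bar>\<xi> \<omega> - \<zeta> \<omega>\<bar> > e}"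
      and "\<omega> \<notin> R n \<union> (\<Union>k\<in>S. sym_diff (A k) (B k))"
    then have R: "\<omega> \<notin> R n" and AB: "\<And>k. k \<in> S \<Longrightarrow> \<omega> \<notin> sym_diff (A k) (B k)" and "\<omega> \<in> space M"
      by blast+
    have "\<bar>real_of_int \<lfloor>\<xi> \<omega> / e\<rfloor>\<bar> \<le> real n"
      using R \<open>\<omega> \<in> space M\<close> by (simp add: R_def not_less)
    then have "\<lfloor>\<xi> \<omega> / e\<rfloor> \<in> S"
      unfolding S_def atLeastAtMost_iff by linarith
    moreover have "\<omega> \<in> B k \<longleftrightarrow> \<lfloor>\<xi> \<omega> / e\<rfloor> = k" if "k \<in> S" for k
      using AB[OF that] \<open>\<omega> \<in> space M\<close> by (auto simp: A_def)
    ultimately have *: "\<lfloor>\<xi> \<omega> / e\<rfloor> \<in> S" "\<And>k. k \<in> S \<Longrightarrow> \<omega> \<in> B k \<longleftrightarrow> \<lfloor>\<xi> \<omega> / e\<rfloor> = k"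
      by auto
    have "\<zeta> \<omega> = (\<Sum>k\<in>S. if k = \<lfloor>\<xi> \<omega> / e\<rfloor> then of_int k * e else 0)"
      unfolding \<zeta>_def using * by (intro sum.cong) (auto simp: indicator_def)
    also have "\<dots> = of_int \<lfloor>\<xi> \<omega> / e\<rfloor> * e"
      using * S by simp
    finally have "\<xi> \<omega> - \<zeta> \<omega> = (\<xi> \<omega> / e - of_int \<lfloor>\<xi> \<omega> / e\<rfloor>) * e"
      using \<open>e > 0\<close> by (simp add: left_diff_distrib)
    moreover have "0 \<le> \<xi> \<omega> / e - of_int \<lfloor>\<xi> \<omega> / e\<rfloor>" "\<xi> \<omega> / e - of_int \<lfloor>\<xi> \<omega> / e\<rfloor> \<le> 1"
      by linarith+
    ultimately have "\<bar>\<xi> \<omega> - \<zeta> \<omega>\<bar> \<le> e"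
      using \<open>e > 0\<close> mult_right_mono[of "\<xi> \<omega> / e - of_int \<lfloor>\<xi> \<omega> / e\<rfloor>" 1 e] by simp
    then show False using \<omega> by simp
  qed
  have "prob {\<omega>\<in>space M. \<bar>\<xi> \<omega> - \<zeta> \<omega>\<bar> > e} \<le> prob (R n \<union> (\<Union>k\<in>S. sym_diff (A k) (B k)))"
    using AM BM RM S by (intro finite_measure_mono sub) auto
  also have "\<dots> \<le> prob (R n) + prob (\<Union>k\<in>S. sym_diff (A k) (B k))"
    using AM BM RM S by (intro measure_Un_le) auto
  also have "prob (\<Union>k\<in>S. sym_diff (A k) (B k)) \<le> (\<Sum>k\<in>S. prob (sym_diff (A k) (B k)))"
    using AM BM S by (intro finite_measure_subadditive_finite) auto
  also have "\<dots> \<le> (\<Sum>k\<in>S. e / (2 * N))"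
    using tB(3) by (intro sum_mono less_imp_le)
  also have "\<dots> = e / 2"
    using S by (simp add: N_def[symmetric])
  finally have "prob {\<omega>\<in>space M. \<bar>\<xi> \<omega> - \<zeta> \<omega>\<bar> > e} < e"
    using n by simp
  then show ?thesis
    using T \<zeta>T bnd by blast
qed

end

section \<open>Stopped Riemann sums\<close>

text \<open>Only indices up to \<open>j\<close> are tested, so the coefficient is known at the left
  end of the interval on which it is used.\<close>

definition stop_coeff :: "real \<Rightarrow> (nat \<Rightarrow> real) \<Rightarrow> nat \<Rightarrow> real" where
  "stop_coeff \<theta> y j = (if \<forall>i\<le>j. \<bar>y i\<bar> < \<theta> then 2 * y j / \<theta>\<^sup>2 else 0)"

definition stop_sum :: "real \<Rightarrow> (nat \<Rightarrow> real) \<Rightarrow> nat \<Rightarrow> real" where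
  "stop_sum \<theta> y k = (\<Sum>j<k. stop_coeff \<theta> y j * (y (Suc j) - y j))"

text \<open>Telescoping \<open>2 y\<^sub>j (y\<^sub>j\<^sub>+\<^sub>1 - y\<^sub>j) = y\<^sub>j\<^sub>+\<^sub>1\<^sup>2 - y\<^sub>j\<^sup>2 - (y\<^sub>j\<^sub>+\<^sub>1 - y\<^sub>j)\<^sup>2\<close>, up to the first exit from
  \<open>(-\<theta>, \<theta>)\<close>.\<close>

lemma stop_sum_before:
  assumes "\<theta> > 0" "y 0 = 0" "\<And>i. i < k \<Longrightarrow> \<bar>y i\<bar> < \<theta>"
  shows "\<theta>\<^sup>2 * stop_sum \<theta> y k = (y k)\<^sup>2 - (\<Sum>j<k. (y (Suc j) - y j)\<^sup>2)"
  using assms(3)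
proof (induction k)
  case 0
  then show ?case using assms by (simp add: stop_sum_def)
next
  case (Suc k)
  have "stop_coeff \<theta> y k = 2 * y k / \<theta>\<^sup>2"
    using Suc.prems by (auto simp: stop_coeff_def)
  then have "\<theta>\<^sup>2 * stop_sum \<theta> y (Suc k) = \<theta>\<^sup>2 * stop_sum \<theta> y k + 2 * y k * (y (Suc k) - y k)"
    using assms(1) by (simp add: stop_sum_def distrib_left)
  also have "\<dots> = (y (Suc k))\<^sup>2 - (\<Sum>j<Suc k. (y (Suc j) - y j)\<^sup>2)"
    using Suc by (simp add: power2_eq_square algebra_simps)
  finally show ?case .
qed

lemma stop_sum_after:
  assumes "\<theta> > 0" "y 0 = 0" "\<kappa> \<ge> 0" "\<And>i. i < k \<Longrightarrow> \<bar>y (Suc i) - y i\<bar> \<le> \<kappa>"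
    and "\<exists>i<k. \<bar>y i\<bar> \<ge> \<theta>"
  shows "\<theta>\<^sup>2 - real k * \<kappa>\<^sup>2 \<le> \<theta>\<^sup>2 * stop_sum \<theta> y k \<and> \<theta>\<^sup>2 * stop_sum \<theta> y k \<le> (\<theta> + \<kappa>)\<^sup>2"
  using assms(4,5)
proof (induction k)
  case 0
  then show ?case by simp
next
  case (Suc k)
  have "\<exists>i\<le>k. \<bar>y i\<bar> \<ge> \<theta>"
    using Suc.prems(2) by (auto simp: less_Suc_eq_le)
  then have "stop_coeff \<theta> y k = 0"
    by (auto simp: stop_coeff_def)
  then have eq: "stop_sum \<theta> y (Suc k) = stop_sum \<theta> y k"
    by (simp add: stop_sum_def)
  show ?case
  proof (cases "\<exists>i<k. \<bar>y i\<bar> \<ge> \<theta>")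
    case True
    then have "\<theta>\<^sup>2 - real k * \<kappa>\<^sup>2 \<le> \<theta>\<^sup>2 * stop_sum \<theta> y k \<and> \<theta>\<^sup>2 * stop_sum \<theta> y k \<le> (\<theta> + \<kappa>)\<^sup>2"
      using Suc.IH Suc.prems(1) by auto
    then show ?thesis
      using zero_le_power2[of \<kappa>] unfolding eq of_nat_Suc distrib_right by linarith
  next
    case False
    \<comment> \<open>Here \<open>k\<close> is the first exit. It is not 0 because
      \<open>y 0 = 0\<close>, so its predecessor is still inside and bounds the overshoot.\<close>
    then have "\<bar>y k\<bar> \<ge> \<theta>"
      using Suc.prems(2) less_Suc_eq by auto
    with assms obtain m where m: "k = Suc m" by (cases k) auto
    have "\<bar>y m\<bar> < \<theta>" "\<bar>y k - y m\<bar> \<le> \<kappa>"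
      using False Suc.prems(1)[of m] by (auto simp: m)
    then have "\<bar>y k\<bar> \<le> \<bar>\<theta> + \<kappa>\<bar>" by linarith
    then have up: "(y k)\<^sup>2 \<le> (\<theta> + \<kappa>)\<^sup>2"
      by (simp add: abs_le_square_iff)
    have low: "\<theta>\<^sup>2 \<le> (y k)\<^sup>2"
      using \<open>\<bar>y k\<bar> \<ge> \<theta>\<close> assms(1) abs_le_square_iff[of \<theta> "y k"] by simp
    have "(\<Sum>j<k. (y (Suc j) - y j)\<^sup>2) \<le> (\<Sum>j<k. \<kappa>\<^sup>2)"
      using Suc.prems(1) assms(3) by (intro sum_mono) (auto simp: abs_le_square_iff[symmetric])
    then have "(\<Sum>j<k. (y (Suc j) - y j)\<^sup>2) \<le> real k * \<kappa>\<^sup>2"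
      by simp
    then have "(\<Sum>j<k. (y (Suc j) - y j)\<^sup>2) \<le> real (Suc k) * \<kappa>\<^sup>2"
      using zero_le_power2[of \<kappa>] unfolding of_nat_Suc distrib_right by linarith
    moreover have "0 \<le> (\<Sum>j<k. (y (Suc j) - y j)\<^sup>2)"
      by (intro sum_nonneg) auto
    moreover have "\<theta>\<^sup>2 * stop_sum \<theta> y k = (y k)\<^sup>2 - (\<Sum>j<k. (y (Suc j) - y j)\<^sup>2)"
      using False assms by (intro stop_sum_before) auto
    ultimately show ?thesis
      unfolding eq using up low by linarith
  qed
qed

text \<open>Here \<open>z\<close> stands for the path at a time between two grid points, where the
  last increment is only partly used.\<close>

lemma stop_sum_bounds:
  assumes "\<theta> > 0" "y 0 = 0" "\<kappa> \<ge> 0" "\<And>i. i < k \<Longrightarrow> \<bar>y (Suc i) - y i\<bar> \<le> \<kappa>" and z: "\<bar>z - y k\<bar> \<le> \<kappa>"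
  shows "\<theta>\<^sup>2 * (stop_sum \<theta> y k + stop_coeff \<theta> y k * (z - y k)) \<in> {- (real (Suc k) * \<kappa>\<^sup>2)..(\<theta> + \<kappa>)\<^sup>2}"
proof (cases "\<forall>i\<le>k. \<bar>y i\<bar> < \<theta>")
  case True
  have "(\<Sum>j<k. (y (Suc j) - y j)\<^sup>2) \<le> (\<Sum>j<k. \<kappa>\<^sup>2)"
    using assms by (intro sum_mono) (auto simp: abs_le_square_iff[symmetric])
  then have Q: "(\<Sum>j<k. (y (Suc j) - y j)\<^sup>2) \<le> real k * \<kappa>\<^sup>2" by simp
  have Q0: "0 \<le> (\<Sum>j<k. (y (Suc j) - y j)\<^sup>2)"
    by (intro sum_nonneg) auto
  have "\<theta>\<^sup>2 * stop_sum \<theta> y k = (y k)\<^sup>2 - (\<Sum>j<k. (y (Suc j) - y j)\<^sup>2)"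
    using True assms by (intro stop_sum_before) auto
  then have "\<theta>\<^sup>2 * (stop_sum \<theta> y k + stop_coeff \<theta> y k * (z - y k)) =
      z\<^sup>2 - (z - y k)\<^sup>2 - (\<Sum>j<k. (y (Suc j) - y j)\<^sup>2)"
    using True assms(1) by (simp add: stop_coeff_def distrib_left) (simp add: power2_eq_square algebra_simps)
  moreover have "(z - y k)\<^sup>2 \<le> \<kappa>\<^sup>2"
    using z assms(3) abs_le_square_iff[of "z - y k" \<kappa>] by simp
  moreover have "\<bar>y k\<bar> < \<theta>" using True by auto
  then have "\<bar>z\<bar> \<le> \<bar>\<theta> + \<kappa>\<bar>" using z by linarith
  then have "z\<^sup>2 \<le> (\<theta> + \<kappa>)\<^sup>2" by (simp add: abs_le_square_iff)
  ultimately show ?thesis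
    using Q Q0 zero_le_power2[of z] zero_le_power2[of "z - y k"] unfolding of_nat_Suc distrib_right atLeastAtMost_iff
    by linarith
next
  case False
  then have c: "stop_coeff \<theta> y k = 0" by (simp only: stop_coeff_def if_False)
  show ?thesis
  proof (cases "\<exists>i<k. \<bar>y i\<bar> \<ge> \<theta>")
    case True
    have "\<theta>\<^sup>2 - real k * \<kappa>\<^sup>2 \<le> \<theta>\<^sup>2 * stop_sum \<theta> y k \<and> \<theta>\<^sup>2 * stop_sum \<theta> y k \<le> (\<theta> + \<kappa>)\<^sup>2"
      using True assms by (intro stop_sum_after) auto
    then show ?thesis
      using zero_le_power2[of \<theta>] zero_le_power2[of \<kappa>]
      unfolding c of_nat_Suc distrib_right mult_zero_left add_0_right atLeastAtMost_iff by linarith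
  next
    case F: False
    have "\<exists>i<Suc k. \<bar>y i\<bar> \<ge> \<theta>" using False by (auto simp: not_less less_Suc_eq_le)
    \<comment> \<open>The exit happens exactly at \<open>k\<close>, whereas
      \<open>stop_sum_after\<close> needs one strictly before its index. Repeating the value
      \<open>y k\<close> once more makes room for it and adds a zero increment.\<close>
    define y' where "y' i = (if i \<le> k then y i else y k)" for i
    have eq: "stop_sum \<theta> y' (Suc k) = stop_sum \<theta> y k"
    proof -
      have "stop_coeff \<theta> y' j = stop_coeff \<theta> y j" if "j \<le> k" for j
        using that by (auto simp: stop_coeff_def y'_def)
      then show ?thesis
        using c by (auto simp: stop_sum_def y'_def intro!: sum.cong)
    qed
    have "\<theta>\<^sup>2 - real (Suc k) * \<kappa>\<^sup>2 \<le> \<theta>\<^sup>2 * stop_sum \<theta> y' (Suc k) \<and> \<theta>\<^sup>2 * stop_sum \<theta> y' (Suc k) \<le> (\<theta> + \<kappa>)\<^sup>2"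
      using assms \<open>\<exists>i<Suc k. \<bar>y i\<bar> \<ge> \<theta>\<close>
      by (intro stop_sum_after) (auto simp: y'_def less_Suc_eq_le Suc_le_eq)
    then show ?thesis
      using zero_le_power2[of \<theta>]
      unfolding eq c mult_zero_left add_0_right atLeastAtMost_iff by linarith
  qed
qed

lemma uniform_grid_near:
  fixes a b u :: real
  assumes "a < b" "u \<in> {a..b}" "N > 0"
  shows "\<exists>k<N. a + real k * ((b - a) / real N) \<le> u \<and> u \<le> a + real (Suc k) * ((b - a) / real N)"
proof (cases "u = b")
  \<comment> \<open>At the right end point the floor would give \<open>N\<close> instead of the last
    index \<open>N - 1\<close>.\<close>
  case True
  obtain m where "N = Suc m" using assms by (cases N) auto
  then show ?thesis
    using True assms by (intro exI[of _ m]) (auto simp: field_simps)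
next
  case False
  define h where "h = (b - a) / real N"
  have h: "h > 0" using assms by (simp add: h_def)
  define k where "k = nat \<lfloor>(u - a) / h\<rfloor>"
  have "(u - a) / h \<ge> 0" using assms h by auto
  then have k: "real k \<le> (u - a) / h" "(u - a) / h < real k + 1"
    unfolding k_def by linarith+
  have "(u - a) / h < real N"
    using False assms h by (simp add: h_def field_simps)
  then have "k < N" using k by linarith
  then show ?thesis
    using k h by (intro exI[of _ k]) (auto simp: field_simps h_def[symmetric])
qed

section \<open>Small balls, mesh size and a single stage\<close>

locale hoelder_process = filtered_space M F for M :: "'a measure" and F +
  fixes X :: "real \<Rightarrow> 'a \<Rightarrow> real" and \<alpha> \<delta> C1 C2 :: real
  assumes adapted: "t \<in> {0..1} \<Longrightarrow> X t \<in> borel_measurable (F t)"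
    and \<alpha>: "\<alpha> > 1 / 2" and \<delta>: "\<delta> > 0" and C1: "C1 > 0" and C2: "C2 > 0"
    and hoelder: "\<omega> \<in> space M \<Longrightarrow> s \<in> {0..1} \<Longrightarrow> t \<in> {0..1} \<Longrightarrow>
      \<bar>X t \<omega> - X s \<omega>\<bar> \<le> C1 * \<bar>t - s\<bar> powr \<alpha>"
    and small_ball: "s \<in> {1 - \<delta>..1} \<inter> {0..1} \<Longrightarrow> t \<in> {1 - \<delta>..1} \<inter> {0..1} \<Longrightarrow>
      s < t \<Longrightarrow> \<epsilon> > 0 \<Longrightarrow> \<epsilon> \<le> (t - s) powr \<alpha> \<Longrightarrow>
      prob {\<omega> \<in> space M. (SUP u\<in>{s..t}. \<bar>X u \<omega> - X s \<omega>\<bar>) \<le> \<epsilon>}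
        \<le> exp (- C2 * (t - s) * \<epsilon> powr (- 1 / \<alpha>))"
begin

lemma X_measurable [measurable]: "t \<in> {0..1} \<Longrightarrow> X t \<in> borel_measurable M"
  using measurable_F_M[OF adapted] .

lemma X_measurable_F: "s \<in> {0..1} \<Longrightarrow> t \<in> {0..1} \<Longrightarrow> s \<le> t \<Longrightarrow> X s \<in> borel_measurable (F t)"
  using measurable_F_mono[OF adapted] .

text \<open>The order 1/2 exceeds 1 - \<alpha> because \<alpha> > 1/2. Fixing one order for all
  stages is what allows their integrals to be summed.\<close>

lemma hoelder_integrator_path:
  assumes "\<omega> \<in> space M" "t \<in> {0..1}"
  shows "hoelder_integrator \<alpha> (1/2) C1 0 t (\<lambda>s. X s \<omega>)"
  using assms C1 \<alpha> hoelder by unfold_locales (auto simp: less_imp_le)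

text \<open>Testing on grids of all mesh sizes makes the supremum event measurable.\<close>

lemma sup_le_event:
  assumes ab: "0 \<le> a" "a < b" "b \<le> 1"
  shows "{\<omega> \<in> space M. (SUP u\<in>{a..b}. \<bar>X u \<omega> - X a \<omega>\<bar>) \<le> \<epsilon>} =
      {\<omega> \<in> space M. \<forall>u\<in>{a..b}. \<bar>X u \<omega> - X a \<omega>\<bar> \<le> \<epsilon>}"
    and "{\<omega> \<in> space M. \<forall>u\<in>{a..b}. \<bar>X u \<omega> - X a \<omega>\<bar> \<le> \<epsilon>} \<in> sets M"
proof -
  have bdd: "bdd_above ((\<lambda>u. \<bar>X u \<omega> - X a \<omega>\<bar>) ` {a..b})" if "\<omega> \<in> space M" for \<omega>
  proof (rule bdd_aboveI2)
    fix u assume u: "u \<in> {a..b}"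
    have "\<bar>X u \<omega> - X a \<omega>\<bar> \<le> C1 * \<bar>u - a\<bar> powr \<alpha>"
      using u ab that by (intro hoelder) auto
    also have "\<dots> \<le> C1 * (b - a) powr \<alpha>"
      using u C1 \<alpha> by (intro mult_left_mono powr_mono2) auto
    finally show "\<bar>X u \<omega> - X a \<omega>\<bar> \<le> C1 * (b - a) powr \<alpha>" .
  qed
  then show "{\<omega> \<in> space M. (SUP u\<in>{a..b}. \<bar>X u \<omega> - X a \<omega>\<bar>) \<le> \<epsilon>} =
      {\<omega> \<in> space M. \<forall>u\<in>{a..b}. \<bar>X u \<omega> - X a \<omega>\<bar> \<le> \<epsilon>}"
    using ab by (auto simp: cSUP_le_iff)
  define g where "g n k = a + real k * ((b - a) / real (Suc n))" for n k
  have g_Suc: "g n (Suc k) = g n k + (b - a) / real (Suc n)" for n k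
    unfolding g_def of_nat_Suc[of k] distrib_right by simp
  have g: "g n k \<in> {a..b}" if "k < Suc n" for n k
  proof -
    have "real k * (b - a) \<le> real (Suc n) * (b - a)"
      using that ab by (intro mult_right_mono) auto
    moreover have "a * real k \<le> b * real k"
      using ab by (intro mult_right_mono) auto
    ultimately show ?thesis using ab by (simp add: g_def field_simps)
  qed
  have "{\<omega> \<in> space M. \<forall>u\<in>{a..b}. \<bar>X u \<omega> - X a \<omega>\<bar> \<le> \<epsilon>} =
     (\<Inter>n. \<Inter>k\<in>{..<Suc n}. {\<omega> \<in> space M. \<bar>X (g n k) \<omega> - X a \<omega>\<bar> \<le> \<epsilon>})" (is "?L = ?R")
  proof (rule antisym)
    show "?L \<subseteq> ?R" using g by auto
    show "?R \<subseteq> ?L"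
    proof (rule subsetI)
      fix \<omega> assume R: "\<omega> \<in> ?R"
      then have \<omega>: "\<omega> \<in> space M" by auto
      have "\<bar>X u \<omega> - X a \<omega>\<bar> \<le> \<epsilon>" if u: "u \<in> {a..b}" for u
      proof -
      have "\<bar>X u \<omega> - X a \<omega>\<bar> \<le> \<epsilon> + C1 * ((b - a) / real (Suc n)) powr \<alpha>" for n
      proof -
        obtain k where k: "k < Suc n" "g n k \<le> u" "u \<le> g n (Suc k)"
          using uniform_grid_near[OF ab(2) u, of "Suc n"] by (auto simp: g_def)
        have "\<bar>X u \<omega> - X (g n k) \<omega>\<bar> \<le> C1 * \<bar>u - g n k\<bar> powr \<alpha>"
          using \<omega> u ab g[OF k(1)] by (intro hoelder) auto
        also have "\<dots> \<le> C1 * ((b - a) / real (Suc n)) powr \<alpha>"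
          using k C1 \<alpha> g_Suc[of n k] by (intro mult_left_mono powr_mono2) auto
        finally have "\<bar>X u \<omega> - X (g n k) \<omega>\<bar> \<le> C1 * ((b - a) / real (Suc n)) powr \<alpha>" .
        moreover have "\<bar>X (g n k) \<omega> - X a \<omega>\<bar> \<le> \<epsilon>"
          using R k by auto
        ultimately show ?thesis by linarith
      qed
      moreover have "(\<lambda>n. \<epsilon> + C1 * ((b - a) / real (Suc n)) powr \<alpha>) \<longlonglongrightarrow> \<epsilon> + C1 * 0 powr \<alpha>"
      proof -
        have "(\<lambda>n. (b - a) * inverse (real (Suc n))) \<longlonglongrightarrow> (b - a) * 0"
          by (intro tendsto_intros LIMSEQ_inverse_real_of_nat)
        then have "(\<lambda>n. (b - a) / real (Suc n)) \<longlonglongrightarrow> 0"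
          by (simp add: divide_inverse)
        then show ?thesis
          using \<alpha> ab by (intro tendsto_intros tendsto_powr') auto
      qed
      ultimately have "\<bar>X u \<omega> - X a \<omega>\<bar> \<le> \<epsilon> + C1 * 0 powr \<alpha>"
        by (intro LIMSEQ_le_const) auto
      then show ?thesis using \<alpha> by simp
      qed
      then show "\<omega> \<in> ?L" using \<omega> by simp
    qed
  qed
  moreover have "?R \<in> sets M"
  proof -
    have "{\<omega> \<in> space M. \<bar>X (g n k) \<omega> - X a \<omega>\<bar> \<le> \<epsilon>} \<in> sets M" if "k < Suc n" for n k
    proof -
      have "g n k \<in> {0..1}" "a \<in> {0..1}" using g[OF that] ab by auto
      then show ?thesis by measurable
    qed
    then have "(\<Inter>k\<in>{..<Suc n}. {\<omega> \<in> space M. \<bar>X (g n k) \<omega> - X a \<omega>\<bar> \<le> \<epsilon>}) \<in> sets M" for n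
      by (intro sets.finite_INT) auto
    then show ?thesis
      by (intro sets.countable_INT') auto
  qed
  ultimately show "{\<omega> \<in> space M. \<forall>u\<in>{a..b}. \<bar>X u \<omega> - X a \<omega>\<bar> \<le> \<epsilon>} \<in> sets M"
    by simp
qed

text \<open>For radii \<open>inverse (Suc n) powr \<alpha>\<close> the power in the exponent is just
  \<open>Suc n\<close>, so the estimate becomes a geometric sequence; the radii also drop below
  \<open>(b - a) powr \<alpha>\<close> eventually.\<close>

lemma small_ball_arbitrary:
  assumes ab: "0 \<le> a" "1 - \<delta> \<le> a" "a < b" "b \<le> 1" and "\<eta> > 0"
  shows "\<exists>\<epsilon>>0. prob {\<omega> \<in> space M. \<forall>u\<in>{a..b}. \<bar>X u \<omega> - X a \<omega>\<bar> \<le> \<epsilon>} \<le> \<eta>"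
proof -
  define \<epsilon> where "\<epsilon> n = inverse (real (Suc n)) powr \<alpha>" for n
  have pow: "\<epsilon> n powr (- 1 / \<alpha>) = real (Suc n)" for n
  proof -
    have "\<epsilon> n powr (- 1 / \<alpha>) = inverse (real (Suc n)) powr (- 1)"
      unfolding \<epsilon>_def powr_powr using \<alpha> by simp
    also have "\<dots> = real (Suc n)"
      by (simp add: powr_minus)
    finally show ?thesis .
  qed
  have "\<epsilon> \<longlonglongrightarrow> 0 powr \<alpha>"
    unfolding \<epsilon>_def using \<alpha> LIMSEQ_inverse_real_of_nat by (intro tendsto_powr') auto
  then have "\<epsilon> \<longlonglongrightarrow> 0" by simp
  then have 1: "\<forall>\<^sub>F n in sequentially. \<epsilon> n < (b - a) powr \<alpha>"
    using ab by (intro order_tendstoD) auto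
  have "(\<lambda>n. exp (- C2 * (b - a)) ^ n) \<longlonglongrightarrow> 0"
    using C2 ab by (intro LIMSEQ_power_zero) auto
  then have "(\<lambda>n. exp (- C2 * (b - a)) ^ Suc n) \<longlonglongrightarrow> 0"
    by (rule LIMSEQ_Suc)
  then have 2: "\<forall>\<^sub>F n in sequentially. exp (- C2 * (b - a)) ^ Suc n < \<eta>"
    using \<open>\<eta> > 0\<close> by (intro order_tendstoD) auto
  obtain n where n: "\<epsilon> n < (b - a) powr \<alpha>" "exp (- C2 * (b - a)) ^ Suc n < \<eta>"
    using eventually_happens'[OF _ eventually_conj[OF 1 2]] by auto
  have "\<epsilon> n > 0" by (simp add: \<epsilon>_def)
  have "prob {\<omega> \<in> space M. \<forall>u\<in>{a..b}. \<bar>X u \<omega> - X a \<omega>\<bar> \<le> \<epsilon> n} \<le> exp (- C2 * (b - a) * \<epsilon> n powr (- 1 / \<alpha>))"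
    using small_ball[of a b "\<epsilon> n"] \<open>\<epsilon> n > 0\<close> n ab sup_le_event(1)[of a b "\<epsilon> n"] by auto
  also have "\<dots> = exp (- C2 * (b - a)) ^ Suc n"
    unfolding pow by (simp only: exp_of_nat_mult[symmetric] mult.commute)
  finally show ?thesis
    using n(2) \<open>\<epsilon> n > 0\<close> by (intro exI[of _ "\<epsilon> n"]) auto
qed

text \<open>\<kappa> is the Hoelder bound for an increment over one mesh width. The term
  \<open>2 * \<theta> * \<kappa> + \<kappa>\<^sup>2\<close> is the overshoot
  \<open>(\<theta> + \<kappa>)\<^sup>2 - \<theta>\<^sup>2\<close>, and
  \<open>N * \<kappa>\<^sup>2\<close> bounds the quadratic variation; the latter is a multiple of
  \<open>inverse N powr (2 * \<alpha> - 1)\<close>.\<close>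

lemma mesh_exists:
  assumes "\<theta> > 0" "\<eta> > 0" "l > 0"
  shows "\<exists>N>0. let \<kappa> = C1 * (l / real N) powr \<alpha> in
    \<kappa> \<le> \<theta> \<and> 2 * \<theta> * \<kappa> + \<kappa>\<^sup>2 + real N * \<kappa>\<^sup>2 \<le> \<eta> * \<theta>\<^sup>2"
proof -
  define \<kappa> where "\<kappa> n = C1 * (l / real (Suc n)) powr \<alpha>" for n
  have inv: "(\<lambda>n. inverse (real (Suc n)) powr p) \<longlonglongrightarrow> 0" if "p > 0" for p
  proof -
    have "(\<lambda>n. inverse (real (Suc n)) powr p) \<longlonglongrightarrow> 0 powr p"
      using that LIMSEQ_inverse_real_of_nat by (intro tendsto_powr') auto
    then show ?thesis by simp
  qed
  have \<kappa>: "\<kappa> n = C1 * l powr \<alpha> * inverse (real (Suc n)) powr \<alpha>" for n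
    unfolding \<kappa>_def divide_inverse using assms by (subst powr_mult) auto
  have k0: "\<kappa> \<longlonglongrightarrow> 0"
    unfolding \<kappa>[abs_def] using inv[of \<alpha>] \<alpha> by (auto intro!: tendsto_mult_right_zero)
  have "real (Suc n) * (\<kappa> n)\<^sup>2 = (C1 * l powr \<alpha>)\<^sup>2 * inverse (real (Suc n)) powr (2 * \<alpha> - 1)" for n
  proof -
    let ?i = "inverse (real (Suc n))"
    have "(?i powr \<alpha>)\<^sup>2 = ?i powr (2 * \<alpha>)"
      by (simp add: power2_eq_square powr_add[symmetric])
    also have "\<dots> = ?i powr (1 + (2 * \<alpha> - 1))" by simp
    also have "\<dots> = ?i * ?i powr (2 * \<alpha> - 1)" by (subst powr_add) simp
    finally have "real (Suc n) * (?i powr \<alpha>)\<^sup>2 = ?i powr (2 * \<alpha> - 1)"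
      by (simp del: of_nat_Suc)
    then show ?thesis
      unfolding \<kappa> power_mult_distrib by (metis mult.left_commute)
  qed
  then have n0: "(\<lambda>n. real (Suc n) * (\<kappa> n)\<^sup>2) \<longlonglongrightarrow> 0"
    using inv[of "2 * \<alpha> - 1"] \<alpha> by (auto intro!: tendsto_mult_right_zero)
  have "(\<lambda>n. 2 * \<theta> * \<kappa> n + (\<kappa> n)\<^sup>2 + real (Suc n) * (\<kappa> n)\<^sup>2) \<longlonglongrightarrow> 2 * \<theta> * 0 + 0\<^sup>2 + 0"
    by (intro tendsto_intros k0 n0)
  then have 1: "\<forall>\<^sub>F n in sequentially. 2 * \<theta> * \<kappa> n + (\<kappa> n)\<^sup>2 + real (Suc n) * (\<kappa> n)\<^sup>2 < \<eta> * \<theta>\<^sup>2"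
    using assms by (intro order_tendstoD) auto
  have 2: "\<forall>\<^sub>F n in sequentially. \<kappa> n < \<theta>"
    using k0 assms by (intro order_tendstoD) auto
  obtain n where "2 * \<theta> * \<kappa> n + (\<kappa> n)\<^sup>2 + real (Suc n) * (\<kappa> n)\<^sup>2 < \<eta> * \<theta>\<^sup>2" "\<kappa> n < \<theta>"
    using eventually_happens'[OF _ eventually_conj[OF 1 2]] by auto
  then show ?thesis
    by (intro exI[of _ "Suc n"]) (auto simp: \<kappa>_def Let_def less_imp_le)
qed

text \<open>\<rho> is the integral of \<phi> as a function of the upper limit. Its two-sided bound
  holds on every path, so even a failed stage changes the value by a controlled amount; only the
  lower bound at the end is probabilistic.\<close>

definition stage :: "real \<Rightarrow> real \<Rightarrow> real \<Rightarrow> (real \<Rightarrow> 'a \<Rightarrow> real) \<Rightarrow> (real \<Rightarrow> 'a \<Rightarrow> real) \<Rightarrow> bool" where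
  "stage a b \<eta> \<phi> \<rho> \<longleftrightarrow>
     (\<forall>s\<in>{0..1}. \<phi> s \<in> borel_measurable (F s)) \<and> (\<forall>s \<omega>. s \<notin> {a<..b} \<longrightarrow> \<phi> s \<omega> = 0) \<and>
     (\<forall>\<omega>\<in>space M. \<forall>t\<in>{0..1}. borel_gls (1/2) (\<lambda>s. \<phi> s \<omega>) (\<lambda>s. X s \<omega>) 0 t (\<rho> t \<omega>)) \<and>
     \<rho> b \<in> borel_measurable (F b) \<and> (\<forall>t \<omega>. t \<le> a \<longrightarrow> \<rho> t \<omega> = 0) \<and> (\<forall>t \<omega>. b \<le> t \<longrightarrow> \<rho> t \<omega> = \<rho> b \<omega>) \<and>
     (\<forall>\<omega>\<in>space M. \<forall>t\<in>{a..b}. - \<eta> \<le> \<rho> t \<omega> \<and> \<rho> t \<omega> \<le> 1 + \<eta>) \<and>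
     prob {\<omega>\<in>space M. \<rho> b \<omega> < 1 - \<eta>} \<le> \<eta>"

lemma stage_exists:
  assumes ab: "0 \<le> a" "1 - \<delta> \<le> a" "a < b" "b < 1" and "\<eta> > 0"
  shows "\<exists>\<phi> \<rho>. stage a b \<eta> \<phi> \<rho>"
proof -
  obtain \<epsilon> where \<epsilon>: "\<epsilon> > 0" "prob {\<omega> \<in> space M. \<forall>u\<in>{a..b}. \<bar>X u \<omega> - X a \<omega>\<bar> \<le> \<epsilon>} \<le> \<eta>"
    using small_ball_arbitrary[of a b \<eta>] ab \<open>\<eta> > 0\<close> by auto
  \<comment> \<open>Half the radius leaves room for one grid step: a path further than \<epsilon>
    from its start is still at distance at least \<open>\<epsilon> - \<kappa> \<ge> \<theta>\<close>
    at the preceding grid point.\<close>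
  define \<theta> where "\<theta> = \<epsilon> / 2"
  have \<theta>: "\<theta> > 0" using \<epsilon> by (simp add: \<theta>_def)
  obtain N where "N > 0" and "let \<kappa> = C1 * ((b - a) / real N) powr \<alpha> in
      \<kappa> \<le> \<theta> \<and> 2 * \<theta> * \<kappa> + \<kappa>\<^sup>2 + real N * \<kappa>\<^sup>2 \<le> \<eta> * \<theta>\<^sup>2"
    using mesh_exists[of \<theta> \<eta> "b - a"] \<theta> ab \<open>\<eta> > 0\<close> by auto
  moreover define \<kappa> where "\<kappa> = C1 * ((b - a) / real N) powr \<alpha>"
  ultimately have \<kappa>: "\<kappa> \<le> \<theta>" "2 * \<theta> * \<kappa> + \<kappa>\<^sup>2 + real N * \<kappa>\<^sup>2 \<le> \<eta> * \<theta>\<^sup>2"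
    by (simp_all add: Let_def)
  have \<kappa>0: "\<kappa> \<ge> 0" using C1 by (simp add: \<kappa>_def)
  define h where "h = (b - a) / real N"
  have h: "h > 0" using ab \<open>N > 0\<close> by (simp add: h_def)
  define u where "u j = a + real j * h" for j :: nat
  have u0: "u 0 = a" and uN: "u N = b"
    using \<open>N > 0\<close> by (auto simp: u_def h_def)
  have u_mono: "i \<le> j \<Longrightarrow> u i \<le> u j" for i j
    using h by (simp add: u_def)
  have u_Suc: "u (Suc j) = u j + h" for j
    by (simp add: u_def distrib_right)
  have u01: "u j \<in> {0..1}" "u j \<in> {a..b}" if "j \<le> N" for j
    using u_mono[of 0 j] u_mono[OF that] u0 uN ab by auto
  define y where "y \<omega> j = X (u j) \<omega> - X a \<omega>" for \<omega> j
  define c where "c j \<omega> = stop_coeff \<theta> (y \<omega>) j" for j \<omega>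
  define \<phi> where "\<phi> s \<omega> = (\<Sum>j<N. c j \<omega> * indicator {u j<..u (Suc j)} s)" for s \<omega>
  define \<rho> where "\<rho> t \<omega> = (\<Sum>j<N. c j \<omega> * (X (min t (u (Suc j))) \<omega> - X (min t (u j)) \<omega>))" for t \<omega>
  have y0: "y \<omega> 0 = 0" for \<omega> by (simp add: y_def u0)
  have inc: "\<bar>X t \<omega> - X s \<omega>\<bar> \<le> \<kappa>" if "\<omega> \<in> space M" "s \<in> {0..1}" "t \<in> {0..1}" "\<bar>t - s\<bar> \<le> h" for s t \<omega>
  proof -
    have "\<bar>X t \<omega> - X s \<omega>\<bar> \<le> C1 * \<bar>t - s\<bar> powr \<alpha>"
      using that by (intro hoelder) auto
    also have "\<dots> \<le> \<kappa>"
      unfolding \<kappa>_def h_def[symmetric] using that C1 \<alpha> by (intro mult_left_mono powr_mono2) auto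
    finally show ?thesis .
  qed
  have yinc: "\<bar>y \<omega> (Suc i) - y \<omega> i\<bar> \<le> \<kappa>" if "\<omega> \<in> space M" "i < N" for \<omega> i
    using inc[of \<omega> "u i" "u (Suc i)"] that u01(1)[of i] u01(1)[of "Suc i"] h by (simp add: y_def u_Suc)
  have c_meas: "c j \<in> borel_measurable (F s)" if "j \<le> N" "u j \<le> s" "s \<in> {0..1}" for j s
  proof -
    have m: "(\<lambda>\<omega>. y \<omega> i) \<in> borel_measurable (F s)" if "i \<le> j" for i
    proof -
      have "u i \<le> s" using u_mono[OF that] \<open>u j \<le> s\<close> by simp
      moreover have "a \<le> s" using \<open>u j \<le> s\<close> u01(2)[OF \<open>j \<le> N\<close>] by simp
      ultimately show ?thesis
        unfolding y_def using u01(1)[of i] that \<open>j \<le> N\<close> \<open>s \<in> {0..1}\<close> ab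
        by (intro borel_measurable_diff X_measurable_F) simp_all
    qed
    have "Measurable.pred (F s) (\<lambda>\<omega>. \<forall>i\<in>{..j}. \<bar>y \<omega> i\<bar> < \<theta>)"
    proof (intro pred_intros_finite)
      fix i assume "i \<in> {..j}"
      then have [measurable]: "(\<lambda>\<omega>. y \<omega> i) \<in> borel_measurable (F s)" using m by auto
      show "Measurable.pred (F s) (\<lambda>\<omega>. \<bar>y \<omega> i\<bar> < \<theta>)" by measurable
    qed auto
    then have "{\<omega> \<in> space (F s). \<forall>i\<le>j. \<bar>y \<omega> i\<bar> < \<theta>} \<in> sets (F s)"
      by (simp only: pred_def Ball_def atMost_iff)
    then show ?thesis
      unfolding c_def stop_coeff_def
      by (intro measurable_If borel_measurable_divide borel_measurable_times borel_measurable_const m order_refl)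
  qed
  \<comment> \<open>A summand is nonzero only for \<open>u j < s\<close>, and then its coefficient
    reads the path at times before \<open>s\<close>.\<close>
  have 1: "\<phi> s \<in> borel_measurable (F s)" if s: "s \<in> {0..1}" for s
    unfolding \<phi>_def
  proof (rule borel_measurable_sum)
    fix j assume "j \<in> {..<N}"
    then show "(\<lambda>\<omega>. c j \<omega> * indicator {u j<..u (Suc j)} s) \<in> borel_measurable (F s)"
      using c_meas[of j s] s by (cases "s \<in> {u j<..u (Suc j)}") auto
  qed
  have 2: "\<phi> s \<omega> = 0" if "s \<notin> {a<..b}" for s \<omega>
    unfolding \<phi>_def
  proof (rule sum.neutral, rule ballI)
    fix j assume "j \<in> {..<N}"
    then have "s \<notin> {u j<..u (Suc j)}"
      using that u01(2)[of j] u01(2)[of "Suc j"] by auto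
    then show "c j \<omega> * indicator {u j<..u (Suc j)} s = 0" by simp
  qed
  have 3: "borel_gls (1/2) (\<lambda>s. \<phi> s \<omega>) (\<lambda>s. X s \<omega>) 0 t (\<rho> t \<omega>)" if "\<omega> \<in> space M" "t \<in> {0..1}" for \<omega> t
  proof -
    interpret hoelder_integrator \<alpha> "1/2" C1 0 t "\<lambda>s. X s \<omega>"
      using that by (rule hoelder_integrator_path)
    show ?thesis
      unfolding \<phi>_def \<rho>_def
    proof (intro borel_gls_sum borel_gls_cmult)
      fix j assume "j \<in> {..<N}"
      then show "borel_gls (1/2) (indicator {u j<..u (Suc j)}) (\<lambda>s. X s \<omega>) 0 t
          (X (min t (u (Suc j))) \<omega> - X (min t (u j)) \<omega>)"
        using u01(1)[of j] h by (intro borel_gls_interval) (auto simp: u_Suc)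
    qed
  qed
  have 4: "\<rho> b \<in> borel_measurable (F b)"
    unfolding \<rho>_def
  proof (rule borel_measurable_sum)
    fix j assume "j \<in> {..<N}"
    then show "(\<lambda>\<omega>. c j \<omega> * (X (min b (u (Suc j))) \<omega> - X (min b (u j)) \<omega>)) \<in> borel_measurable (F b)"
      using u01[of j] u01[of "Suc j"] ab
      by (intro borel_measurable_times borel_measurable_diff c_meas X_measurable_F) auto
  qed
  have 5: "\<rho> t \<omega> = 0" if "t \<le> a" for t \<omega>
    unfolding \<rho>_def
  proof (rule sum.neutral, rule ballI)
    fix j assume "j \<in> {..<N}"
    then have "min t (u (Suc j)) = min t (u j)"
      using that u01(2)[of j] u01(2)[of "Suc j"] by auto
    then show "c j \<omega> * (X (min t (u (Suc j))) \<omega> - X (min t (u j)) \<omega>) = 0" by simp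
  qed
  have \<rho>_late: "\<rho> t \<omega> = stop_sum \<theta> (y \<omega>) N" if "b \<le> t" for t \<omega>
    unfolding \<rho>_def stop_sum_def
  proof (rule sum.cong)
    fix j assume "j \<in> {..<N}"
    then have "min t (u (Suc j)) = u (Suc j)" "min t (u j) = u j"
      using that u01(2)[of j] u01(2)[of "Suc j"] by auto
    then show "c j \<omega> * (X (min t (u (Suc j))) \<omega> - X (min t (u j)) \<omega>) =
       stop_coeff \<theta> (y \<omega>) j * (y \<omega> (Suc j) - y \<omega> j)"
      by (simp add: c_def y_def)
  qed simp
  have 7: "- \<eta> \<le> \<rho> t \<omega> \<and> \<rho> t \<omega> \<le> 1 + \<eta>" if \<omega>: "\<omega> \<in> space M" and t: "t \<in> {a..b}" for \<omega> t
  proof -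
    obtain k where k: "k < N" "u k \<le> t" "t \<le> u (Suc k)"
      using uniform_grid_near[OF ab(3) t \<open>N > 0\<close>] unfolding u_def h_def by auto
    \<comment> \<open>Intervals to the right of \<open>t\<close> contribute nothing, since both
      minima equal \<open>t\<close>.\<close>
    have "\<rho> t \<omega> = (\<Sum>j<Suc k. c j \<omega> * (X (min t (u (Suc j))) \<omega> - X (min t (u j)) \<omega>))"
      unfolding \<rho>_def
    proof (rule sum.mono_neutral_right)
      show "\<forall>j\<in>{..<N} - {..<Suc k}. c j \<omega> * (X (min t (u (Suc j))) \<omega> - X (min t (u j)) \<omega>) = 0"
      proof
        fix j assume "j \<in> {..<N} - {..<Suc k}"
        then have "t \<le> u j" "t \<le> u (Suc j)"
          using k u_mono[of "Suc k" j] u_mono[of "Suc k" "Suc j"] by auto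
        then show "c j \<omega> * (X (min t (u (Suc j))) \<omega> - X (min t (u j)) \<omega>) = 0" by (simp add: min_absorb1)
      qed
    qed (use k in auto)
    also have "\<dots> = stop_sum \<theta> (y \<omega>) k + stop_coeff \<theta> (y \<omega>) k * ((X t \<omega> - X a \<omega>) - y \<omega> k)"
    proof -
      have "(\<Sum>j<k. c j \<omega> * (X (min t (u (Suc j))) \<omega> - X (min t (u j)) \<omega>)) = stop_sum \<theta> (y \<omega>) k"
        unfolding stop_sum_def
      proof (rule sum.cong)
        fix j assume "j \<in> {..<k}"
        then have "u j \<le> t" "u (Suc j) \<le> t"
          using k u_mono[of j k] u_mono[of "Suc j" k] by auto
        then show "c j \<omega> * (X (min t (u (Suc j))) \<omega> - X (min t (u j)) \<omega>) =
            stop_coeff \<theta> (y \<omega>) j * (y \<omega> (Suc j) - y \<omega> j)"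
          by (simp add: c_def y_def min_absorb2)
      qed simp
      then show ?thesis
        using k by (simp add: c_def y_def min_absorb1 min_absorb2)
    qed
    finally have eq: "\<rho> t \<omega> = stop_sum \<theta> (y \<omega>) k + stop_coeff \<theta> (y \<omega>) k * ((X t \<omega> - X a \<omega>) - y \<omega> k)" .
    have z: "\<bar>(X t \<omega> - X a \<omega>) - y \<omega> k\<bar> \<le> \<kappa>"
      using inc[OF \<omega>, of "u k" t] k u01(1)[of k] t ab by (simp add: y_def u_Suc)
    have e: "\<theta>\<^sup>2 * (- \<eta>) = - (\<eta> * \<theta>\<^sup>2)" "\<theta>\<^sup>2 * (1 + \<eta>) = \<theta>\<^sup>2 + \<eta> * \<theta>\<^sup>2"
      by (simp_all add: algebra_simps)
    have "\<theta>\<^sup>2 * \<rho> t \<omega> \<in> {- (real (Suc k) * \<kappa>\<^sup>2)..(\<theta> + \<kappa>)\<^sup>2}"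
      unfolding eq using \<theta> \<kappa>0 y0 yinc[OF \<omega>] k z by (intro stop_sum_bounds) auto
    moreover have "real (Suc k) * \<kappa>\<^sup>2 \<le> real N * \<kappa>\<^sup>2"
      using k by (intro mult_right_mono) auto
    moreover have "0 \<le> real N * \<kappa>\<^sup>2" "0 \<le> 2 * \<theta> * \<kappa> + \<kappa>\<^sup>2"
      using \<theta> \<kappa>0 by auto
    moreover have "(\<theta> + \<kappa>)\<^sup>2 = \<theta>\<^sup>2 + (2 * \<theta> * \<kappa> + \<kappa>\<^sup>2)"
      by (simp add: power2_sum)
    ultimately have "\<theta>\<^sup>2 * (- \<eta>) \<le> \<theta>\<^sup>2 * \<rho> t \<omega>" "\<theta>\<^sup>2 * \<rho> t \<omega> \<le> \<theta>\<^sup>2 * (1 + \<eta>)"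
      using \<kappa>(2) unfolding e atLeastAtMost_iff by linarith+
    then show ?thesis
      using \<theta> by (blast intro: mult_left_le_imp_le zero_less_power)
  qed
  \<comment> \<open>Leaving the ball forces an exit that the grid detects at some
    \<open>k < N\<close>, and then \<open>stop_sum_after\<close> gives at least
    \<open>1 - \<eta>\<close>.\<close>
  have "{\<omega>\<in>space M. \<rho> b \<omega> < 1 - \<eta>} \<subseteq> {\<omega> \<in> space M. \<forall>u\<in>{a..b}. \<bar>X u \<omega> - X a \<omega>\<bar> \<le> \<epsilon>}"
  proof (intro subsetI, rule ccontr)
    fix \<omega> assume \<omega>: "\<omega> \<in> {\<omega>\<in>space M. \<rho> b \<omega> < 1 - \<eta>}"
      and "\<omega> \<notin> {\<omega> \<in> space M. \<forall>u\<in>{a..b}. \<bar>X u \<omega> - X a \<omega>\<bar> \<le> \<epsilon>}"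
    then obtain v where v: "v \<in> {a..b}" "\<bar>X v \<omega> - X a \<omega>\<bar> > \<epsilon>" by auto
    obtain k where k: "k < N" "u k \<le> v" "v \<le> u (Suc k)"
      using uniform_grid_near[OF ab(3) v(1) \<open>N > 0\<close>] unfolding u_def h_def by auto
    have "\<bar>X v \<omega> - X (u k) \<omega>\<bar> \<le> \<kappa>"
      using inc[of \<omega> "u k" v] \<omega> k u01(1)[of k] v ab by (simp add: u_Suc)
    then have "\<bar>y \<omega> k\<bar> \<ge> \<theta>"
      using v(2) \<kappa>(1) unfolding y_def \<theta>_def by linarith
    then have "\<theta>\<^sup>2 - real N * \<kappa>\<^sup>2 \<le> \<theta>\<^sup>2 * stop_sum \<theta> (y \<omega>) N"
      using stop_sum_after[of \<theta> "y \<omega>" \<kappa> N] \<theta> y0 \<kappa>0 yinc \<omega> k by auto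
    moreover have "real N * \<kappa>\<^sup>2 \<le> \<eta> * \<theta>\<^sup>2"
    proof -
      have "0 \<le> 2 * \<theta> * \<kappa> + \<kappa>\<^sup>2" using \<theta> \<kappa>0 by auto
      then show ?thesis using \<kappa>(2) by linarith
    qed
    ultimately have "\<theta>\<^sup>2 * (1 - \<eta>) \<le> \<theta>\<^sup>2 * \<rho> b \<omega>"
      unfolding \<rho>_late[OF order_refl] by (simp add: algebra_simps)
    then have "1 - \<eta> \<le> \<rho> b \<omega>"
      using \<theta> by (auto simp: mult_le_cancel_left)
    then show False using \<omega> by auto
  qed
  then have "prob {\<omega>\<in>space M. \<rho> b \<omega> < 1 - \<eta>} \<le> prob {\<omega> \<in> space M. \<forall>u\<in>{a..b}. \<bar>X u \<omega> - X a \<omega>\<bar> \<le> \<epsilon>}"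
    using ab by (intro finite_measure_mono sup_le_event(2)) auto
  then have 8: "prob {\<omega>\<in>space M. \<rho> b \<omega> < 1 - \<eta>} \<le> \<eta>"
    using \<epsilon> by simp
  have "stage a b \<eta> \<phi> \<rho>"
    unfolding stage_def using 1 2 3 4 5 7 8 \<rho>_late by auto
  then show ?thesis by blast
qed

end

section \<open>Representation of terminal values\<close>

lemma suminf_eq_sum_lessThan:
  fixes f :: "nat \<Rightarrow> real"
  assumes "\<And>n. n \<ge> N \<Longrightarrow> f n = 0"
  shows "suminf f = (\<Sum>n<N. f n)"
  using assms by (intro suminf_finite) (auto simp: not_less)

context hoelder_process
begin

lemma adapted_approximation:
  fixes \<xi> :: "'a \<Rightarrow> real"
  assumes "left_continuous_at_1 M F" and "\<xi> \<in> borel_measurable (F 1)" and "t0 \<in> {0..<1}"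
  shows "\<exists>t \<zeta> K. (\<forall>n. t0 \<le> t n \<and> t n < t (Suc n) \<and> t n < 1) \<and> t \<longlonglongrightarrow> 1 \<and>
    (\<forall>n. \<zeta> n \<in> borel_measurable (F (t n)) \<and> (\<forall>\<omega>\<in>space M. \<bar>\<zeta> n \<omega>\<bar> \<le> K n) \<and>
      prob {\<omega>\<in>space M. \<bar>\<xi> \<omega> - \<zeta> n \<omega>\<bar> > (1/2) ^ n} < (1/2) ^ n)"
proof -
  have "\<forall>n. \<exists>s \<zeta> K. s \<in> {0..<1} \<and> \<zeta> \<in> borel_measurable (F s) \<and> (\<forall>\<omega>\<in>space M. \<bar>\<zeta> \<omega>\<bar> \<le> K) \<and>
    prob {\<omega>\<in>space M. \<bar>\<xi> \<omega> - \<zeta> \<omega>\<bar> > (1/2) ^ n} < (1/2) ^ n"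
  proof
    fix n :: nat
    have "(0::real) < (1/2) ^ n" by simp
    from approx_random_variable[OF assms(1,2) this]
    show "\<exists>s \<zeta> K. s \<in> {0..<1} \<and> \<zeta> \<in> borel_measurable (F s) \<and> (\<forall>\<omega>\<in>space M. \<bar>\<zeta> \<omega>\<bar> \<le> K) \<and>
      prob {\<omega>\<in>space M. \<bar>\<xi> \<omega> - \<zeta> \<omega>\<bar> > (1/2) ^ n} < (1/2) ^ n"
      by blast
  qed
  then obtain s \<zeta> K where sK: "\<forall>n. s n \<in> {0..<1} \<and> \<zeta> n \<in> borel_measurable (F (s n)) \<and>
    (\<forall>\<omega>\<in>space M. \<bar>\<zeta> n \<omega>\<bar> \<le> K n) \<and> prob {\<omega>\<in>space M. \<bar>\<xi> \<omega> - \<zeta> n \<omega>\<bar> > (1/2) ^ n} < (1/2) ^ n"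
    unfolding choice_iff by (elim exE)
  then have s: "s n \<in> {0..<1}" "\<zeta> n \<in> borel_measurable (F (s n))"
    and K: "\<forall>\<omega>\<in>space M. \<bar>\<zeta> n \<omega>\<bar> \<le> K n"
    "prob {\<omega>\<in>space M. \<bar>\<xi> \<omega> - \<zeta> n \<omega>\<bar> > (1/2) ^ n} < (1/2) ^ n" for n
    by blast+
  \<comment> \<open>The maximum with \<open>s (Suc n)\<close> makes \<open>\<zeta> (Suc n)\<close>
    measurable at its time. The midpoint to 1 gives strict growth and halves the remaining
    distance.\<close>
  define t where "t = rec_nat (max (s 0) t0) (\<lambda>n x. max (s (Suc n)) ((1 + x) / 2))"
  have t_0: "t 0 = max (s 0) t0" and t_Suc: "t (Suc n) = max (s (Suc n)) ((1 + t n) / 2)" for n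
    by (simp_all add: t_def)
  have t1: "t n < 1" for n
    by (induction n) (use s(1) assms(3) in \<open>auto simp: t_0 t_Suc\<close>)
  have inc: "t n < t (Suc n)" for n
    using t1[of n] by (simp add: t_Suc less_max_iff_disj)
  have ge: "t0 \<le> t n" for n
    by (induction n) (use inc in \<open>auto simp: t_0 intro: order_trans less_imp_le\<close>)
  have "s n \<le> t n" for n
    by (cases n) (auto simp: t_0 t_Suc)
  then have \<zeta>: "\<zeta> n \<in> borel_measurable (F (t n))" for n
    using s[of n] t1[of n] by (intro measurable_F_mono[OF s(2)]) (auto intro: order_trans)
  have bound: "1 - t n \<le> (1/2) ^ n" for n
  proof (induction n)
    case 0
    then show ?case using s(1)[of 0] by (auto simp: t_0)
  next
    case (Suc n)
    have "1 - t (Suc n) \<le> (1 - t n) / 2" by (simp add: t_Suc max_def field_simps)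
    then show ?case using Suc by simp
  qed
  have "(\<lambda>n. 1 - t n) \<longlonglongrightarrow> 0"
  proof (rule tendsto_sandwich[where f = "\<lambda>_. 0" and h = "\<lambda>n. (1/2) ^ n"])
    show "(\<lambda>n. (1 / 2) ^ n :: real) \<longlonglongrightarrow> 0"
      by (intro LIMSEQ_power_zero) auto
  qed (use bound t1 in \<open>auto intro!: always_eventually less_imp_le\<close>)
  then have "(\<lambda>n. 1 - (1 - t n)) \<longlonglongrightarrow> 1 - 0"
    by (intro tendsto_intros)
  then have "t \<longlonglongrightarrow> 1" by simp
  then show ?thesis
    using ge inc t1 \<zeta> K by blast
qed

lemma representation:
  fixes \<xi> :: "'a \<Rightarrow> real"
  assumes lc: "left_continuous_at_1 M F" and \<xi>: "\<xi> \<in> borel_measurable (F 1)"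
  shows "\<exists>\<psi>. adapted F \<psi> \<and>
    (AE \<omega> in M. \<exists>I. (\<forall>t\<in>{0..<1}. has_gls_integral \<alpha> (\<lambda>s. \<psi> s \<omega>) (\<lambda>s. X s \<omega>) 0 t (I t)) \<and>
              (I \<longlongrightarrow> \<xi> \<omega>) (at_left 1))"
proof -
  have "max 0 (1 - \<delta>) \<in> {0..<1}" using \<delta> by auto
  from adapted_approximation[OF lc \<xi> this] obtain t \<zeta> B where
    "\<forall>n. max 0 (1 - \<delta>) \<le> t n \<and> t n < t (Suc n) \<and> t n < 1" and t_lim: "t \<longlonglongrightarrow> 1"
    and "\<forall>n. \<zeta> n \<in> borel_measurable (F (t n)) \<and> (\<forall>\<omega>\<in>space M. \<bar>\<zeta> n \<omega>\<bar> \<le> B n) \<and>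
      prob {\<omega>\<in>space M. \<bar>\<xi> \<omega> - \<zeta> n \<omega>\<bar> > (1/2) ^ n} < (1/2) ^ n"
    by (elim exE conjE)
  then have t: "max 0 (1 - \<delta>) \<le> t n" "t n < t (Suc n)" "t n < 1"
    and \<zeta>: "\<zeta> n \<in> borel_measurable (F (t n))" "\<omega> \<in> space M \<Longrightarrow> \<bar>\<zeta> n \<omega>\<bar> \<le> B n"
    "prob {\<omega>\<in>space M. \<bar>\<xi> \<omega> - \<zeta> n \<omega>\<bar> > (1/2) ^ n} < (1/2) ^ n" for n \<omega>
    by blast+
  have t01: "t n \<in> {0..1}" for n
    using t(1)[of n] t(3)[of n] by auto
  have t_mono: "m \<le> n \<Longrightarrow> t m \<le> t n" for m n
    using t(2) by (simp add: incseq_SucI less_imp_le incseqD)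
  obtain \<omega>0 where "\<omega>0 \<in> space M" using not_empty by blast
  then have B0: "B n \<ge> 0" for n
    using \<zeta>(2)[of \<omega>0 n] by linarith
  \<comment> \<open>\<open>W n\<close> bounds the integral at time \<open>t n\<close> whatever the stages are, since they only have to
    satisfy \<open>\<bar>\<rho> n\<bar> \<le> 2\<close>; so the accuracies \<open>\<eta> n\<close> can be fixed before the stages are chosen.\<close>
  define W where "W = rec_nat 0 (\<lambda>n w. w + 2 * (B n + w))"
  have W_0: "W 0 = 0" and W_Suc: "W (Suc n) = W n + 2 * (B n + W n)" for n
    by (simp_all add: W_def)
  have W0: "W n \<ge> 0" for n
    by (induction n) (use B0 in \<open>auto simp: W_0 W_Suc\<close>)
  define K where "K n = B n + W n" for n
  \<comment> \<open>\<open>K n\<close> bounds the distance to the target at stage \<open>n\<close>.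
    Dividing by \<open>1 + K n\<close> makes both \<eta> itself, a failure probability, and
    \<open>K n * \<eta> n\<close>, an absolute error, at most \<open>(1/2) ^ n\<close>.\<close>
  define \<eta> where "\<eta> n = (1/2) ^ n / (1 + K n)" for n
  have K0: "K n \<ge> 0" for n using B0[of n] W0[of n] by (simp add: K_def)
  have \<eta>0: "\<eta> n > 0" for n using K0[of n] by (simp add: \<eta>_def add_pos_nonneg)
  have \<eta>q: "\<eta> n \<le> (1/2) ^ n" "K n * \<eta> n \<le> (1/2) ^ n" for n
  proof -
    have "(1/2) ^ n * 1 \<le> (1/2) ^ n * (1 + K n)" "(1/2) ^ n * K n \<le> (1/2) ^ n * (1 + K n)"
      using K0[of n] by (intro mult_left_mono; simp)+
    then show "\<eta> n \<le> (1/2) ^ n" "K n * \<eta> n \<le> (1/2) ^ n"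
      using K0[of n] by (simp_all add: \<eta>_def pos_divide_le_eq add_pos_nonneg mult.commute)
  qed
  have \<eta>1: "\<eta> n \<le> 1" for n
    using \<eta>q(1)[of n] power_le_one[of "1/2::real" n] by linarith
  have "\<forall>n. \<exists>\<phi> \<rho>. stage (t n) (t (Suc n)) (\<eta> n) \<phi> \<rho>"
    using t \<eta>0 by (intro allI stage_exists) auto
  then obtain \<phi> \<rho> where st: "\<And>n. stage (t n) (t (Suc n)) (\<eta> n) (\<phi> n) (\<rho> n)"
    by metis
  have \<phi>_meas: "s \<in> {0..1} \<Longrightarrow> \<phi> n s \<in> borel_measurable (F s)"
    and \<phi>_zero: "s \<notin> {t n<..t (Suc n)} \<Longrightarrow> \<phi> n s \<omega> = 0"
    and \<phi>_gls: "\<omega> \<in> space M \<Longrightarrow> s \<in> {0..1} \<Longrightarrow> borel_gls (1/2) (\<lambda>s. \<phi> n s \<omega>) (\<lambda>s. X s \<omega>) 0 s (\<rho> n s \<omega>)"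
    and \<rho>_meas: "\<rho> n (t (Suc n)) \<in> borel_measurable (F (t (Suc n)))"
    and \<rho>_early: "s \<le> t n \<Longrightarrow> \<rho> n s \<omega> = 0"
    and \<rho>_late: "t (Suc n) \<le> s \<Longrightarrow> \<rho> n s \<omega> = \<rho> n (t (Suc n)) \<omega>"
    and \<rho>_bounds: "\<omega> \<in> space M \<Longrightarrow> s \<in> {t n..t (Suc n)} \<Longrightarrow> - \<eta> n \<le> \<rho> n s \<omega> \<and> \<rho> n s \<omega> \<le> 1 + \<eta> n"
    and \<rho>_prob: "prob {\<omega>\<in>space M. \<rho> n (t (Suc n)) \<omega> < 1 - \<eta> n} \<le> \<eta> n" for n s \<omega>
    using st[of n] unfolding stage_def by blast+
  \<comment> \<open>\<open>V n\<close> will be the value of the integral at \<open>t n\<close> (see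
    \<open>I_stage\<close>). The recursion gives its measurability and its bound by induction,
    before the integral is formed.\<close>
  define V where "V = rec_nat (\<lambda>\<omega>. 0) (\<lambda>n v \<omega>. v \<omega> + (\<zeta> n \<omega> - v \<omega>) * \<rho> n (t (Suc n)) \<omega>)"
  have V_0: "V 0 = (\<lambda>\<omega>. 0)"
    and V_Suc: "V (Suc n) = (\<lambda>\<omega>. V n \<omega> + (\<zeta> n \<omega> - V n \<omega>) * \<rho> n (t (Suc n)) \<omega>)" for n
    by (simp_all add: V_def)
  define D where "D n \<omega> = \<zeta> n \<omega> - V n \<omega>" for n \<omega>
  have V_meas: "V n \<in> borel_measurable (F (t n))" for n
  proof (induction n)
    case 0
    then show ?case by (simp add: V_0)
  next
    case (Suc n)
    have "V n \<in> borel_measurable (F (t (Suc n)))" "\<zeta> n \<in> borel_measurable (F (t (Suc n)))"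
      using Suc \<zeta>(1)[of n] t01 t(2)[of n] by (auto intro: measurable_F_mono less_imp_le)
    then show ?case
      unfolding V_Suc using \<rho>_meas by (intro borel_measurable_add borel_measurable_times borel_measurable_diff)
  qed
  have D_meas: "D n \<in> borel_measurable (F (t n))" for n
    unfolding D_def using V_meas \<zeta>(1) by (intro borel_measurable_diff)
  have V_bound: "\<bar>V n \<omega>\<bar> \<le> W n" if \<omega>: "\<omega> \<in> space M" for n \<omega>
  proof (induction n)
    case 0
    then show ?case by (simp add: V_0 W_0)
  next
    case (Suc n)
    have "\<bar>\<rho> n (t (Suc n)) \<omega>\<bar> \<le> 2"
      using \<rho>_bounds[OF \<omega>, of "t (Suc n)" n] t(2)[of n] \<eta>1[of n] \<eta>0[of n] by auto
    moreover have "\<bar>\<zeta> n \<omega> - V n \<omega>\<bar> \<le> B n + W n"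
      using \<zeta>(2)[OF \<omega>, of n] Suc by linarith
    ultimately have "\<bar>(\<zeta> n \<omega> - V n \<omega>) * \<rho> n (t (Suc n)) \<omega>\<bar> \<le> (B n + W n) * 2"
      unfolding abs_mult using B0[of n] W0[of n] by (intro mult_mono) auto
    then show ?case using Suc by (auto simp: V_Suc W_Suc)
  qed
  have D_bound: "\<bar>D n \<omega>\<bar> \<le> K n" if "\<omega> \<in> space M" for n \<omega>
    unfolding D_def K_def using V_bound[OF that, of n] \<zeta>(2)[OF that, of n] by linarith
  \<comment> \<open>The stages live on disjoint intervals, so at each time at most one summand is
    nonzero.\<close>
  define \<psi> where "\<psi> s \<omega> = (\<Sum>n. D n \<omega> * \<phi> n s \<omega>)" for s \<omega>
  define I where "I s \<omega> = (\<Sum>n. D n \<omega> * \<rho> n s \<omega>)" for s \<omega>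
  have \<psi>_fin: "\<psi> s \<omega> = (\<Sum>n<N. D n \<omega> * \<phi> n s \<omega>)" if "s \<le> t N" for s \<omega> N
    unfolding \<psi>_def
  proof (rule suminf_eq_sum_lessThan)
    fix n assume "n \<ge> N"
    then have "s \<le> t n" using t_mono[of N n] that by simp
    then show "D n \<omega> * \<phi> n s \<omega> = 0" by (simp add: \<phi>_zero)
  qed
  have I_fin: "I s \<omega> = (\<Sum>n<N. D n \<omega> * \<rho> n s \<omega>)" if "s \<le> t N" for s \<omega> N
    unfolding I_def
  proof (rule suminf_eq_sum_lessThan)
    fix n assume "n \<ge> N"
    then have "s \<le> t n" using t_mono[of N n] that by simp
    then show "D n \<omega> * \<rho> n s \<omega> = 0" by (simp add: \<rho>_early)
  qed
  have beyond: "\<exists>N. s < t N" if "s < 1" for s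
    using order_tendstoD(1)[OF t_lim that] by (auto simp: eventually_sequentially)
  have "adapted F \<psi>"
    unfolding adapted_def
  proof
    fix s :: real assume s: "s \<in> {0..1}"
    show "\<psi> s \<in> borel_measurable (F s)"
      unfolding \<psi>_def
    proof (rule borel_measurable_suminf)
      fix n show "(\<lambda>\<omega>. D n \<omega> * \<phi> n s \<omega>) \<in> borel_measurable (F s)"
      \<comment> \<open>Stage \<open>n\<close> is active only after \<open>t n\<close>, when its
        random factor \<open>D n\<close> is already known.\<close>
      proof (cases "s \<le> t n")
        case True
        then show ?thesis by (simp add: \<phi>_zero)
      next
        case False
        then have "D n \<in> borel_measurable (F s)"
          using s t01 by (intro measurable_F_mono[OF D_meas]) auto
        then show ?thesis
          using \<phi>_meas[OF s] by (intro borel_measurable_times)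
      qed
    qed
  qed
  have gls: "has_gls_integral \<alpha> (\<lambda>s. \<psi> s \<omega>) (\<lambda>s. X s \<omega>) 0 s (I s \<omega>)" if \<omega>: "\<omega> \<in> space M" and s: "s \<in> {0..<1}" for s \<omega>
  proof -
    obtain N where N: "s < t N" using beyond s by auto
    have s1: "s \<in> {0..1}" using s by auto
    have 1: "borel_gls (1/2) (\<lambda>s. \<Sum>n<N. D n \<omega> * \<phi> n s \<omega>) (\<lambda>s. X s \<omega>) 0 s (\<Sum>n<N. D n \<omega> * \<rho> n s \<omega>)"
      using \<phi>_gls[OF \<omega> s1] by (intro borel_gls_sum borel_gls_cmult)
    \<comment> \<open>The finite sum agrees with \<psi> only up to \<open>t N\<close>, so
      measurability on the whole line is taken from the series.\<close>
    have 2: "(\<lambda>s. \<psi> s \<omega>) \<in> borel_measurable borel"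
      unfolding \<psi>_def
      using \<phi>_gls[OF \<omega> s1] by (intro borel_measurable_suminf borel_measurable_times borel_measurable_const)
        (auto simp: borel_gls_def)
    have "borel_gls (1/2) (\<lambda>s. \<psi> s \<omega>) (\<lambda>s. X s \<omega>) 0 s (I s \<omega>)"
      unfolding I_fin[OF less_imp_le[OF N]]
      by (rule borel_gls_cong[OF 1 _ 2]) (use N in \<open>simp add: \<psi>_fin[of _ N]\<close>)
    then show ?thesis
      using hoelder_integrator_path[OF \<omega> s1] by (rule has_gls_integralI)
  qed
  have V_sum: "V n \<omega> = (\<Sum>i<n. D i \<omega> * \<rho> i (t (Suc i)) \<omega>)" for n \<omega>
    by (induction n) (simp_all add: V_0 V_Suc D_def)
  have I_stage: "I s \<omega> = V n \<omega> + D n \<omega> * \<rho> n s \<omega>" if s: "t n \<le> s" "s \<le> t (Suc n)" for n s \<omega>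
  proof -
    have "\<rho> i s \<omega> = \<rho> i (t (Suc i)) \<omega>" if "i < n" for i
      using t_mono[of "Suc i" n] that s by (intro \<rho>_late) auto
    then show ?thesis
      unfolding I_fin[OF s(2)] V_sum by simp
  qed
  define bad where "bad n = {\<omega>\<in>space M. \<bar>\<xi> \<omega> - \<zeta> n \<omega>\<bar> > (1/2) ^ n} \<union>
      {\<omega>\<in>space M. \<rho> n (t (Suc n)) \<omega> < 1 - \<eta> n}" for n
  have [measurable]: "\<xi> \<in> borel_measurable M" "\<zeta> n \<in> borel_measurable M"
    "\<rho> n (t (Suc n)) \<in> borel_measurable M" for n
    using measurable_F_M[OF \<xi>] measurable_F_M[OF \<zeta>(1) t01] measurable_F_M[OF \<rho>_meas t01] by auto
  have bad_sets: "bad n \<in> sets M" for n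
    unfolding bad_def by measurable
  have bad_le: "prob (bad n) \<le> 2 * (1/2) ^ n" for n
  proof -
    have "prob (bad n) \<le> prob {\<omega>\<in>space M. \<bar>\<xi> \<omega> - \<zeta> n \<omega>\<bar> > (1/2) ^ n} +
        prob {\<omega>\<in>space M. \<rho> n (t (Suc n)) \<omega> < 1 - \<eta> n}"
      unfolding bad_def by (intro measure_Un_le) measurable
    then show ?thesis
      using \<zeta>(3)[of n] \<rho>_prob[of n] \<eta>q(1)[of n] by linarith
  qed
  have "summable (\<lambda>n. 2 * (1/2) ^ n :: real)"
    by (intro summable_mult summable_geometric) auto
  then have "summable (\<lambda>n. prob (bad n))"
    by (rule summable_comparison_test') (use bad_le in auto)
  then have "AE \<omega> in M. eventually (\<lambda>n. \<omega> \<in> space M - bad n) sequentially"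
    using bad_sets by (intro borel_cantelli_AE1) (auto simp: emeasure_eq_measure)
  then have "AE \<omega> in M. \<exists>J. (\<forall>s\<in>{0..<1}. has_gls_integral \<alpha> (\<lambda>s. \<psi> s \<omega>) (\<lambda>s. X s \<omega>) 0 s (J s)) \<and>
              (J \<longlongrightarrow> \<xi> \<omega>) (at_left 1)"
  proof (rule AE_mp, intro AE_I2 impI)
    fix \<omega> assume \<omega>: "\<omega> \<in> space M" and "eventually (\<lambda>n. \<omega> \<in> space M - bad n) sequentially"
    then obtain n1 where n1: "\<And>n. n \<ge> n1 \<Longrightarrow> \<omega> \<notin> bad n"
      by (auto simp: eventually_sequentially)
    have good1: "\<bar>\<xi> \<omega> - \<zeta> n \<omega>\<bar> \<le> (1/2) ^ n" and good2: "\<rho> n (t (Suc n)) \<omega> \<ge> 1 - \<eta> n" if "n \<ge> n1" for n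
      using n1[OF that] \<omega> by (auto simp: bad_def not_less)
    \<comment> \<open>The upper half of the bound on \<open>\<rho> - 1\<close> holds on every path;
      the lower half is what a good stage adds.\<close>
    have hit: "\<bar>V (Suc n) \<omega> - \<zeta> n \<omega>\<bar> \<le> (1/2) ^ n" if "n \<ge> n1" for n
    proof -
      have "V (Suc n) \<omega> - \<zeta> n \<omega> = D n \<omega> * (\<rho> n (t (Suc n)) \<omega> - 1)"
        by (simp add: V_Suc D_def algebra_simps)
      moreover have "\<bar>\<rho> n (t (Suc n)) \<omega> - 1\<bar> \<le> \<eta> n"
        using good2[OF that] \<rho>_bounds[OF \<omega>, of "t (Suc n)" n] t(2)[of n] by auto
      ultimately have "\<bar>V (Suc n) \<omega> - \<zeta> n \<omega>\<bar> \<le> K n * \<eta> n"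
        unfolding abs_mult using D_bound[OF \<omega>, of n] K0[of n] by (auto intro: mult_mono simp: abs_mult)
      then show ?thesis using \<eta>q(2)[of n] by linarith
    qed
    \<comment> \<open>During stage \<open>Suc m\<close> the distance to
      \<open>\<zeta> (Suc m)\<close> is at most \<open>\<bar>D (Suc m) \<omega>\<bar>\<close> plus a
      small error, because \<rho> stays near [0,1]. That distance is small since stage
      \<open>m\<close> ended near \<open>\<zeta> m\<close> and both approximations are near \<xi>.
      The errors add up to 7/2 times \<open>(1/2) ^ m\<close>, within the factor 5.\<close>
    have close: "\<bar>I s \<omega> - \<xi> \<omega>\<bar> \<le> 5 * (1/2) ^ m" if m: "m \<ge> n1" and s: "t (Suc m) \<le> s" "s \<le> t (Suc (Suc m))" for m s
    proof -
      let ?n = "Suc m"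
      have half: "(1/2::real) ^ ?n = (1/2) ^ m / 2" by simp
      have "I s \<omega> - \<zeta> ?n \<omega> = D ?n \<omega> * (\<rho> ?n s \<omega> - 1)"
        unfolding I_stage[OF s] by (simp add: D_def algebra_simps)
      moreover have "\<bar>\<rho> ?n s \<omega> - 1\<bar> \<le> 1 + \<eta> ?n"
        using \<rho>_bounds[OF \<omega>, of s ?n] s \<eta>0[of ?n] by auto
      then have "\<bar>D ?n \<omega>\<bar> * \<bar>\<rho> ?n s \<omega> - 1\<bar> \<le> \<bar>D ?n \<omega>\<bar> * (1 + \<eta> ?n)"
        by (intro mult_left_mono) auto
      moreover have "\<bar>D ?n \<omega>\<bar> * \<eta> ?n \<le> K ?n * \<eta> ?n"
        using D_bound[OF \<omega>] \<eta>0[of ?n] by (intro mult_right_mono) auto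
      ultimately have 1: "\<bar>I s \<omega> - \<zeta> ?n \<omega>\<bar> \<le> \<bar>D ?n \<omega>\<bar> + (1/2) ^ ?n"
        using \<eta>q(2)[of ?n] by (simp add: abs_mult distrib_left)
      have "\<bar>\<xi> \<omega> - \<zeta> ?n \<omega>\<bar> \<le> (1/2) ^ ?n" "\<bar>\<xi> \<omega> - \<zeta> m \<omega>\<bar> \<le> (1/2) ^ m" "\<bar>V ?n \<omega> - \<zeta> m \<omega>\<bar> \<le> (1/2) ^ m"
        using good1[of ?n] good1[of m] hit[of m] m by auto
      then show ?thesis
        using 1 unfolding D_def half by linarith
    qed
    have close': "\<bar>I s \<omega> - \<xi> \<omega>\<bar> \<le> 5 * (1/2) ^ m" if m: "m \<ge> n1" and s: "t (Suc m) \<le> s" "s < 1" for m s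
    proof -
      \<comment> \<open>The least \<open>n\<close> with \<open>s < t n\<close> locates the stage
        containing \<open>s\<close>; it exceeds \<open>Suc m\<close>, so it has the form
        \<open>Suc (Suc k)\<close> with \<open>k \<ge> m\<close>.\<close>
      define n where "n = (LEAST n. s < t n)"
      have n: "s < t n"
        unfolding n_def using beyond[OF s(2)] by (rule LeastI_ex)
      have "Suc m < n"
        using n s(1) t_mono[of n "Suc m"] by (cases "Suc m < n") auto
      then obtain k where k: "n = Suc (Suc k)" "k \<ge> m"
        by (cases n; cases "n - 1") auto
      have "\<not> s < t (Suc k)"
        using not_less_Least[of "Suc k" "\<lambda>n. s < t n"] k unfolding n_def[symmetric] by auto
      then have "\<bar>I s \<omega> - \<xi> \<omega>\<bar> \<le> 5 * (1/2) ^ k"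
        using close[of k s] k m n by auto
      also have "\<dots> \<le> 5 * (1/2) ^ m"
        using k power_decreasing[of m k "1/2::real"] by auto
      finally show ?thesis .
    qed
    have "((\<lambda>s. I s \<omega>) \<longlongrightarrow> \<xi> \<omega>) (at_left 1)"
    proof (rule tendstoI)
      fix e :: real assume "e > 0"
      have "(\<lambda>n. 5 * (1/2) ^ n :: real) \<longlonglongrightarrow> 5 * 0"
        by (intro tendsto_intros LIMSEQ_power_zero) auto
      then have "\<forall>\<^sub>F n in sequentially. 5 * (1/2) ^ n < e"
        using \<open>e > 0\<close> by (intro order_tendstoD) auto
      then have "\<forall>\<^sub>F n in sequentially. n \<ge> n1 \<and> 5 * (1/2) ^ n < e"
        by (intro eventually_conj eventually_ge_at_top)
      then obtain m where m: "m \<ge> n1" "5 * (1/2) ^ m < e"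
        using eventually_happens'[OF sequentially_bot] by blast
      have "\<forall>\<^sub>F s in at_left 1. s \<in> {t (Suc m)<..<1}"
        by (rule eventually_at_left_real[OF t(3)])
      then show "\<forall>\<^sub>F s in at_left 1. dist (I s \<omega>) (\<xi> \<omega>) < e"
      proof (eventually_elim)
        case (elim s)
        then show ?case using close'[OF m(1), of s] m(2) by (auto simp: dist_real_def)
      qed
    qed
    then show "\<exists>J. (\<forall>s\<in>{0..<1}. has_gls_integral \<alpha> (\<lambda>s. \<psi> s \<omega>) (\<lambda>s. X s \<omega>) 0 s (J s)) \<and>
              (J \<longlongrightarrow> \<xi> \<omega>) (at_left 1)"
      using gls[OF \<omega>] by (intro exI[of _ "\<lambda>s. I s \<omega>"]) auto
  qed
  with \<open>adapted F \<psi>\<close> show ?thesis by blast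
qed

end

theorem theorem4p2:
  fixes M :: "'a measure" and F :: "real \<Rightarrow> 'a measure"
    and X :: "real \<Rightarrow> 'a \<Rightarrow> real" and \<xi> :: "'a \<Rightarrow> real"
    and \<alpha> \<delta> C1 C2 :: real
  assumes "stochastic_basis M F"
    and "left_continuous_at_1 M F"
    and "adapted F X"
    and "\<alpha> > 1/2" and "\<delta> > 0" and "C1 > 0" and "C2 > 0"
    and "\<And>\<omega> s t. \<omega> \<in> space M \<Longrightarrow> s \<in> {0..1} \<Longrightarrow> t \<in> {0..1} \<Longrightarrow>
           \<bar>X t \<omega> - X s \<omega>\<bar> \<le> C1 * \<bar>t - s\<bar> powr \<alpha>"
    and "\<And>s t \<Delta> \<epsilon>. s \<in> {1 - \<delta>..1} \<inter> {0..1} \<Longrightarrow> t \<in> {1 - \<delta>..1} \<inter> {0..1} \<Longrightarrow>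
           t = s + \<Delta> \<Longrightarrow> \<Delta> > 0 \<Longrightarrow> \<epsilon> > 0 \<Longrightarrow> \<epsilon> \<le> \<Delta> powr \<alpha> \<Longrightarrow>
           measure M {\<omega> \<in> space M. (SUP u\<in>{s..t}. \<bar>X u \<omega> - X s \<omega>\<bar>) \<le> \<epsilon>}
             \<le> exp (- C2 * \<Delta> * \<epsilon> powr (- 1 / \<alpha>))"
    and "\<xi> \<in> borel_measurable (F 1)"
  shows "\<exists>\<psi>. adapted F \<psi> \<and>
           (AE \<omega> in M. \<exists>I. (\<forall>t\<in>{0..<1}. has_gls_integral \<alpha> (\<lambda>s. \<psi> s \<omega>) (\<lambda>s. X s \<omega>) 0 t (I t)) \<and>
              (I \<longlongrightarrow> \<xi> \<omega>) (at_left 1))"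
proof -
  interpret prob_space M
    using assms(1) by (simp add: stochastic_basis_def)
  interpret hoelder_process M F X \<alpha> \<delta> C1 C2
  proof
    show "subalgebra M (F t)" if "t \<in> {0..1}" for t
      using assms(1) that by (auto simp: stochastic_basis_def)
    show "sets (F s) \<subseteq> sets (F t)" if "s \<in> {0..1}" "t \<in> {0..1}" "s \<le> t" for s t
      using assms(1) that by (auto simp: stochastic_basis_def)
    show "X t \<in> borel_measurable (F t)" if "t \<in> {0..1}" for t
      using assms(3) that by (auto simp: adapted_def)
    show "prob {\<omega> \<in> space M. (SUP u\<in>{s..t}. \<bar>X u \<omega> - X s \<omega>\<bar>) \<le> \<epsilon>}
        \<le> exp (- C2 * (t - s) * \<epsilon> powr (- 1 / \<alpha>))"
      if "s \<in> {1 - \<delta>..1} \<inter> {0..1}" "t \<in> {1 - \<delta>..1} \<inter> {0..1}" "s < t" "\<epsilon> > 0" "\<epsilon> \<le> (t - s) powr \<alpha>" for s t \<epsilon>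
      using that by (intro assms(9)) auto
  qed (use assms in auto)
  show ?thesis
    using representation[OF assms(2,10)] .
qed

end
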